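(* The normalized Haar basis $(h_I/|I|)_{I\in\mathcal D}$ is strategically reproducible in the dyadic Hardy space $H^1$.
   Context: All Banach spaces are real. $\mathcal D$ is the set of dyadic intervals $[\frac{i-1}{2^j},\frac{i}{2^j})$, $j\ge0$, $1\le i\le2^j$, linearly ordered by the bijection $\mathcal O:\mathcal D\to\mathbb N$, $[\frac{i-1}{2^j},\frac i{2^j})\mapsto 2^j+i-1$. For $I\in\mathcal D$ with left half $I^+$ and right half $I^-$, $h_I=\chi_{I^+}-\chi_{I^-}$. $H^1$ is the completion of $\mathrm{span}\{h_I:I\in\mathcal D\}$ under the norm $\|\sum a_Ih_I\|_{H^1}=\|(\sum a_I^2h_I^2)^{1/2}\|_{L^1}$. The system $e_I=h_I/|I|$, enumerated via $\mathcal O$, is a normalized $1$-unconditional basis of $H^1$. Impartial equivalence: sequences $(x_i)$, $(y_i)$ in Banach spaces are impartially $C$-equivalent if $\frac1{\sqrt C}\|\sum a_iy_i\|\le\|\sum a_ix_i\|\le\sqrt C\|\sum a_iy_i\|$ for all finitely supported real sequences $(a_i)$. Strategical reproducibility (for unconditional bases): let $X$ be a Banach space with an unconditional basis $(e_i)_{i\in\mathbb N}$ and biorthogonal functionals $(e_i^* )\subset X^*$. $\mathrm{cof}(X)$ is the set of closed finite-codimensional subspaces of $X$ and $\mathrm{cof}_{w^*}(X^* )$ the set of $w^*$-closed finite-codimensional subspaces of $X^*$. For $C\ge1$ the two-player game $\mathrm{Rep}_{(X,(e_i))}(C)$ has turns $k\in\mathbb N$, each with three steps. Step 1: player (I) chooses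 $\eta_k>0$, $W_k\in\mathrm{cof}(X)$, $G_k\in\mathrm{cof}_{w^*}(X^* )$. Step 2: player (II) chooses a finite set $E_k\subset\mathbb N$ and non-negative reals $(\lambda_i^{(k)})_{i\in E_k}$, $(\mu_i^{(k)})_{i\in E_k}$ with $\sum_{i\in E_k}\lambda_i^{(k)}\mu_i^{(k)}=1$. Step 3: player (I) chooses signs $(\varepsilon_i^{(k)})_{i\in E_k}\in\{-1,1\}^{E_k}$. Put $x_k=\sum_{i\in E_k}\varepsilon_i^{(k)}\lambda_i^{(k)}e_i$, $x_k^*=\sum_{i\in E_k}\varepsilon_i^{(k)}\mu_i^{(k)}e_i^*$. Player (II) wins if (i) $(x_k)$ and $(e_k)$ are impartially $C$-equivalent; (ii) $(x_k^* )$ and $(e_k^* )$ are impartially $C$-equivalent; (iii) $\mathrm{dist}(x_k,W_k)<\eta_k$ for all $k$; (iv) $\mathrm{dist}(x_k^*,G_k)<\eta_k$ for all $k$. The basis is $C$-strategically reproducible if for every $\eta>0$ player (II) has a winning strategy in $\mathrm{Rep}_{(X,(e_i))}(C+\eta)$, and strategically reproducible if it is $C$-strategically reproducible for some $C\ge1$. *)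

theory Defs
  imports "HOL-Analysis.Analysis"
begin

section \<open>Completion of a normed space\<close>

definition completion_rel :: "(nat \<Rightarrow> 'a::real_normed_vector) \<Rightarrow> (nat \<Rightarrow> 'a) \<Rightarrow> bool" where
  "completion_rel X Y \<longleftrightarrow> Cauchy X \<and> Cauchy Y \<and> (\<lambda>n. X n - Y n) \<longlonglongrightarrow> 0"

lemma Cauchy_const_vec: "Cauchy (\<lambda>n. c :: 'a::real_normed_vector)"
  by (simp add: Cauchy_def)

lemma Cauchy_add_vec:
  fixes X Y :: "nat \<Rightarrow> 'a::real_normed_vector"
  assumes "Cauchy X" "Cauchy Y"
  shows "Cauchy (\<lambda>n. X n + Y n)"
proof (rule CauchyI)
  fix e :: real assume e: "0 < e"
  obtain M where M: "\<forall>m\<ge>M. \<forall>n\<ge>M. norm (X m - X n) < e/2" using CauchyD[OF assms(1), of "e/2"] e by auto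
  obtain N where N: "\<forall>m\<ge>N. \<forall>n\<ge>N. norm (Y m - Y n) < e/2" using CauchyD[OF assms(2), of "e/2"] e by auto
  have "norm (X m + Y m - (X n + Y n)) < e" if "m \<ge> max M N" "n \<ge> max M N" for m n
  proof -
    have "norm (X m + Y m - (X n + Y n)) \<le> norm (X m - X n) + norm (Y m - Y n)"
      by (rule norm_diff_triangle_ineq)
    moreover have "norm (X m - X n) < e/2" "norm (Y m - Y n) < e/2" using M N that by auto
    ultimately show ?thesis by linarith
  qed
  then show "\<exists>M. \<forall>m\<ge>M. \<forall>n\<ge>M. norm (X m + Y m - (X n + Y n)) < e" by blast
qed

lemma Cauchy_scaleR_vec:
  fixes X :: "nat \<Rightarrow> 'a::real_normed_vector"
  assumes "Cauchy X"
  shows "Cauchy (\<lambda>n. r *\<^sub>R X n)"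
  using bounded_linear.Cauchy[OF bounded_linear_scaleR_right assms] .

lemma Cauchy_uminus_vec:
  fixes X :: "nat \<Rightarrow> 'a::real_normed_vector"
  assumes "Cauchy X"
  shows "Cauchy (\<lambda>n. - X n)"
  using Cauchy_scaleR_vec[OF assms, of "-1"] by simp

lemma Cauchy_minus_vec:
  fixes X Y :: "nat \<Rightarrow> 'a::real_normed_vector"
  assumes "Cauchy X" "Cauchy Y"
  shows "Cauchy (\<lambda>n. X n - Y n)"
  using Cauchy_add_vec[OF assms(1) Cauchy_uminus_vec[OF assms(2)]] by simp

lemma convergent_norm_vec:
  fixes X :: "nat \<Rightarrow> 'a::real_normed_vector"
  assumes "Cauchy X"
  shows "convergent (\<lambda>n. norm (X n))"
proof -
  have "Cauchy (\<lambda>n. norm (X n))"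
  proof (rule CauchyI)
    fix e :: real assume "0 < e"
    then obtain M where M: "\<forall>m\<ge>M. \<forall>n\<ge>M. norm (X m - X n) < e" using CauchyD[OF assms] by blast
    have "norm (norm (X m) - norm (X n)) < e" if "m \<ge> M" "n \<ge> M" for m n
      using M that norm_triangle_ineq3[of "X m" "X n"] by (metis le_less_trans real_norm_def)
    then show "\<exists>M. \<forall>m\<ge>M. \<forall>n\<ge>M. norm (norm (X m) - norm (X n)) < e" by blast
  qed
  then show ?thesis by (rule real_Cauchy_convergent)
qed

quotient_type (overloaded) 'a banach_completion =
  "nat \<Rightarrow> 'a::real_normed_vector" / partial: completion_rel
  morphisms rep_completion abs_completion
proof (rule part_equivpI)
  show "\<exists>x::nat \<Rightarrow> 'a. completion_rel x x"
    by (rule exI[of _ "\<lambda>_. 0"]) (simp add: completion_rel_def Cauchy_const_vec)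
  show "symp (completion_rel :: (nat \<Rightarrow> 'a) \<Rightarrow> _)"
  proof (rule sympI)
    fix X Y :: "nat \<Rightarrow> 'a" assume "completion_rel X Y"
    then show "completion_rel Y X"
      using tendsto_minus[of "\<lambda>n. X n - Y n" 0 sequentially] by (simp add: completion_rel_def)
  qed
  show "transp (completion_rel :: (nat \<Rightarrow> 'a) \<Rightarrow> _)"
  proof (rule transpI)
    fix X Y Z :: "nat \<Rightarrow> 'a" assume "completion_rel X Y" "completion_rel Y Z"
    then show "completion_rel X Z"
      using tendsto_add[of "\<lambda>n. X n - Y n" 0 sequentially "\<lambda>n. Y n - Z n" 0]
      by (simp add: completion_rel_def)
  qed
qed

instantiation banach_completion :: (real_normed_vector) real_vector
begin

lift_definition zero_banach_completion :: "'a banach_completion" is "\<lambda>_. 0"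
  by (simp add: completion_rel_def Cauchy_const_vec)

lift_definition plus_banach_completion :: "'a banach_completion \<Rightarrow> 'a banach_completion \<Rightarrow> 'a banach_completion"
  is "\<lambda>X Y n. X n + Y n"
  unfolding completion_rel_def
proof (elim conjE, intro conjI)
  fix X X' Y Y' :: "nat \<Rightarrow> 'a"
  assume "(\<lambda>n. X n - X' n) \<longlonglongrightarrow> 0" "(\<lambda>n. Y n - Y' n) \<longlonglongrightarrow> 0"
  from tendsto_add[OF this] show "(\<lambda>n. X n + Y n - (X' n + Y' n)) \<longlonglongrightarrow> 0"
    by (simp add: algebra_simps)
qed (auto intro: Cauchy_add_vec)

lift_definition minus_banach_completion :: "'a banach_completion \<Rightarrow> 'a banach_completion \<Rightarrow> 'a banach_completion"
  is "\<lambda>X Y n. X n - Y n"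
  unfolding completion_rel_def
proof (elim conjE, intro conjI)
  fix X X' Y Y' :: "nat \<Rightarrow> 'a"
  assume "(\<lambda>n. X n - X' n) \<longlonglongrightarrow> 0" "(\<lambda>n. Y n - Y' n) \<longlonglongrightarrow> 0"
  from tendsto_diff[OF this] show "(\<lambda>n. X n - Y n - (X' n - Y' n)) \<longlonglongrightarrow> 0"
    by (simp add: algebra_simps)
qed (auto intro: Cauchy_minus_vec)

lift_definition uminus_banach_completion :: "'a banach_completion \<Rightarrow> 'a banach_completion"
  is "\<lambda>X n. - X n"
  unfolding completion_rel_def
proof (elim conjE, intro conjI)
  fix X X' :: "nat \<Rightarrow> 'a"
  assume "(\<lambda>n. X n - X' n) \<longlonglongrightarrow> 0"
  from tendsto_minus[OF this] show "(\<lambda>n. - X n - - X' n) \<longlonglongrightarrow> 0" by simp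
qed (auto intro: Cauchy_uminus_vec)

lift_definition scaleR_banach_completion :: "real \<Rightarrow> 'a banach_completion \<Rightarrow> 'a banach_completion"
  is "\<lambda>r X n. r *\<^sub>R X n"
  unfolding completion_rel_def
proof (elim conjE, intro conjI)
  fix r and X X' :: "nat \<Rightarrow> 'a"
  assume "(\<lambda>n. X n - X' n) \<longlonglongrightarrow> 0"
  from tendsto_scaleR[OF tendsto_const this] show "(\<lambda>n. r *\<^sub>R X n - r *\<^sub>R X' n) \<longlonglongrightarrow> 0"
    by (simp add: scaleR_diff_right)
qed (auto intro: Cauchy_scaleR_vec)

instance
proof
  fix x y z :: "'a banach_completion" and a b :: real
  show "x + y + z = x + (y + z)"
    by transfer (auto simp: completion_rel_def algebra_simps intro: Cauchy_add_vec)
  show "x + y = y + x"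
    by transfer (auto simp: completion_rel_def algebra_simps intro: Cauchy_add_vec)
  show "0 + x = x"
    by transfer (auto simp: completion_rel_def)
  show "- x + x = 0"
    by transfer (auto simp: completion_rel_def Cauchy_const_vec)
  show "x - y = x + - y"
    by transfer (auto simp: completion_rel_def intro: Cauchy_minus_vec)
  show "a *\<^sub>R (x + y) = a *\<^sub>R x + a *\<^sub>R y"
    by transfer (auto simp: completion_rel_def scaleR_add_right intro: Cauchy_add_vec Cauchy_scaleR_vec)
  show "(a + b) *\<^sub>R x = a *\<^sub>R x + b *\<^sub>R x"
    by transfer (auto simp: completion_rel_def scaleR_add_left intro: Cauchy_add_vec Cauchy_scaleR_vec)
  show "a *\<^sub>R b *\<^sub>R x = (a * b) *\<^sub>R x"
    by transfer (auto simp: completion_rel_def intro: Cauchy_scaleR_vec)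
  show "1 *\<^sub>R x = x"
    by transfer (auto simp: completion_rel_def)
qed

end

instantiation banach_completion :: (real_normed_vector) real_normed_vector
begin

lift_definition norm_banach_completion :: "'a banach_completion \<Rightarrow> real" is "\<lambda>X. lim (\<lambda>n. norm (X n))"
proof -
  fix X X' :: "nat \<Rightarrow> 'a" assume r: "completion_rel X X'"
  then obtain l where l: "(\<lambda>n. norm (X n)) \<longlonglongrightarrow> l"
    using convergent_norm_vec by (auto simp: completion_rel_def convergent_def)
  have "(\<lambda>n. norm (X n - X' n)) \<longlonglongrightarrow> 0"
    using r by (auto simp: completion_rel_def intro: tendsto_norm_zero)
  then have "(\<lambda>n. norm (X n) - norm (X' n)) \<longlonglongrightarrow> 0"
    by (rule Lim_null_comparison[rotated])
      (auto simp: norm_triangle_ineq3 intro!: always_eventually norm_triangle_ineq3)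
  from tendsto_diff[OF l this] have "(\<lambda>n. norm (X' n)) \<longlonglongrightarrow> l" by simp
  with l show "lim (\<lambda>n. norm (X n)) = lim (\<lambda>n. norm (X' n))" by (simp add: limI)
qed

definition dist_banach_completion :: "'a banach_completion \<Rightarrow> 'a banach_completion \<Rightarrow> real"
  where "dist_banach_completion x y = norm (x - y)"

definition sgn_banach_completion :: "'a banach_completion \<Rightarrow> 'a banach_completion"
  where "sgn_banach_completion x = scaleR (inverse (norm x)) x"

definition uniformity_banach_completion :: "('a banach_completion \<times> 'a banach_completion) filter"
  where "uniformity_banach_completion = (INF e\<in>{0 <..}. principal {(x, y). dist x y < e})"

definition open_banach_completion :: "'a banach_completion set \<Rightarrow> bool"
  where "open_banach_completion U = (\<forall>x\<in>U. \<forall>\<^sub>F (x', y) in uniformity. x' = x \<longrightarrow> y \<in> U)"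

instance
proof
  fix x y z :: "'a banach_completion" and a b :: real
  show "dist x y = norm (x - y)" by (rule dist_banach_completion_def)
  show "sgn x = x /\<^sub>R norm x" by (rule sgn_banach_completion_def)
  show "uniformity = (INF e\<in>{0 <..}. principal {(x, y :: 'a banach_completion). dist x y < e})"
    by (rule uniformity_banach_completion_def)
  show "open U = (\<forall>x\<in>U. \<forall>\<^sub>F (x', y) in uniformity. x' = x \<longrightarrow> y \<in> U)" for U :: "'a banach_completion set"
    by (rule open_banach_completion_def)
  show "norm x = 0 \<longleftrightarrow> x = 0"
  proof (transfer, goal_cases)
    case (1 X)
    then have c: "Cauchy X" by (simp add: completion_rel_def)
    have "lim (\<lambda>n. norm (X n)) = 0 \<longleftrightarrow> (\<lambda>n. norm (X n)) \<longlonglongrightarrow> 0"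
      using convergent_norm_vec[OF c] by (metis convergent_LIMSEQ_iff limI)
    then show ?case using c by (simp add: completion_rel_def Cauchy_const_vec tendsto_norm_zero_iff)
  qed
  show "norm (x + y) \<le> norm x + norm y"
  proof (transfer, goal_cases)
    case (1 X Y)
    then have c: "Cauchy X" "Cauchy Y" by (auto simp: completion_rel_def)
    have 1: "(\<lambda>n. norm (X n)) \<longlonglongrightarrow> lim (\<lambda>n. norm (X n))" "(\<lambda>n. norm (Y n)) \<longlonglongrightarrow> lim (\<lambda>n. norm (Y n))"
      "(\<lambda>n. norm (X n + Y n)) \<longlonglongrightarrow> lim (\<lambda>n. norm (X n + Y n))"
      using convergent_norm_vec Cauchy_add_vec c by (auto simp: convergent_LIMSEQ_iff[symmetric])
    show ?case
      by (rule LIMSEQ_le[OF 1(3) tendsto_add[OF 1(1,2)]]) (auto intro: norm_triangle_ineq)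
  qed
  show "norm (a *\<^sub>R x) = \<bar>a\<bar> * norm x"
  proof (transfer, goal_cases)
    case (1 a X)
    then have "(\<lambda>n. norm (X n)) \<longlonglongrightarrow> lim (\<lambda>n. norm (X n))"
      using convergent_norm_vec by (auto simp: convergent_LIMSEQ_iff[symmetric] completion_rel_def)
    from tendsto_mult_left[OF this, of "\<bar>a\<bar>"] show ?case by (simp add: limI)
  qed
qed

end

lift_definition completion_embed :: "'a::real_normed_vector \<Rightarrow> 'a banach_completion" is "\<lambda>x _. x"
  by (simp add: completion_rel_def Cauchy_const_vec)

lemma norm_completion_embed [simp]: "norm (completion_embed x) = norm x"
  by transfer (simp add: limI)

lemma completion_embed_add: "completion_embed (x + y) = completion_embed x + completion_embed y"
  by transfer (simp add: completion_rel_def Cauchy_const_vec)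

lemma completion_embed_scaleR: "completion_embed (r *\<^sub>R x) = r *\<^sub>R completion_embed x"
  by transfer (simp add: completion_rel_def Cauchy_const_vec)

lemma bounded_linear_completion_embed: "bounded_linear completion_embed"
  by (rule bounded_linear_intro[where K = 1]) (auto simp: completion_embed_add completion_embed_scaleR)

lemma completion_embed_diff: "completion_embed (x - y) = completion_embed x - completion_embed y"
  by (rule linear_diff[OF bounded_linear.linear[OF bounded_linear_completion_embed]])

lemma completion_embed_tendsto:
  assumes "Cauchy X"
  shows "(\<lambda>n. completion_embed (X n)) \<longlonglongrightarrow> abs_completion X"
proof (rule LIMSEQ_I)
  fix e :: real assume e: "0 < e"
  then obtain M where M: "\<And>m n. m\<ge>M \<Longrightarrow> n\<ge>M \<Longrightarrow> norm (X m - X n) < e/2" using CauchyD[OF assms, of "e/2"] by auto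
  have "norm (completion_embed (X m) - abs_completion X) < e" if m: "m \<ge> M" for m
  proof -
    have c: "Cauchy (\<lambda>n. X m - X n)" by (intro Cauchy_minus_vec Cauchy_const_vec assms)
    have "completion_embed (X m) - abs_completion X = abs_completion (\<lambda>n. X m - X n)"
      using assms by (simp add: completion_embed.abs_eq minus_banach_completion.abs_eq completion_rel_def eq_onp_def Cauchy_const_vec)
    then have "norm (completion_embed (X m) - abs_completion X) = lim (\<lambda>n. norm (X m - X n))"
      using c by (simp add: norm_banach_completion.abs_eq completion_rel_def eq_onp_def)
    also have "\<dots> \<le> e/2"
    proof (rule LIMSEQ_le_const2)
      show "(\<lambda>n. norm (X m - X n)) \<longlonglongrightarrow> lim (\<lambda>n. norm (X m - X n))"
        using convergent_norm_vec[OF c] by (simp add: convergent_LIMSEQ_iff)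
      show "\<exists>N. \<forall>n\<ge>N. norm (X m - X n) \<le> e/2" using M m less_imp_le by blast
    qed
    finally show ?thesis using e by linarith
  qed
  then show "\<exists>M. \<forall>n\<ge>M. norm (completion_embed (X n) - abs_completion X) < e" by blast
qed

lemma completion_approx:
  assumes "0 < e"
  shows "\<exists>y. norm (x - completion_embed y) < e"
proof -
  have "\<exists>X. Cauchy X \<and> x = abs_completion X"
    by (induction x rule: banach_completion.abs_induct) (auto simp: completion_rel_def)
  then obtain X where X: "Cauchy X" "x = abs_completion X" by blast
  from LIMSEQ_D[OF completion_embed_tendsto[OF X(1)] assms] show ?thesis
    unfolding X(2) using norm_minus_commute[of "abs_completion X"] by auto
qed

lemma closure_range_completion_embed: "closure (range completion_embed) = UNIV"
proof -
  have "x \<in> closure (range completion_embed)" for x :: "'a banach_completion"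
    using completion_approx[of _ x] by (auto simp: closure_approachable dist_norm norm_minus_commute)
  then show ?thesis by auto
qed

instance banach_completion :: (real_normed_vector) banach
proof
  fix x :: "nat \<Rightarrow> 'a banach_completion" assume cx: "Cauchy x"
  have "\<exists>y. norm (x n - completion_embed y) < inverse (real (Suc n))" for n
    by (rule completion_approx) simp
  then obtain Y where Y: "\<And>n. norm (x n - completion_embed (Y n)) < inverse (real (Suc n))" by metis
  have d0: "(\<lambda>n. x n - completion_embed (Y n)) \<longlonglongrightarrow> 0"
    by (rule Lim_null_comparison[OF _ LIMSEQ_inverse_real_of_nat]) (intro always_eventually allI less_imp_le[OF Y])
  then have "Cauchy (\<lambda>n. x n - completion_embed (Y n))" by (rule LIMSEQ_imp_Cauchy)
  from Cauchy_minus_vec[OF cx this] have "Cauchy (\<lambda>n. completion_embed (Y n))" by simp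
  then have "Cauchy Y"
    by (simp add: Cauchy_def dist_norm flip: completion_embed_diff)
  from tendsto_add[OF d0 completion_embed_tendsto[OF this]]
  show "convergent x" by (auto simp: convergent_def)
qed


section \<open>Dyadic intervals and Haar functions\<close>

definition dyadic_interval :: "nat \<Rightarrow> nat \<Rightarrow> real set" where
  "dyadic_interval j i = {(real i - 1) / 2 ^ j ..< real i / 2 ^ j}"

definition dyadic_intervals :: "real set set" where
  "dyadic_intervals = {dyadic_interval j i | j i. 1 \<le> i \<and> i \<le> 2 ^ j}"

definition dyadic_rank :: "real set \<Rightarrow> nat" where
  "dyadic_rank I = (THE m. \<exists>j i. 1 \<le> i \<and> i \<le> 2 ^ j \<and> I = dyadic_interval j i \<and> m = 2 ^ j + i - 1)"

text \<open>The rank takes the values \<open>1, 2, \<dots>\<close>; sequences in this theory start at index \<open>0\<close>.\<close>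

definition nth_dyadic :: "nat \<Rightarrow> real set" where
  "nth_dyadic n = inv_into dyadic_intervals dyadic_rank (Suc n)"

text \<open>For a dyadic interval \<open>(Inf I + Sup I) / 2\<close> is its midpoint. The Haar functions are
  defined on the whole line and vanish outside \<open>[0, 1)\<close>.\<close>

definition left_half :: "real set \<Rightarrow> real set" where
  "left_half I = {x \<in> I. x < (Inf I + Sup I) / 2}"

definition right_half :: "real set \<Rightarrow> real set" where
  "right_half I = {x \<in> I. (Inf I + Sup I) / 2 \<le> x}"

definition haar :: "real set \<Rightarrow> real \<Rightarrow> real" where
  "haar I x = indicator (left_half I) x - indicator (right_half I) x"

lemma mem_dyadic_interval: "x \<in> dyadic_interval j i \<longleftrightarrow> \<lfloor>2 ^ j * x\<rfloor> = int i - 1"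
  unfolding dyadic_interval_def floor_eq_iff by (auto simp: field_simps)

lemma dyadic_interval_nonempty: "(real i - 1) / 2 ^ j < real i / 2 ^ j"
  by (simp add: field_simps)

lemma measure_dyadic_interval: "measure lborel (dyadic_interval j i) = 1 / 2 ^ j"
  using dyadic_interval_nonempty[of i j] by (simp add: dyadic_interval_def field_simps)

lemma dyadic_interval_inject:
  assumes "dyadic_interval j i = dyadic_interval j' i'"
  shows "j = j'" "i = i'"
proof -
  have "(1::real) / 2 ^ j = 1 / 2 ^ j'" using assms by (metis measure_dyadic_interval)
  then show j: "j = j'" by simp
  have "\<lfloor>2 ^ j * ((real i - 1) / 2 ^ j)\<rfloor> = int i - 1" by (simp add: floor_eq_iff)
  then have "(real i - 1) / 2 ^ j \<in> dyadic_interval j i" by (simp only: mem_dyadic_interval)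
  then have "(real i - 1) / 2 ^ j \<in> dyadic_interval j i'" using assms j by simp
  then have "\<lfloor>2 ^ j * ((real i - 1) / 2 ^ j)\<rfloor> = int i' - 1" by (simp only: mem_dyadic_interval)
  moreover have "2 ^ j * ((real i - 1) / 2 ^ j) = of_int (int i - 1)" by simp
  ultimately show "i = i'" by (metis add_right_cancel diff_add_cancel floor_of_int of_nat_eq_iff)
qed

lemma dyadic_rank_interval:
  assumes "1 \<le> i" "i \<le> 2 ^ j"
  shows "dyadic_rank (dyadic_interval j i) = 2 ^ j + i - 1"
  unfolding dyadic_rank_def using assms by (intro the_equality) (auto dest: dyadic_interval_inject)

lemma ex_level: "\<exists>j i. 1 \<le> i \<and> i \<le> 2 ^ j \<and> Suc n = 2 ^ j + i - 1"
proof -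
  obtain j where j: "2 ^ j \<le> Suc n" "Suc n < 2 ^ (j + 1)" using ex_power_ivl1[of 2 "Suc n"] by auto
  show ?thesis
    by (rule exI[of _ j], rule exI[of _ "Suc (Suc n) - 2 ^ j"]) (use j in auto)
qed

lemma level_unique:
  fixes i i' j j' :: nat
  assumes "1 \<le> i" "i \<le> 2 ^ j" "1 \<le> i'" "i' \<le> 2 ^ j'" "2 ^ j + i - 1 = 2 ^ j' + i' - (1::nat)"
  shows "j = j' \<and> i = i'"
proof -
  have *: False if "1 \<le> i" "i \<le> 2 ^ j" "1 \<le> i'" "i' \<le> 2 ^ j'"
    "2 ^ j + i - 1 = 2 ^ j' + i' - (1::nat)" "j < j'" for i i' j j' :: nat
  proof -
    have "(2::nat) ^ (j + 1) \<le> 2 ^ j'" using that by (intro power_increasing) auto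
    then show False using that by simp
  qed
  have "j = j'" using *[of i j i' j'] *[of i' j' i j] assms by (metis linorder_less_linear)
  then show ?thesis using assms by auto
qed

lemma bij_betw_dyadic_rank: "bij_betw dyadic_rank dyadic_intervals {1..}"
proof (rule bij_betw_imageI)
  show "inj_on dyadic_rank dyadic_intervals"
  proof (rule inj_onI)
    fix I J assume IJ: "I \<in> dyadic_intervals" "J \<in> dyadic_intervals" "dyadic_rank I = dyadic_rank J"
    obtain j i where I: "1 \<le> i" "i \<le> 2 ^ j" "I = dyadic_interval j i"
      using IJ(1) unfolding dyadic_intervals_def by blast
    obtain k l where J: "1 \<le> l" "l \<le> 2 ^ k" "J = dyadic_interval k l"
      using IJ(2) unfolding dyadic_intervals_def by blast
    show "I = J"
      using level_unique[OF I(1,2) J(1,2)] IJ(3) I J by (simp add: dyadic_rank_interval)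
  qed
  show "dyadic_rank ` dyadic_intervals = {1..}"
  proof (intro equalityI subsetI)
    fix m assume "m \<in> dyadic_rank ` dyadic_intervals"
    then show "m \<in> {1..}" by (auto simp: dyadic_intervals_def dyadic_rank_interval Suc_le_eq)
  next
    fix m :: nat assume "m \<in> {1..}"
    then obtain n where "m = Suc n" by (cases m) auto
    then show "m \<in> dyadic_rank ` dyadic_intervals"
      using ex_level[of n] by (fastforce simp: dyadic_intervals_def dyadic_rank_interval image_iff)
  qed
qed

lemma nth_dyadic_eq:
  assumes "1 \<le> i" "i \<le> 2 ^ j" "Suc n = 2 ^ j + i - 1"
  shows "nth_dyadic n = dyadic_interval j i"
proof -
  have "dyadic_interval j i \<in> dyadic_intervals" using assms by (auto simp: dyadic_intervals_def)
  then have "inv_into dyadic_intervals dyadic_rank (dyadic_rank (dyadic_interval j i)) = dyadic_interval j i"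
    using bij_betw_dyadic_rank by (intro inv_into_f_f) (auto simp: bij_betw_def)
  then show ?thesis using assms by (simp add: nth_dyadic_def dyadic_rank_interval)
qed

lemma bij_betw_nth_dyadic: "bij_betw nth_dyadic UNIV dyadic_intervals"
proof -
  have 1: "bij_betw Suc UNIV {1..}"
    by (rule bij_betw_imageI) (auto simp: image_iff Suc_le_eq gr0_conv_Suc)
  have "bij_betw (inv_into dyadic_intervals dyadic_rank \<circ> Suc) UNIV dyadic_intervals"
    by (rule bij_betw_trans[OF 1 bij_betw_inv_into[OF bij_betw_dyadic_rank]])
  then show ?thesis by (simp add: nth_dyadic_def[abs_def] comp_def)
qed

lemma nth_dyadic_in [simp]: "nth_dyadic n \<in> dyadic_intervals"
  using bij_betw_nth_dyadic by (auto simp: bij_betw_def)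

lemma measure_dyadic_pos: "I \<in> dyadic_intervals \<Longrightarrow> 0 < measure lborel I"
  by (auto simp: dyadic_intervals_def measure_dyadic_interval)

lemma haar_dyadic_interval:
  "haar (dyadic_interval j i) x =
    (if \<lfloor>2 ^ Suc j * x\<rfloor> = 2 * int i - 2 then 1 else if \<lfloor>2 ^ Suc j * x\<rfloor> = 2 * int i - 1 then - 1 else 0)"
proof -
  have m: "(Inf (dyadic_interval j i) + Sup (dyadic_interval j i)) / 2 = (2 * real i - 1) / 2 ^ Suc j"
    using dyadic_interval_nonempty[of i j] by (simp add: dyadic_interval_def field_simps)
  have l: "x \<in> left_half (dyadic_interval j i) \<longleftrightarrow> \<lfloor>2 ^ Suc j * x\<rfloor> = 2 * int i - 2"
    unfolding left_half_def m floor_eq_iff dyadic_interval_def by (auto simp: field_simps)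
  have r: "x \<in> right_half (dyadic_interval j i) \<longleftrightarrow> \<lfloor>2 ^ Suc j * x\<rfloor> = 2 * int i - 1"
    unfolding right_half_def m floor_eq_iff dyadic_interval_def by (auto simp: field_simps)
  show ?thesis by (simp add: haar_def indicator_def l r)
qed

lemma abs_haar_dyadic:
  assumes "I \<in> dyadic_intervals"
  shows "\<bar>haar I x\<bar> = indicator I x"
  using assms by (auto simp: haar_def left_half_def right_half_def indicator_def)

lemma haar_measurable:
  assumes "I \<in> dyadic_intervals"
  shows "haar I \<in> borel_measurable borel"
proof -
  have s: "I \<in> sets borel" using assms by (auto simp: dyadic_intervals_def dyadic_interval_def)
  have "left_half I = I \<inter> {..<(Inf I + Sup I) / 2}" "right_half I = I \<inter> {(Inf I + Sup I) / 2..}"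
    by (auto simp: left_half_def right_half_def)
  then have "left_half I \<in> sets borel" "right_half I \<in> sets borel" using s by auto
  then show ?thesis unfolding haar_def[abs_def] by measurable
qed

lemma floor_coarsen:
  fixes x y :: real
  assumes "j \<le> k" "\<lfloor>2 ^ k * x\<rfloor> = \<lfloor>2 ^ k * y\<rfloor>"
  shows "\<lfloor>2 ^ j * x\<rfloor> = \<lfloor>2 ^ j * y\<rfloor>"
proof -
  have "\<lfloor>2 ^ j * z\<rfloor> = \<lfloor>2 ^ k * z\<rfloor> div 2 ^ (k - j)" for z :: real
  proof -
    have "(2::real) ^ k = 2 ^ j * 2 ^ (k - j)" using assms(1) by (simp flip: power_add)
    then have "2 ^ j * z = (2 ^ k * z) / real_of_int (2 ^ (k - j))" by simp
    then show ?thesis by (simp only: floor_divide_real_eq_div zero_le_power zero_le_numeral)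
  qed
  then show ?thesis using assms(2) by simp
qed

lemma haar_earlier_const:
  assumes "m < n" "x \<in> nth_dyadic n" "y \<in> nth_dyadic n"
  shows "haar (nth_dyadic m) x = haar (nth_dyadic m) y"
proof -
  obtain j i where m: "1 \<le> i" "i \<le> 2 ^ j" "Suc m = 2 ^ j + i - 1" using ex_level by blast
  obtain k l where n: "1 \<le> l" "l \<le> 2 ^ k" "Suc n = 2 ^ k + l - 1" using ex_level by blast
  have fl: "\<lfloor>2 ^ k * x\<rfloor> = int l - 1" "\<lfloor>2 ^ k * y\<rfloor> = int l - 1"
    using assms(2,3) nth_dyadic_eq[OF n] by (auto simp: mem_dyadic_interval)
  have "j \<le> k"
  proof (rule ccontr)
    assume "\<not> j \<le> k"
    then have "(2::nat) ^ (k + 1) \<le> 2 ^ j" by (intro power_increasing) auto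
    then show False using m n assms(1) by simp
  qed
  then consider "Suc j \<le> k" | "j = k" by linarith
  then show ?thesis
  proof cases
    case 1
    then show ?thesis
      using floor_coarsen[OF 1, of x y] fl by (simp add: nth_dyadic_eq[OF m] haar_dyadic_interval)
  next
    case 2
    then have "i < l" using m n assms(1) by simp
    then have "x \<notin> dyadic_interval j i" "y \<notin> dyadic_interval j i"
      using fl 2 by (auto simp: mem_dyadic_interval)
    then show ?thesis
      by (simp add: nth_dyadic_eq[OF m] haar_def left_half_def right_half_def)
  qed
qed

lemma haar_independent:
  assumes "\<And>x. (\<Sum>n<N. a n * haar (nth_dyadic n) x) = 0" "n < N"
  shows "a n = (0::real)"
  using assms
proof (induction N arbitrary: n)
  case (Suc N)
  obtain k l where kl: "1 \<le> l" "l \<le> 2 ^ k" "Suc N = 2 ^ k + l - 1" using ex_level by blast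
  define x y :: real where "x = (real l - 1) / 2 ^ k" and "y = (2 * real l - 1) / 2 ^ Suc k"
  have fx: "\<lfloor>2 ^ Suc k * x\<rfloor> = 2 * int l - 2" and fy: "\<lfloor>2 ^ Suc k * y\<rfloor> = 2 * int l - 1"
    unfolding x_def y_def floor_eq_iff by (simp_all add: field_simps)
  have xy: "x \<in> nth_dyadic N" "y \<in> nth_dyadic N"
    unfolding nth_dyadic_eq[OF kl] x_def y_def dyadic_interval_def by (simp_all add: field_simps)
  have hx: "haar (nth_dyadic N) x = 1" and hy: "haar (nth_dyadic N) y = - 1"
    unfolding nth_dyadic_eq[OF kl] haar_dyadic_interval fx fy by simp_all
  have "(\<Sum>n<N. a n * haar (nth_dyadic n) x) = (\<Sum>n<N. a n * haar (nth_dyadic n) y)"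
    by (rule sum.cong) (simp_all add: haar_earlier_const[OF _ xy])
  then have aN: "a N = 0" using Suc.prems(1)[of x] Suc.prems(1)[of y] hx hy by simp
  then have "(\<Sum>n<N. a n * haar (nth_dyadic n) z) = 0" for z using Suc.prems(1)[of z] by simp
  then show ?case using Suc.IH[of n] Suc.prems(2) aN by (cases "n = N") auto
qed simp


section \<open>The span of the Haar functions\<close>

text \<open>\<open>haar_coeffs\<close> are the finitely supported coefficient families on the dyadic intervals,
  \<open>haar_comb\<close> the corresponding linear combinations. Since all functions vanish outside \<open>[0, 1)\<close>,
  the integral over the line is the \<open>L\<^sup>1\<close> norm of the square function on \<open>[0, 1)\<close>.\<close>

definition haar_coeffs :: "(real set \<Rightarrow> real) set" where
  "haar_coeffs = {a. finite {I. a I \<noteq> 0} \<and> {I. a I \<noteq> 0} \<subseteq> dyadic_intervals}"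

definition haar_comb :: "(real set \<Rightarrow> real) \<Rightarrow> real \<Rightarrow> real" where
  "haar_comb a x = (\<Sum>I | a I \<noteq> 0. a I * haar I x)"

definition haar_sq_norm :: "(real set \<Rightarrow> real) \<Rightarrow> real" where
  "haar_sq_norm a = (LINT x|lborel. sqrt (\<Sum>I | a I \<noteq> 0. (a I)\<^sup>2 * (haar I x)\<^sup>2))"

lemma haar_comb_superset:
  assumes "finite F" "{I. a I \<noteq> 0} \<subseteq> F"
  shows "haar_comb a x = (\<Sum>I\<in>F. a I * haar I x)"
  unfolding haar_comb_def by (rule sum.mono_neutral_left) (use assms in auto)

lemma haar_sq_norm_superset:
  assumes "finite F" "{I. a I \<noteq> 0} \<subseteq> F"
  shows "haar_sq_norm a = (LINT x|lborel. L2_set (\<lambda>I. a I * haar I x) F)"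
proof -
  have "(\<Sum>I | a I \<noteq> 0. (a I)\<^sup>2 * (haar I x)\<^sup>2) = (\<Sum>I\<in>F. (a I * haar I x)\<^sup>2)" for x
    by (rule sum.mono_neutral_cong_left) (use assms in \<open>auto simp: power_mult_distrib\<close>)
  then show ?thesis by (simp add: haar_sq_norm_def L2_set_def)
qed

lemma haar_coeffs_zero: "(\<lambda>_. 0) \<in> haar_coeffs"
  by (simp add: haar_coeffs_def)

lemma haar_coeffs_add:
  assumes "a \<in> haar_coeffs" "b \<in> haar_coeffs"
  shows "(\<lambda>I. a I + b I) \<in> haar_coeffs"
    and "haar_comb (\<lambda>I. a I + b I) x = haar_comb a x + haar_comb b x"
proof -
  let ?F = "{I. a I \<noteq> 0} \<union> {I. b I \<noteq> 0}"
  have F: "finite ?F" using assms by (simp add: haar_coeffs_def)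
  have s: "{I. a I + b I \<noteq> 0} \<subseteq> ?F" by auto
  then show "(\<lambda>I. a I + b I) \<in> haar_coeffs"
    using assms finite_subset[OF s F] by (auto simp: haar_coeffs_def)
  show "haar_comb (\<lambda>I. a I + b I) x = haar_comb a x + haar_comb b x"
    by (subst (1 2 3) haar_comb_superset[OF F]) (auto simp: sum.distrib algebra_simps)
qed

lemma haar_coeffs_scale:
  assumes "a \<in> haar_coeffs"
  shows "(\<lambda>I. r * a I) \<in> haar_coeffs" and "haar_comb (\<lambda>I. r * a I) x = r * haar_comb a x"
proof -
  let ?F = "{I. a I \<noteq> 0}"
  have F: "finite ?F" using assms by (simp add: haar_coeffs_def)
  have s: "{I. r * a I \<noteq> 0} \<subseteq> ?F" by auto
  show "(\<lambda>I. r * a I) \<in> haar_coeffs"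
    using assms finite_subset[OF s F] by (auto simp: haar_coeffs_def)
  show "haar_comb (\<lambda>I. r * a I) x = r * haar_comb a x"
    by (subst (1 2) haar_comb_superset[OF F]) (auto simp: sum_distrib_left algebra_simps)
qed

lemma haar_comb_zeroD:
  assumes "a \<in> haar_coeffs" "\<And>x. haar_comb a x = 0"
  shows "a I = 0"
proof (rule ccontr)
  assume aI: "a I \<noteq> 0"
  let ?S = "{n. a (nth_dyadic n) \<noteq> 0}"
  have inj: "inj nth_dyadic" and surj: "range nth_dyadic = dyadic_intervals"
    using bij_betw_nth_dyadic by (auto simp: bij_betw_def)
  have "?S = nth_dyadic -` {I. a I \<noteq> 0}" by auto
  then have "finite ?S" 
    using assms(1) finite_vimageI[OF _ inj, of "{I. a I \<noteq> 0}"] by (auto simp: haar_coeffs_def)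
  then obtain N where N: "?S \<subseteq> {..<N}" using finite_nat_iff_bounded by blast
  have *: "{I. a I \<noteq> 0} \<subseteq> nth_dyadic ` {..<N}"
  proof
    fix J assume J: "J \<in> {I. a I \<noteq> 0}"
    then have "J \<in> range nth_dyadic" using assms(1) surj by (auto simp: haar_coeffs_def)
    then show "J \<in> nth_dyadic ` {..<N}" using J N by auto
  qed
  have "(\<Sum>n<N. a (nth_dyadic n) * haar (nth_dyadic n) x) = 0" for x
  proof -
    have "(\<Sum>n<N. a (nth_dyadic n) * haar (nth_dyadic n) x) = (\<Sum>J\<in>nth_dyadic ` {..<N}. a J * haar J x)"
      using inj by (subst sum.reindex) (auto intro: inj_on_subset)
    also have "\<dots> = haar_comb a x" using * by (subst haar_comb_superset) auto
    finally show ?thesis using assms(2) by simp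
  qed
  then have "a (nth_dyadic n) = 0" if "n < N" for n
    using haar_independent[where N = N and a = "\<lambda>n. a (nth_dyadic n)" and n = n] that by blast
  then show False using * aI by auto
qed

lemma haar_comb_inject:
  assumes "a \<in> haar_coeffs" "b \<in> haar_coeffs" "haar_comb a = haar_comb b"
  shows "a = b"
proof
  fix I
  have m: "(\<lambda>I. (- 1) * b I) \<in> haar_coeffs" by (rule haar_coeffs_scale[OF assms(2)])
  have c: "(\<lambda>I. a I + (- 1) * b I) \<in> haar_coeffs" by (rule haar_coeffs_add(1)[OF assms(1) m])
  have "haar_comb (\<lambda>I. a I + (- 1) * b I) x = 0" for x
    unfolding haar_coeffs_add(2)[OF assms(1) m] haar_coeffs_scale(2)[OF assms(2)] using assms(3) by simp
  from haar_comb_zeroD[OF c this, of I] show "a I = b I" by simp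
qed

typedef haar_span = "haar_comb ` haar_coeffs"
  morphisms haar_span_fun Haar_span
  using haar_coeffs_zero by auto

setup_lifting type_definition_haar_span

text \<open>By linear independence (\<open>haar_comb_inject\<close>) the coefficients are unique.\<close>

definition haar_coeff :: "haar_span \<Rightarrow> real set \<Rightarrow> real" where
  "haar_coeff f = (THE a. a \<in> haar_coeffs \<and> haar_span_fun f = haar_comb a)"

lemma haar_coeff_eqI:
  assumes "a \<in> haar_coeffs" "haar_span_fun f = haar_comb a"
  shows "haar_coeff f = a"
  unfolding haar_coeff_def using assms haar_comb_inject by (intro the_equality) auto

lemma haar_coeff:
  shows haar_coeff_in: "haar_coeff f \<in> haar_coeffs"
    and haar_span_fun_eq: "haar_span_fun f = haar_comb (haar_coeff f)"
proof -
  obtain a where a: "a \<in> haar_coeffs" "haar_span_fun f = haar_comb a"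
    using haar_span_fun[of f] by auto
  then show "haar_coeff f \<in> haar_coeffs" "haar_span_fun f = haar_comb (haar_coeff f)"
    using haar_coeff_eqI[OF a] by auto
qed

lemma haar_coeff_Haar_span: "a \<in> haar_coeffs \<Longrightarrow> haar_coeff (Haar_span (haar_comb a)) = a"
  by (rule haar_coeff_eqI) (auto simp: Haar_span_inverse)

lemma haar_span_eqI: "haar_coeff f = haar_coeff g \<Longrightarrow> f = g"
  by (metis haar_span_fun_eq haar_span_fun_inject)

lemma finite_haar_coeff [simp]: "finite {I. haar_coeff f I \<noteq> 0}"
  using haar_coeff_in[of f] by (simp add: haar_coeffs_def)

lemma haar_coeff_dyadic: "haar_coeff f I \<noteq> 0 \<Longrightarrow> I \<in> dyadic_intervals"
  using haar_coeff_in[of f] by (auto simp: haar_coeffs_def)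

lemma integrable_sq_fun:
  assumes "finite F" "F \<subseteq> dyadic_intervals"
  shows "integrable lborel (\<lambda>x. L2_set (\<lambda>I. a I * haar I x) F)"
proof (rule Bochner_Integration.integrable_bound)
  have "integrable lborel (\<lambda>x. \<bar>a I\<bar> * indicator I x)" if "I \<in> F" for I
  proof (rule integrable_mult_right, rule integrable_real_indicator)
    have "I \<in> dyadic_intervals" using that assms(2) by blast
    then obtain j i where "I = dyadic_interval j i" unfolding dyadic_intervals_def by blast
    then show "I \<in> sets lborel" "emeasure lborel I < \<infinity>"
      using dyadic_interval_nonempty[of i j] by (auto simp: dyadic_interval_def)
  qed
  then show "integrable lborel (\<lambda>x. \<Sum>I\<in>F. \<bar>a I\<bar> * (indicator I x :: real))"
    by (intro Bochner_Integration.integrable_sum)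
  have "haar I \<in> borel_measurable lborel" if "I \<in> F" for I
    using haar_measurable[of I] that assms(2) by auto
  then show "(\<lambda>x. L2_set (\<lambda>I. a I * haar I x) F) \<in> borel_measurable lborel"
    unfolding L2_set_def
    by (intro measurable_compose[OF _ borel_measurable_sqrt] borel_measurable_sum borel_measurable_power borel_measurable_times) auto
  have *: "\<bar>L2_set (\<lambda>I. a I * haar I x) F\<bar> \<le> (\<Sum>I\<in>F. \<bar>a I\<bar> * indicator I x)" for x
  proof -
    have "\<bar>L2_set (\<lambda>I. a I * haar I x) F\<bar> \<le> (\<Sum>I\<in>F. \<bar>a I * haar I x\<bar>)"
      by (simp add: L2_set_le_sum_abs)
    also have "\<dots> = (\<Sum>I\<in>F. \<bar>a I\<bar> * indicator I x)"
      using assms(2) by (intro sum.cong) (auto simp: abs_mult abs_haar_dyadic)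
    finally show ?thesis .
  qed
  show "AE x in lborel. norm (L2_set (\<lambda>I. a I * haar I x) F) \<le> norm (\<Sum>I\<in>F. \<bar>a I\<bar> * (indicator I x :: real))"
    by (intro always_eventually allI, unfold real_norm_def) (rule order_trans[OF * abs_ge_self])
qed

lemma haar_sq_norm_mono:
  assumes "a \<in> haar_coeffs" "b \<in> haar_coeffs" "\<And>I. \<bar>a I\<bar> \<le> \<bar>b I\<bar>"
  shows "haar_sq_norm a \<le> haar_sq_norm b"
proof -
  let ?F = "{I. b I \<noteq> 0}"
  have F: "finite ?F" "?F \<subseteq> dyadic_intervals" using assms(2) by (auto simp: haar_coeffs_def)
  have "{I. a I \<noteq> 0} \<subseteq> ?F"
  proof
    fix I assume "I \<in> {I. a I \<noteq> 0}"
    then show "I \<in> ?F" using assms(3)[of I] by auto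
  qed
  then have "haar_sq_norm a = (LINT x|lborel. L2_set (\<lambda>I. a I * haar I x) ?F)"
    "haar_sq_norm b = (LINT x|lborel. L2_set (\<lambda>I. b I * haar I x) ?F)"
    using F by (auto intro: haar_sq_norm_superset)
  moreover have "L2_set (\<lambda>I. a I * haar I x) ?F \<le> L2_set (\<lambda>I. b I * haar I x) ?F" for x
    unfolding L2_set_def
    by (intro real_sqrt_le_mono sum_mono) (simp add: abs_le_square_iff[symmetric] abs_mult assms(3) mult_right_mono)
  ultimately show ?thesis by (auto intro!: integral_mono integrable_sq_fun F)
qed

lemma haar_sq_norm_single:
  assumes "I \<in> dyadic_intervals"
  shows "haar_sq_norm (\<lambda>J. if J = I then r else 0) = \<bar>r\<bar> * measure lborel I"
proof -
  have "haar_sq_norm (\<lambda>J. if J = I then r else 0) = (LINT x|lborel. \<bar>r\<bar> * indicator I x)"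
    by (subst haar_sq_norm_superset[of "{I}"]) (auto simp: abs_mult abs_haar_dyadic[OF assms])
  then show ?thesis by simp
qed

lemma haar_sq_norm_ge_coeff:
  assumes "a \<in> haar_coeffs" "I \<in> dyadic_intervals"
  shows "\<bar>a I\<bar> * measure lborel I \<le> haar_sq_norm a"
proof -
  have "(\<lambda>J. if J = I then a I else 0) \<in> haar_coeffs" using assms(2) by (auto simp: haar_coeffs_def)
  then have "haar_sq_norm (\<lambda>J. if J = I then a I else 0) \<le> haar_sq_norm a"
    using assms(1) by (rule haar_sq_norm_mono) auto
  then show ?thesis by (simp add: haar_sq_norm_single assms(2))
qed

instantiation haar_span :: real_vector
begin

lift_definition zero_haar_span :: haar_span is "\<lambda>x. 0"
proof -
  have "(\<lambda>x. 0) = haar_comb (\<lambda>_. 0)" by (simp add: fun_eq_iff haar_comb_def)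
  then show "(\<lambda>x. 0) \<in> haar_comb ` haar_coeffs" using haar_coeffs_zero by blast
qed

lift_definition plus_haar_span :: "haar_span \<Rightarrow> haar_span \<Rightarrow> haar_span" is "\<lambda>f g x. f x + g x"
proof -
  fix f g assume "f \<in> haar_comb ` haar_coeffs" "g \<in> haar_comb ` haar_coeffs"
  then obtain a b where ab: "a \<in> haar_coeffs" "b \<in> haar_coeffs" "f = haar_comb a" "g = haar_comb b" by blast
  then have "(\<lambda>x. f x + g x) = haar_comb (\<lambda>I. a I + b I)" by (simp add: fun_eq_iff haar_coeffs_add)
  then show "(\<lambda>x. f x + g x) \<in> haar_comb ` haar_coeffs" using haar_coeffs_add(1)[OF ab(1,2)] by blast
qed

lift_definition scaleR_haar_span :: "real \<Rightarrow> haar_span \<Rightarrow> haar_span" is "\<lambda>r f x. r * f x"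
proof -
  fix r f assume "f \<in> haar_comb ` haar_coeffs"
  then obtain a where a: "a \<in> haar_coeffs" "f = haar_comb a" by blast
  then have "(\<lambda>x. r * f x) = haar_comb (\<lambda>I. r * a I)" by (simp add: fun_eq_iff haar_coeffs_scale)
  then show "(\<lambda>x. r * f x) \<in> haar_comb ` haar_coeffs" using haar_coeffs_scale(1)[OF a(1)] by blast
qed

definition uminus_haar_span :: "haar_span \<Rightarrow> haar_span" where "uminus_haar_span f = (- 1) *\<^sub>R f"

definition minus_haar_span :: "haar_span \<Rightarrow> haar_span \<Rightarrow> haar_span" where "minus_haar_span f g = f + - g"

instance
proof
  fix x y z :: haar_span and a b :: real
  show "x + y + z = x + (y + z)" by transfer (simp add: algebra_simps)
  show "x + y = y + x" by transfer (simp add: algebra_simps)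
  show "0 + x = x" by transfer simp
  show "- x + x = 0" unfolding uminus_haar_span_def by transfer simp
  show "x - y = x + - y" by (rule minus_haar_span_def)
  show "a *\<^sub>R (x + y) = a *\<^sub>R x + a *\<^sub>R y" by transfer (simp add: algebra_simps)
  show "(a + b) *\<^sub>R x = a *\<^sub>R x + b *\<^sub>R x" by transfer (simp add: algebra_simps)
  show "a *\<^sub>R b *\<^sub>R x = (a * b) *\<^sub>R x" by transfer (simp add: algebra_simps)
  show "1 *\<^sub>R x = x" by transfer simp
qed

end

lemma haar_coeff_add: "haar_coeff (f + g) I = haar_coeff f I + haar_coeff g I"
proof -
  have "haar_coeff (f + g) = (\<lambda>I. haar_coeff f I + haar_coeff g I)"
    by (rule haar_coeff_eqI)
      (auto simp: haar_coeffs_add haar_coeff_in plus_haar_span.rep_eq haar_span_fun_eq[of f] haar_span_fun_eq[of g])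
  then show ?thesis by simp
qed

lemma haar_coeff_scaleR: "haar_coeff (r *\<^sub>R f) I = r * haar_coeff f I"
proof -
  have "haar_coeff (r *\<^sub>R f) = (\<lambda>I. r * haar_coeff f I)"
    by (rule haar_coeff_eqI)
      (auto simp: haar_coeffs_scale haar_coeff_in scaleR_haar_span.rep_eq haar_span_fun_eq[of f])
  then show ?thesis by simp
qed

lemma haar_coeff_zero: "haar_coeff 0 I = 0"
  using haar_coeff_scaleR[of 0 0 I] by simp

lemma haar_coeff_sum: "haar_coeff (sum f A) I = (\<Sum>i\<in>A. haar_coeff (f i) I)"
  by (induction A rule: infinite_finite_induct) (auto simp: haar_coeff_zero haar_coeff_add)

instantiation haar_span :: real_normed_vector
begin

definition norm_haar_span :: "haar_span \<Rightarrow> real" where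
  "norm_haar_span f = haar_sq_norm (haar_coeff f)"

definition dist_haar_span :: "haar_span \<Rightarrow> haar_span \<Rightarrow> real"
  where "dist_haar_span x y = norm (x - y)"

definition sgn_haar_span :: "haar_span \<Rightarrow> haar_span"
  where "sgn_haar_span x = scaleR (inverse (norm x)) x"

definition uniformity_haar_span :: "(haar_span \<times> haar_span) filter"
  where "uniformity_haar_span = (INF e\<in>{0 <..}. principal {(x, y). dist x y < e})"

definition open_haar_span :: "haar_span set \<Rightarrow> bool"
  where "open_haar_span U = (\<forall>x\<in>U. \<forall>\<^sub>F (x', y) in uniformity. x' = x \<longrightarrow> y \<in> U)"

instance
proof
  fix x y :: haar_span and a :: real
  show "dist x y = norm (x - y)" by (rule dist_haar_span_def)
  show "sgn x = x /\<^sub>R norm x" by (rule sgn_haar_span_def)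
  show "uniformity = (INF e\<in>{0 <..}. principal {(x, y :: haar_span). dist x y < e})"
    by (rule uniformity_haar_span_def)
  show "open U = (\<forall>x\<in>U. \<forall>\<^sub>F (x', y) in uniformity. x' = x \<longrightarrow> y \<in> U)" for U :: "haar_span set"
    by (rule open_haar_span_def)
  show "norm x = 0 \<longleftrightarrow> x = 0"
  proof
    assume n: "norm x = 0"
    have "haar_coeff x I = 0" for I
    proof (rule ccontr)
      assume "haar_coeff x I \<noteq> 0"
      then have "I \<in> dyadic_intervals" "0 < \<bar>haar_coeff x I\<bar>" using haar_coeff_dyadic by auto
      then have "0 < \<bar>haar_coeff x I\<bar> * measure lborel I"
        using measure_dyadic_pos[of I] by simp
      also have "\<dots> \<le> norm x"
        unfolding norm_haar_span_def by (rule haar_sq_norm_ge_coeff) (auto simp: haar_coeff_in \<open>I \<in> _\<close>)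
      finally show False using n by simp
    qed
    then show "x = 0" by (intro haar_span_eqI) (auto simp: haar_coeff_zero)
  next
    assume "x = 0"
    then show "norm x = 0" by (simp add: norm_haar_span_def haar_sq_norm_def haar_coeff_zero)
  qed
  show "norm (x + y) \<le> norm x + norm y"
  proof -
    let ?F = "{I. haar_coeff x I \<noteq> 0} \<union> {I. haar_coeff y I \<noteq> 0}"
    have F: "finite ?F" "?F \<subseteq> dyadic_intervals" using haar_coeff_dyadic by auto
    have "norm (x + y) = (LINT t|lborel. L2_set (\<lambda>I. haar_coeff (x + y) I * haar I t) ?F)"
      unfolding norm_haar_span_def by (rule haar_sq_norm_superset[OF F(1)]) (auto simp: haar_coeff_add)
    also have "\<dots> \<le> (LINT t|lborel. L2_set (\<lambda>I. haar_coeff x I * haar I t) ?F + L2_set (\<lambda>I. haar_coeff y I * haar I t) ?F)"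
    proof (rule integral_mono)
      show "L2_set (\<lambda>I. haar_coeff (x + y) I * haar I t) ?F
        \<le> L2_set (\<lambda>I. haar_coeff x I * haar I t) ?F + L2_set (\<lambda>I. haar_coeff y I * haar I t) ?F" for t
        unfolding haar_coeff_add distrib_right by (rule L2_set_triangle_ineq)
    qed (intro integrable_sq_fun Bochner_Integration.integrable_add F)+
    also have "\<dots> = norm x + norm y"
      unfolding norm_haar_span_def
      by (subst Bochner_Integration.integral_add, (intro integrable_sq_fun F)+)
        (auto simp: haar_sq_norm_superset[OF F(1)])
    finally show ?thesis .
  qed
  show "norm (a *\<^sub>R x) = \<bar>a\<bar> * norm x"
  proof -
    let ?F = "{I. haar_coeff x I \<noteq> 0}"
    have "norm (a *\<^sub>R x) = (LINT t|lborel. L2_set (\<lambda>I. haar_coeff (a *\<^sub>R x) I * haar I t) ?F)"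
      unfolding norm_haar_span_def by (rule haar_sq_norm_superset) (auto simp: haar_coeff_scaleR)
    also have "\<dots> = (LINT t|lborel. \<bar>a\<bar> * L2_set (\<lambda>I. haar_coeff x I * haar I t) ?F)"
    proof (rule arg_cong[where f = "integral\<^sup>L lborel"], rule ext)
      fix t
      have "(\<Sum>I\<in>?F. (haar_coeff (a *\<^sub>R x) I * haar I t)\<^sup>2) = a\<^sup>2 * (\<Sum>I\<in>?F. (haar_coeff x I * haar I t)\<^sup>2)"
        by (simp add: haar_coeff_scaleR sum_distrib_left power_mult_distrib mult.assoc)
      then show "L2_set (\<lambda>I. haar_coeff (a *\<^sub>R x) I * haar I t) ?F = \<bar>a\<bar> * L2_set (\<lambda>I. haar_coeff x I * haar I t) ?F"
        by (simp add: L2_set_def real_sqrt_mult)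
    qed
    also have "\<dots> = \<bar>a\<bar> * norm x"
      unfolding norm_haar_span_def by (simp add: haar_sq_norm_superset[of ?F])
    finally show ?thesis .
  qed
qed

end


section \<open>Unconditional bases\<close>

definition schauder_basis :: "(nat \<Rightarrow> 'a::real_normed_vector) \<Rightarrow> bool" where
  "schauder_basis e \<longleftrightarrow> (\<forall>x. \<exists>!a. (\<lambda>i. a i *\<^sub>R e i) sums x)"

definition unconditional_basis :: "(nat \<Rightarrow> 'a::real_normed_vector) \<Rightarrow> bool" where
  "unconditional_basis e \<longleftrightarrow> schauder_basis e \<and>
    (\<forall>a. summable (\<lambda>i. a i *\<^sub>R e i) \<longrightarrow> (\<lambda>i. a i *\<^sub>R e i) summable_on UNIV)"

text \<open>If \<open>e\<close> is a Schauder basis of a Banach space, there is exactly one such functional;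
  for the Haar basis of the dyadic Hardy space see \<open>biorthogonal_haar\<close> below.\<close>

definition biorthogonal :: "(nat \<Rightarrow> 'a::real_normed_vector) \<Rightarrow> nat \<Rightarrow> 'a \<Rightarrow>\<^sub>L real" where
  "biorthogonal e i = (THE f. \<forall>j. blinfun_apply f (e j) = (if j = i then 1 else 0))"

context
  fixes e :: "nat \<Rightarrow> 'a::banach"
  assumes one_unconditional: "\<And>a b F. finite F \<Longrightarrow> (\<And>i. \<bar>a i\<bar> \<le> \<bar>b i\<bar>) \<Longrightarrow>
      norm (\<Sum>i\<in>F. a i *\<^sub>R e i) \<le> norm (\<Sum>i\<in>F. b i *\<^sub>R e i)"
    and nonzero: "\<And>i. e i \<noteq> 0"
    and dense: "\<And>x \<epsilon>. 0 < \<epsilon> \<Longrightarrow> \<exists>a F. finite F \<and> norm (x - (\<Sum>i\<in>F. a i *\<^sub>R e i)) < \<epsilon>"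
begin

lemma one_unc_restrict:
  assumes "finite F" "A \<subseteq> F"
  shows "norm (\<Sum>i\<in>A. a i *\<^sub>R e i) \<le> norm (\<Sum>i\<in>F. a i *\<^sub>R e i)"
proof -
  have "(\<Sum>i\<in>A. a i *\<^sub>R e i) = (\<Sum>i\<in>F. (if i \<in> A then a i else 0) *\<^sub>R e i)"
    by (rule sum.mono_neutral_cong_left) (use assms in auto)
  then show ?thesis using one_unconditional[OF assms(1), of "\<lambda>i. if i \<in> A then a i else 0" a] by auto
qed

lemma one_unc_coord:
  assumes "(\<lambda>i. a i *\<^sub>R e i) sums x"
  shows "\<bar>a i\<bar> * norm (e i) \<le> norm x"
proof (rule LIMSEQ_le_const)
  show "(\<lambda>n. norm (\<Sum>j<n. a j *\<^sub>R e j)) \<longlonglongrightarrow> norm x"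
    using assms unfolding sums_def by (rule tendsto_norm)
  show "\<exists>N. \<forall>n\<ge>N. \<bar>a i\<bar> * norm (e i) \<le> norm (\<Sum>j<n. a j *\<^sub>R e j)"
    using one_unc_restrict[of "{..<n}" "{i}" a for n] by (intro exI[of _ "Suc i"]) auto
qed

lemma one_unc_unique:
  assumes "(\<lambda>i. a i *\<^sub>R e i) sums x" "(\<lambda>i. b i *\<^sub>R e i) sums x"
  shows "a = b"
proof
  fix i
  have "(\<lambda>i. (a i - b i) *\<^sub>R e i) sums 0"
    using sums_diff[OF assms] by (simp add: scaleR_diff_left)
  from one_unc_coord[OF this, of i] nonzero[of i] have "\<bar>a i - b i\<bar> \<le> 0"
    by (simp add: mult_le_0_iff)
  then show "a i = b i" by simp
qed

lemma one_unc_has_sum: "\<exists>a. ((\<lambda>i. a i *\<^sub>R e i) has_sum x) UNIV"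
proof -
  have "\<exists>a F. finite F \<and> norm (x - (\<Sum>i\<in>F. a i *\<^sub>R e i)) < inverse (real (Suc k))" for k
    by (rule dense) simp
  then obtain b F where F: "\<And>k. finite (F k)"
    and b: "\<And>k. norm (x - (\<Sum>i\<in>F k. b k i *\<^sub>R e i)) < inverse (real (Suc k))" by metis
  define c where "c k i = (if i \<in> F k then b k i else 0)" for k i
  define y where "y k = (\<Sum>i\<in>F k. b k i *\<^sub>R e i)" for k
  have y: "y k = (\<Sum>i\<in>G. c k i *\<^sub>R e i)" if "finite G" "F k \<subseteq> G" for k G
    unfolding y_def c_def by (rule sum.mono_neutral_cong_left) (use that in auto)
  have "(\<lambda>k. x - y k) \<longlonglongrightarrow> 0"
    by (rule Lim_null_comparison[OF _ LIMSEQ_inverse_real_of_nat])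
      (intro always_eventually allI less_imp_le b[folded y_def])
  from tendsto_diff[OF tendsto_const[of x] this] have yx: "y \<longlonglongrightarrow> x" by simp
  then have "Cauchy y" by (rule LIMSEQ_imp_Cauchy)
  have coord: "\<bar>c k i - c l i\<bar> * norm (e i) \<le> norm (y k - y l)" for k l i
  proof -
    let ?G = "insert i (F k \<union> F l)"
    have "norm (\<Sum>j\<in>{i}. (c k j - c l j) *\<^sub>R e j) \<le> norm (\<Sum>j\<in>?G. (c k j - c l j) *\<^sub>R e j)"
      by (rule one_unc_restrict) (use F in auto)
    also have "(\<Sum>j\<in>?G. (c k j - c l j) *\<^sub>R e j) = y k - y l"
    proof -
      have "finite ?G" using F by auto
      then have "y k = (\<Sum>j\<in>?G. c k j *\<^sub>R e j)" "y l = (\<Sum>j\<in>?G. c l j *\<^sub>R e j)" by (auto intro: y)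
      then show ?thesis by (simp add: scaleR_diff_left sum_subtractf)
    qed
    finally show ?thesis by simp
  qed
  have "convergent (\<lambda>k. c k i)" for i
  proof (rule real_Cauchy_convergent, rule CauchyI)
    fix \<epsilon> :: real assume "0 < \<epsilon>"
    then have "0 < \<epsilon> * norm (e i)" using nonzero[of i] by simp
    then obtain M where M: "\<And>k l. k \<ge> M \<Longrightarrow> l \<ge> M \<Longrightarrow> norm (y k - y l) < \<epsilon> * norm (e i)"
      using CauchyD[OF \<open>Cauchy y\<close>] by blast
    have "norm (c k i - c l i) < \<epsilon>" if "k \<ge> M" "l \<ge> M" for k l
    proof -
      have "\<bar>c k i - c l i\<bar> * norm (e i) < \<epsilon> * norm (e i)"
        using coord[of k i l] M[OF that] by linarith
      then show ?thesis using nonzero[of i] by simp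
    qed
    then show "\<exists>M. \<forall>m\<ge>M. \<forall>n\<ge>M. norm (c m i - c n i) < \<epsilon>" by blast
  qed
  then have "\<exists>a. (\<lambda>k. c k i) \<longlonglongrightarrow> a" for i by (auto simp: convergent_def)
  then obtain a where a: "\<And>i. (\<lambda>k. c k i) \<longlonglongrightarrow> a i" by metis
  have "((\<lambda>i. a i *\<^sub>R e i) has_sum x) UNIV"
    unfolding has_sum_def tendsto_iff eventually_finite_subsets_at_top
  proof (intro allI impI)
    fix \<epsilon> :: real assume \<epsilon>: "0 < \<epsilon>"
    obtain M where M: "\<And>k l. k \<ge> M \<Longrightarrow> l \<ge> M \<Longrightarrow> norm (y k - y l) < \<epsilon>/4"
      using CauchyD[OF \<open>Cauchy y\<close>, of "\<epsilon>/4"] \<epsilon> by auto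
    have xM: "norm (x - y M) \<le> \<epsilon>/4"
    proof (rule LIMSEQ_le_const2)
      show "(\<lambda>l. norm (y l - y M)) \<longlonglongrightarrow> norm (x - y M)" by (intro tendsto_intros yx)
      show "\<exists>N. \<forall>n\<ge>N. norm (y n - y M) \<le> \<epsilon>/4" using M less_imp_le order_refl by blast
    qed
    have aM: "norm ((\<Sum>i\<in>G. a i *\<^sub>R e i) - y M) \<le> \<epsilon>/4" if G: "finite G" "F M \<subseteq> G" for G
    proof (rule LIMSEQ_le_const2)
      show "(\<lambda>l. norm ((\<Sum>i\<in>G. c l i *\<^sub>R e i) - y M)) \<longlonglongrightarrow> norm ((\<Sum>i\<in>G. a i *\<^sub>R e i) - y M)"
        by (intro tendsto_intros a)
      have "norm ((\<Sum>i\<in>G. c l i *\<^sub>R e i) - y M) \<le> \<epsilon>/4" if "l \<ge> M" for l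
      proof -
        have "(\<Sum>i\<in>G. c l i *\<^sub>R e i) - y M = (\<Sum>i\<in>G. (c l i - c M i) *\<^sub>R e i)"
          using y[OF G] by (simp add: scaleR_diff_left sum_subtractf)
        also have "norm \<dots> \<le> norm (\<Sum>i\<in>G \<union> F l. (c l i - c M i) *\<^sub>R e i)"
          by (rule one_unc_restrict) (use F G in auto)
        also have "(\<Sum>i\<in>G \<union> F l. (c l i - c M i) *\<^sub>R e i) = y l - y M"
          using y[of "G \<union> F l" M] y[of "G \<union> F l" l] G F
          by (simp add: scaleR_diff_left sum_subtractf le_supI1)
        finally show ?thesis using M[OF that order_refl] by linarith
      qed
      then show "\<exists>N. \<forall>l\<ge>N. norm ((\<Sum>i\<in>G. c l i *\<^sub>R e i) - y M) \<le> \<epsilon>/4" by blast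
    qed
    have "dist (\<Sum>i\<in>G. a i *\<^sub>R e i) x < \<epsilon>" if "finite G" "F M \<subseteq> G" for G
    proof -
      have "(\<Sum>i\<in>G. a i *\<^sub>R e i) - x = ((\<Sum>i\<in>G. a i *\<^sub>R e i) - y M) - (x - y M)" by simp
      then have "norm ((\<Sum>i\<in>G. a i *\<^sub>R e i) - x)
          \<le> norm ((\<Sum>i\<in>G. a i *\<^sub>R e i) - y M) + norm (x - y M)"
        by (metis norm_triangle_ineq4)
      with xM aM[OF that] \<epsilon> show ?thesis by (simp add: dist_norm)
    qed
    then show "\<exists>X. finite X \<and> X \<subseteq> UNIV \<and>
        (\<forall>Y. finite Y \<and> X \<subseteq> Y \<and> Y \<subseteq> UNIV \<longrightarrow> dist (\<Sum>i\<in>Y. a i *\<^sub>R e i) x < \<epsilon>)"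
      by (intro exI[of _ "F M"]) (simp add: F)
  qed
  then show ?thesis by blast
qed

lemma one_unc_schauder_basis: "schauder_basis e"
  unfolding schauder_basis_def
proof
  fix x
  show "\<exists>!a. (\<lambda>i. a i *\<^sub>R e i) sums x"
    using one_unc_has_sum[of x] has_sum_imp_sums one_unc_unique by (intro ex_ex1I) blast+
qed

lemma one_unc_unconditional_basis: "unconditional_basis e"
  unfolding unconditional_basis_def
proof (intro conjI allI impI one_unc_schauder_basis)
  fix a assume "summable (\<lambda>i. a i *\<^sub>R e i)"
  then obtain x where x: "(\<lambda>i. a i *\<^sub>R e i) sums x" by (auto simp: summable_def)
  obtain b where b: "((\<lambda>i. b i *\<^sub>R e i) has_sum x) UNIV" using one_unc_has_sum by blast
  have "a = b" by (rule one_unc_unique[OF x has_sum_imp_sums[OF b]])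
  then show "(\<lambda>i. a i *\<^sub>R e i) summable_on UNIV" using b by (auto simp: summable_on_def)
qed

lemma one_unc_biorthogonal: "blinfun_apply (biorthogonal e i) (e j) = (if j = i then 1 else 0)"
proof -
  obtain c where c: "\<And>x. (\<lambda>i. c x i *\<^sub>R e i) sums x"
    using one_unc_has_sum has_sum_imp_sums by metis
  have add: "c (x + y) k = c x k + c y k" for x y k
    using one_unc_unique[OF c[of "x + y"], of "\<lambda>i. c x i + c y i"] sums_add[OF c[of x] c[of y]]
    by (simp add: scaleR_add_left)
  have scale: "c (r *\<^sub>R x) k = r * c x k" for r x k
    using one_unc_unique[OF c[of "r *\<^sub>R x"], of "\<lambda>i. r * c x i"] sums_scaleR_right[OF c[of x], of r]
    by simp
  have bl: "bounded_linear (\<lambda>x. c x k)" for k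
  proof (rule bounded_linear_intro[where K = "inverse (norm (e k))"])
    show "norm (c x k) \<le> norm x * inverse (norm (e k))" for x
      using one_unc_coord[OF c[of x], of k] nonzero[of k] by (simp add: field_simps)
  qed (auto simp: add scale)
  have ce: "c (e k) = (\<lambda>i. if i = k then 1 else 0)" for k
  proof (rule one_unc_unique[OF c])
    show "(\<lambda>i. (if i = k then 1 else 0) *\<^sub>R e i) sums e k"
      using sums_If_finite_set[of "{k}" e] by (simp add: if_distrib[of "\<lambda>r. r *\<^sub>R e _"] cong: if_cong)
  qed
  let ?P = "\<lambda>f :: 'a \<Rightarrow>\<^sub>L real. \<forall>j. blinfun_apply f (e j) = (if j = i then 1 else 0)"
  have "\<exists>!f. ?P f"
  proof (rule ex1I[of _ "Blinfun (\<lambda>x. c x i)"])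
    show "?P (Blinfun (\<lambda>x. c x i))" by (simp add: bounded_linear_Blinfun_apply[OF bl] ce)
    fix f assume f: "?P f"
    have "f x = c x i" for x
    proof -
      have "(\<lambda>j. f (c x j *\<^sub>R e j)) sums f x"
        by (rule bounded_linear.sums[OF blinfun.bounded_linear_right c])
      moreover have "(\<lambda>j. f (c x j *\<^sub>R e j)) = (\<lambda>j. if j = i then c x i else 0)"
        using f by (auto simp: blinfun.scaleR_right)
      moreover have "(\<lambda>j. if j = i then c x i else 0) sums c x i" by (rule sums_single)
      ultimately show ?thesis by (metis sums_unique2)
    qed
    then show "f = Blinfun (\<lambda>x. c x i)"
      by (intro blinfun_eqI) (simp add: bounded_linear_Blinfun_apply[OF bl])
  qed
  from theI'[OF this] show ?thesis unfolding biorthogonal_def by blast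
qed

end


section \<open>Strategical reproducibility\<close>

definition impartially_equivalent ::
    "real \<Rightarrow> (nat \<Rightarrow> 'a::real_normed_vector) \<Rightarrow> (nat \<Rightarrow> 'b::real_normed_vector) \<Rightarrow> bool" where
  "impartially_equivalent C x y \<longleftrightarrow> (\<forall>a :: nat \<Rightarrow> real. finite {i. a i \<noteq> 0} \<longrightarrow>
     1 / sqrt C * norm (\<Sum>i | a i \<noteq> 0. a i *\<^sub>R y i) \<le> norm (\<Sum>i | a i \<noteq> 0. a i *\<^sub>R x i) \<and>
     norm (\<Sum>i | a i \<noteq> 0. a i *\<^sub>R x i) \<le> sqrt C * norm (\<Sum>i | a i \<noteq> 0. a i *\<^sub>R y i))"

definition finite_codim_subspace :: "'a::real_vector set \<Rightarrow> bool" where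
  "finite_codim_subspace W \<longleftrightarrow> subspace W \<and> (\<exists>F. finite F \<and> span (W \<union> F) = UNIV)"

definition cof :: "'a::real_normed_vector set set" where
  "cof = {W. closed W \<and> finite_codim_subspace W}"

text \<open>On a dual space the strong operator topology, i.e. the topology of pointwise convergence,
  is the weak-star topology.\<close>

definition cof_wstar :: "('a::real_normed_vector \<Rightarrow>\<^sub>L real) set set" where
  "cof_wstar = {G. closedin strong_operator_topology G \<and> finite_codim_subspace G}"

text \<open>Step 1 is \<open>(\<eta>, W, G)\<close>, step 2 is \<open>(E, \<lambda>, \<mu>)\<close>, where only the values of
  \<open>\<lambda>\<close> and \<open>\<mu>\<close> on \<open>E\<close> matter. The signs of step 3 are a function on \<open>E\<close>,
  extended by \<open>undefined\<close>, so they carry no information outside \<open>E\<close>.\<close>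

type_synonym 'a subspace_move = "real \<times> 'a set \<times> ('a \<Rightarrow>\<^sub>L real) set"
type_synonym vector_move = "nat set \<times> (nat \<Rightarrow> real) \<times> (nat \<Rightarrow> real)"
type_synonym sign_move = "nat \<Rightarrow> real"

fun legal_subspace_move :: "'a::real_normed_vector subspace_move \<Rightarrow> bool" where
  "legal_subspace_move (\<eta>, W, G) \<longleftrightarrow> 0 < \<eta> \<and> W \<in> cof \<and> G \<in> cof_wstar"

fun legal_vector_move :: "vector_move \<Rightarrow> bool" where
  "legal_vector_move (E, l, m) \<longleftrightarrow>
     finite E \<and> (\<forall>i\<in>E. 0 \<le> l i \<and> 0 \<le> m i) \<and> (\<Sum>i\<in>E. l i * m i) = 1"

fun legal_sign_move :: "vector_move \<Rightarrow> sign_move \<Rightarrow> bool" where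
  "legal_sign_move (E, l, m) s \<longleftrightarrow> s \<in> E \<rightarrow>\<^sub>E {-1, 1}"

fun played_vector :: "(nat \<Rightarrow> 'a::real_normed_vector) \<Rightarrow> vector_move \<Rightarrow> sign_move \<Rightarrow> 'a" where
  "played_vector e (E, l, m) s = (\<Sum>i\<in>E. (s i * l i) *\<^sub>R e i)"

fun played_functional ::
    "(nat \<Rightarrow> 'a::real_normed_vector) \<Rightarrow> vector_move \<Rightarrow> sign_move \<Rightarrow> 'a \<Rightarrow>\<^sub>L real" where
  "played_functional e (E, l, m) s = (\<Sum>i\<in>E. (s i * m i) *\<^sub>R biorthogonal e i)"

text \<open>A strategy of player (II) maps the moves of player (I) known at step 2 of turn \<open>k\<close>
  (step 1 of turns \<open>0, \<dots>, k\<close> and step 3 of turns \<open>0, \<dots>, k - 1\<close>) to a step 2 move.\<close>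

type_synonym 'a strategy = "'a subspace_move list \<Rightarrow> sign_move list \<Rightarrow> vector_move"

definition reply ::
    "'a::real_normed_vector strategy \<Rightarrow> (nat \<Rightarrow> 'a subspace_move) \<Rightarrow> (nat \<Rightarrow> sign_move) \<Rightarrow> nat \<Rightarrow> vector_move" where
  "reply \<sigma> p s k = \<sigma> (map p [0..<Suc k]) (map s [0..<k])"

definition player_II_wins ::
    "(nat \<Rightarrow> 'a::real_normed_vector) \<Rightarrow> real \<Rightarrow> (nat \<Rightarrow> 'a subspace_move) \<Rightarrow>
     (nat \<Rightarrow> vector_move) \<Rightarrow> (nat \<Rightarrow> sign_move) \<Rightarrow> bool" where
  "player_II_wins e C p v s \<longleftrightarrow>
     (let x = (\<lambda>k. played_vector e (v k) (s k)); x' = (\<lambda>k. played_functional e (v k) (s k)) in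
       impartially_equivalent C x e \<and>
       impartially_equivalent C x' (biorthogonal e) \<and>
       (\<forall>k. case p k of (\<eta>, W, G) \<Rightarrow> infdist (x k) W < \<eta> \<and> infdist (x' k) G < \<eta>))"

definition winning_strategy ::
    "(nat \<Rightarrow> 'a::real_normed_vector) \<Rightarrow> real \<Rightarrow> 'a strategy \<Rightarrow> bool" where
  "winning_strategy e C \<sigma> \<longleftrightarrow> (\<forall>p s.
     (\<forall>k. legal_subspace_move (p k)) \<and> (\<forall>k. legal_sign_move (reply \<sigma> p s k) (s k)) \<longrightarrow>
     (\<forall>k. legal_vector_move (reply \<sigma> p s k)) \<and> player_II_wins e C p (reply \<sigma> p s) s)"

definition strategically_reproducible_with :: "real \<Rightarrow> (nat \<Rightarrow> 'a::banach) \<Rightarrow> bool" where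
  "strategically_reproducible_with C e \<longleftrightarrow> unconditional_basis e \<and>
     (\<forall>\<eta>>0. \<exists>\<sigma>. winning_strategy e (C + \<eta>) \<sigma>)"

definition strategically_reproducible :: "(nat \<Rightarrow> 'a::banach) \<Rightarrow> bool" where
  "strategically_reproducible e \<longleftrightarrow> (\<exists>C\<ge>1. strategically_reproducible_with C e)"


section \<open>The dyadic Hardy space and its normalized Haar basis\<close>

type_synonym dyadic_H1 = "haar_span banach_completion"

definition haar_basis :: "nat \<Rightarrow> dyadic_H1" where
  "haar_basis n = (let I = nth_dyadic n in
     completion_embed (Haar_span (\<lambda>x. haar I x / measure lborel I)))"

lemma haar_basis_comb:
  "\<exists>f. haar_basis n = completion_embed f \<and>
       haar_coeff f = (\<lambda>J. if J = nth_dyadic n then 1 / measure lborel (nth_dyadic n) else 0)"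
proof -
  let ?I = "nth_dyadic n"
  let ?a = "\<lambda>J. if J = ?I then 1 / measure lborel ?I else 0"
  have a: "?a \<in> haar_coeffs" by (auto simp: haar_coeffs_def)
  have "haar_comb ?a x = haar ?I x / measure lborel ?I" for x
    by (subst haar_comb_superset[of "{?I}"]) auto
  then have "haar_comb ?a = (\<lambda>x. haar ?I x / measure lborel ?I)" by (simp add: fun_eq_iff)
  then show ?thesis using haar_coeff_Haar_span[OF a] by (auto simp: haar_basis_def Let_def)
qed

lemma haar_basis_sum_comb:
  "\<exists>f. (\<Sum>n\<in>F. a n *\<^sub>R haar_basis n) = completion_embed f \<and>
     (\<forall>J. haar_coeff f J = (\<Sum>n\<in>F. if J = nth_dyadic n then a n / measure lborel J else 0))"
proof -
  obtain g where g: "\<And>n. haar_basis n = completion_embed (g n)"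
    "\<And>n. haar_coeff (g n) = (\<lambda>J. if J = nth_dyadic n then 1 / measure lborel (nth_dyadic n) else 0)"
    using haar_basis_comb by metis
  have lin: "linear completion_embed" using bounded_linear_completion_embed by (rule bounded_linear.linear)
  have "(\<Sum>n\<in>F. a n *\<^sub>R haar_basis n) = completion_embed (\<Sum>n\<in>F. a n *\<^sub>R g n)"
    by (simp add: g(1) linear_sum[OF lin] completion_embed_scaleR)
  moreover have "haar_coeff (\<Sum>n\<in>F. a n *\<^sub>R g n) J
      = (\<Sum>n\<in>F. if J = nth_dyadic n then a n / measure lborel J else 0)" for J
    unfolding haar_coeff_sum haar_coeff_scaleR g(2) by (rule sum.cong) auto
  ultimately show ?thesis by blast
qed

lemma norm_haar_basis_sum:
  assumes "finite F"
  shows "norm (\<Sum>n\<in>F. a n *\<^sub>R haar_basis n) =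
    (LINT x|lborel. sqrt (\<Sum>n\<in>F. (a n / measure lborel (nth_dyadic n))\<^sup>2 * (haar (nth_dyadic n) x)\<^sup>2))"
proof -
  obtain f where f: "(\<Sum>n\<in>F. a n *\<^sub>R haar_basis n) = completion_embed f"
    "\<And>J. haar_coeff f J = (\<Sum>n\<in>F. if J = nth_dyadic n then a n / measure lborel J else 0)"
    using haar_basis_sum_comb by blast
  have inj: "inj_on nth_dyadic A" for A
    using bij_betw_nth_dyadic by (auto simp: bij_betw_def intro: inj_on_subset)
  have fn: "haar_coeff f (nth_dyadic n) = a n / measure lborel (nth_dyadic n)" if "n \<in> F" for n
  proof -
    have "haar_coeff f (nth_dyadic n) = (\<Sum>m\<in>F. if n = m then a m / measure lborel (nth_dyadic n) else 0)"
      unfolding f(2) by (rule sum.cong) (auto dest: inj_onD[OF inj[of UNIV]])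
    then show ?thesis using assms that by simp
  qed
  have "haar_coeff f J = 0" if "J \<notin> nth_dyadic ` F" for J
    unfolding f(2) by (rule sum.neutral) (use that in auto)
  then have sub: "{J. haar_coeff f J \<noteq> 0} \<subseteq> nth_dyadic ` F" by blast
  have "norm (\<Sum>n\<in>F. a n *\<^sub>R haar_basis n) = haar_sq_norm (haar_coeff f)"
    unfolding f(1) by (simp add: norm_haar_span_def)
  also have "\<dots> = (LINT x|lborel. L2_set (\<lambda>J. haar_coeff f J * haar J x) (nth_dyadic ` F))"
    using assms sub by (intro haar_sq_norm_superset) auto
  also have "\<dots> = (LINT x|lborel. sqrt (\<Sum>n\<in>F. (a n / measure lborel (nth_dyadic n))\<^sup>2 * (haar (nth_dyadic n) x)\<^sup>2))"
    unfolding L2_set_def by (simp add: sum.reindex[OF inj] fn power_mult_distrib)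
  finally show ?thesis .
qed

lemma norm_haar_basis [simp]: "norm (haar_basis n) = 1"
proof -
  obtain f where f: "haar_basis n = completion_embed f"
    "haar_coeff f = (\<lambda>J. if J = nth_dyadic n then 1 / measure lborel (nth_dyadic n) else 0)"
    using haar_basis_comb by blast
  then show ?thesis
    using measure_dyadic_pos[OF nth_dyadic_in, of n] by (simp add: norm_haar_span_def haar_sq_norm_single)
qed

lemma haar_basis_dense:
  assumes "0 < \<epsilon>"
  shows "\<exists>a F. finite F \<and> norm (x - (\<Sum>n\<in>F. a n *\<^sub>R haar_basis n)) < \<epsilon>"
proof -
  obtain f where f: "norm (x - completion_embed f) < \<epsilon>" using completion_approx[OF assms] by blast
  have inj: "inj nth_dyadic" and surj: "range nth_dyadic = dyadic_intervals"
    using bij_betw_nth_dyadic by (auto simp: bij_betw_def)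
  define F where "F = nth_dyadic -` {J. haar_coeff f J \<noteq> 0}"
  define a where "a n = haar_coeff f (nth_dyadic n) * measure lborel (nth_dyadic n)" for n
  have F: "finite F" unfolding F_def by (rule finite_vimageI[OF _ inj]) simp
  obtain g where g: "(\<Sum>n\<in>F. a n *\<^sub>R haar_basis n) = completion_embed g"
    "\<And>J. haar_coeff g J = (\<Sum>n\<in>F. if J = nth_dyadic n then a n / measure lborel J else 0)"
    using haar_basis_sum_comb by blast
  have "haar_coeff g J = haar_coeff f J" for J
  proof (cases "J \<in> dyadic_intervals")
    case True
    then obtain m where m: "J = nth_dyadic m" using surj by blast
    have "haar_coeff g J = (\<Sum>n\<in>F. if m = n then haar_coeff f J else 0)"
      unfolding g(2) a_def m using measure_dyadic_pos[OF nth_dyadic_in]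
      by (intro sum.cong) (auto dest: injD[OF inj] simp: less_le)
    also have "\<dots> = haar_coeff f J" using F by (simp add: F_def m)
    finally show ?thesis .
  next
    case False
    then show ?thesis using haar_coeff_dyadic by metis
  qed
  then have "g = f" by (intro haar_span_eqI ext)
  then show ?thesis using f g(1) F by metis
qed

lemma haar_basis_one_unconditional:
  assumes "finite F" "\<And>i. \<bar>a i\<bar> \<le> \<bar>b i\<bar>"
  shows "norm (\<Sum>n\<in>F. a n *\<^sub>R haar_basis n) \<le> norm (\<Sum>n\<in>F. b n *\<^sub>R haar_basis n)"
proof -
  obtain f where f: "(\<Sum>n\<in>F. a n *\<^sub>R haar_basis n) = completion_embed f"
    "\<And>J. haar_coeff f J = (\<Sum>n\<in>F. if J = nth_dyadic n then a n / measure lborel J else 0)"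
    using haar_basis_sum_comb by blast
  obtain g where g: "(\<Sum>n\<in>F. b n *\<^sub>R haar_basis n) = completion_embed g"
    "\<And>J. haar_coeff g J = (\<Sum>n\<in>F. if J = nth_dyadic n then b n / measure lborel J else 0)"
    using haar_basis_sum_comb by blast
  have inj: "inj nth_dyadic" using bij_betw_nth_dyadic by (auto simp: bij_betw_def)
  have c: "(\<Sum>n\<in>F. if nth_dyadic m = nth_dyadic n then d n / r else 0) = (if m \<in> F then d m / r else 0)"
    for d :: "nat \<Rightarrow> real" and r m
    using assms(1) by (simp add: inj_eq[OF inj])
  have "\<bar>haar_coeff f J\<bar> \<le> \<bar>haar_coeff g J\<bar>" for J
  proof (cases "\<exists>m. J = nth_dyadic m")
    case True
    then obtain m where "J = nth_dyadic m" by blast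
    then show ?thesis using assms(2)[of m]
      by (simp add: f(2) g(2) c divide_right_mono)
  next
    case False
    then have "haar_coeff f J = 0" unfolding f(2) by (intro sum.neutral) auto
    then show ?thesis by simp
  qed
  then have "haar_sq_norm (haar_coeff f) \<le> haar_sq_norm (haar_coeff g)"
    by (intro haar_sq_norm_mono haar_coeff_in)
  then show ?thesis unfolding f(1) g(1) by (simp add: norm_haar_span_def)
qed

lemma haar_basis_nonzero: "haar_basis n \<noteq> 0"
  using norm_haar_basis[of n] by (metis norm_zero zero_neq_one)

lemma unconditional_basis_haar: "unconditional_basis haar_basis"
  by (rule one_unc_unconditional_basis[OF haar_basis_one_unconditional haar_basis_nonzero haar_basis_dense])

lemma biorthogonal_haar: "blinfun_apply (biorthogonal haar_basis i) (haar_basis j) = (if j = i then 1 else 0)"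
  by (rule one_unc_biorthogonal[OF haar_basis_one_unconditional haar_basis_nonzero haar_basis_dense])

end

theory Submission
  imports Defs
begin

text \<open>
  The idea is to replace the Haar system by a copy that lives on sparse binary digits. Player (II) chooses an
  increasing sequence of levels \<open>n k\<close>, one in each turn. The dyadic interval number \<open>k\<close> corresponds to a cell,
  a set of the same measure: the cells of the two halves of an interval arise from its cell by
  fixing the binary digit number \<open>n k + 1\<close>. At turn \<open>k\<close> the set \<open>E\<close> consists of all
  dyadic intervals of level \<open>n k\<close> inside the cell of \<open>k\<close>, with \<open>\<mu> = 1\<close> and \<open>\<lambda>\<close> the quotient of the lengths of the small
  interval and of the interval number \<open>k\<close>.

  Both equivalences hold with constant \<open>1\<close>. The norm of \<open>H\<^sup>1\<close> depends only on the
  square function, hence not on signs, and the square function of a combination of the played vectors has the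
  same distribution as that of the Haar system, because the cells form a tree of sets with the right
  measures (\<open>norm_node_cover_sum\<close>). For the functionals, the space is projected onto the
  span of the Haar basis by evaluating the played functionals. This replaces, for each \<open>k\<close>, the
  absolute values of the coefficients on the cell of \<open>k\<close> by something at most their average over the cell. Since the digits
  that define later cells are independent of the digits up to level \<open>n k\<close>, all these averages are taken
  simultaneously by averaging over the cells of the leaves of a finite tree, and
  Jensen's inequality for the Euclidean norm shows that the projection is a contraction
  (\<open>norm_node_averages_le\<close>). A contractive embedding with a contractive left inverse
  gives isometries of the spans and, by duality, of the spans of the functionals
  (\<open>dual_norm_isometric\<close>).

  The distance conditions hold once the level is large, uniformly over all subsets of the level and all signs
  (\<open>level_vectors_close\<close>). Vectors of increasing levels satisfy an upper \<open>2\<close>-estimate and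
  are therefore weakly null, and functionals of increasing levels are bounded and tend to \<open>0\<close> pointwise. Modulo a
  closed subspace of finite codimension the identity agrees with a bounded operator of finite rank, so these
  convergences force the distances to \<open>0\<close>. By uniformity, the threshold for the level
  depends only on the current move of player (I), and the strategy is explicit.
\<close>

section \<open>Dyadic intervals and binary digits\<close>

text \<open>With indices starting at \<open>0\<close>, the interval number \<open>k\<close> has the left half number \<open>2 * k + 1\<close> and the
  right half number \<open>2 * k + 2\<close>, as in a binary heap. So \<open>Suc k\<close> has the parent \<open>k div 2\<close>, and it is
  a left half iff \<open>k\<close> is even. The recursive definitions below follow this parent map.\<close>

fun dyadic_level :: "nat \<Rightarrow> nat" where
  "dyadic_level 0 = 0"
| "dyadic_level (Suc k) = Suc (dyadic_level (k div 2))"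

lemma dyadic_level_bounds: "2 ^ dyadic_level k \<le> Suc k" "Suc k < 2 ^ Suc (dyadic_level k)"
proof -
  have "2 ^ dyadic_level k \<le> Suc k \<and> Suc k < 2 ^ Suc (dyadic_level k)"
  proof (induction k rule: dyadic_level.induct)
    case (2 k)
    define q :: nat where "q = 2 ^ dyadic_level (k div 2)"
    have "q \<le> Suc (k div 2)" "Suc (k div 2) < 2 * q" using 2 by (simp_all add: q_def)
    then have "2 * q \<le> Suc (Suc k)" "Suc (Suc k) < 2 * (2 * q)" by linarith+
    then show ?case by (simp add: q_def)
  qed simp
  then show "2 ^ dyadic_level k \<le> Suc k" "Suc k < 2 ^ Suc (dyadic_level k)" by auto
qed

lemma finite_dyadic_level: "finite {i. dyadic_level i = n}"
proof (rule finite_subset)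
  show "{i. dyadic_level i = n} \<subseteq> {..<2 ^ Suc n}" using Suc_lessD[OF dyadic_level_bounds(2)] by auto
qed simp

lemma nth_dyadic_eq_interval:
  "nth_dyadic k = dyadic_interval (dyadic_level k) (k + 2 - 2 ^ dyadic_level k)"
  by (rule nth_dyadic_eq) (use dyadic_level_bounds[of k] in auto)

lemma mem_nth_dyadic:
  "x \<in> nth_dyadic k \<longleftrightarrow> \<lfloor>2 ^ dyadic_level k * x\<rfloor> = int k + 1 - 2 ^ dyadic_level k"
  unfolding nth_dyadic_eq_interval mem_dyadic_interval using dyadic_level_bounds[of k]
  by (auto simp: of_nat_diff)

lemma measure_nth_dyadic: "measure lborel (nth_dyadic k) = 1 / 2 ^ dyadic_level k"
  unfolding nth_dyadic_eq_interval measure_dyadic_interval ..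

text \<open>The norm of \<open>H\<^sup>1\<close> sees a Haar function only through its square, which is why signs, and the way
  an interval is cut into halves, never enter a norm computation.\<close>

lemma haar_nth_dyadic_square: "(haar (nth_dyadic k) x)\<^sup>2 = indicator (nth_dyadic k) x"
  by (metis abs_haar_dyadic nth_dyadic_in power2_abs indicator_simps power2_eq_square mult_1 mult_zero_left)

lemma nth_dyadic_measurable: "nth_dyadic k \<in> sets borel"
  by (simp add: nth_dyadic_eq_interval dyadic_interval_def)

lemma nth_dyadic_subset_unit: "nth_dyadic k \<subseteq> {0..<1}"
proof
  fix x assume "x \<in> nth_dyadic k"
  then have f: "\<lfloor>2 ^ dyadic_level k * x\<rfloor> = int k + 1 - 2 ^ dyadic_level k" by (simp add: mem_nth_dyadic)
  have "int (Suc k) < int (2 ^ Suc (dyadic_level k))" "int (2 ^ dyadic_level k) \<le> int (Suc k)"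
    using dyadic_level_bounds[of k] by linarith+
  then have "0 \<le> \<lfloor>2 ^ dyadic_level k * x\<rfloor>" "\<lfloor>2 ^ dyadic_level k * x\<rfloor> < 2 ^ dyadic_level k"
    unfolding f by auto
  then have "2 ^ dyadic_level k * 0 \<le> 2 ^ dyadic_level k * x" "2 ^ dyadic_level k * x < 2 ^ dyadic_level k * 1"
    by (simp_all add: floor_less_iff)
  moreover from this(1) have "0 \<le> x" by (rule mult_left_le_imp_le) simp
  ultimately have "0 \<le> x" "x < 1" by auto
  then show "x \<in> {0..<1}" by simp
qed

lemma nth_dyadic_disjoint:
  "dyadic_level i = dyadic_level j \<Longrightarrow> x \<in> nth_dyadic i \<Longrightarrow> x \<in> nth_dyadic j \<Longrightarrow> i = j"
  by (simp add: mem_nth_dyadic)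

lemma nth_dyadic_cover:
  assumes "x \<in> {0..<1}"
  obtains i where "dyadic_level i = n" "x \<in> nth_dyadic i"
proof -
  define l where "l = nat \<lfloor>2 ^ n * x\<rfloor>"
  have l: "int l = \<lfloor>2 ^ n * x\<rfloor>" using assms by (simp add: l_def)
  have "\<lfloor>2 ^ n * x\<rfloor> < 2 ^ n" using assms by (simp add: floor_less_iff)
  then have l2: "l < 2 ^ n" using l by (metis of_nat_less_iff of_nat_numeral of_nat_power)
  define i where "i = l + 2 ^ n - 1"
  have i: "Suc i = l + 2 ^ n" using l2 by (simp add: i_def)
  have "nth_dyadic i = dyadic_interval n (Suc l)" by (rule nth_dyadic_eq) (use l2 i in auto)
  moreover have lev: "dyadic_level i = n"
    using dyadic_interval_inject(1) nth_dyadic_eq_interval calculation by metis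
  ultimately show thesis using that[of i] l by (simp add: mem_dyadic_interval)
qed

text \<open>Finite unions of dyadic intervals of length \<open>1 / 2 ^ n\<close>, described by the fact that membership of
  \<open>x\<close> depends only on the first \<open>n\<close> binary digits of \<open>x\<close>.\<close>

definition level_set :: "nat \<Rightarrow> real set \<Rightarrow> bool" where
  "level_set n U \<longleftrightarrow> U \<in> sets borel \<and> U \<subseteq> {0..<1} \<and>
     (\<forall>x y. \<lfloor>2 ^ n * x\<rfloor> = \<lfloor>2 ^ n * y\<rfloor> \<longrightarrow> x \<in> U \<longrightarrow> y \<in> U)"

lemma level_set_refine: "level_set m U \<Longrightarrow> m \<le> n \<Longrightarrow> level_set n U"
  unfolding level_set_def using floor_coarsen by blast

lemma level_set_Int: "level_set n U \<Longrightarrow> level_set n V \<Longrightarrow> level_set n (U \<inter> V)"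
  unfolding level_set_def by blast

lemma level_set_nth_dyadic: "level_set (dyadic_level k) (nth_dyadic k)"
  unfolding level_set_def using nth_dyadic_subset_unit[of k] nth_dyadic_measurable[of k] by (auto simp: mem_nth_dyadic)

lemma level_set_unit: "level_set n {0..<1}"
proof -
  have "nth_dyadic 0 = {0..<1}" by (simp add: nth_dyadic_eq_interval dyadic_interval_def)
  then show ?thesis using level_set_refine[OF level_set_nth_dyadic[of 0]] by simp
qed

text \<open>The points whose binary digit number \<open>n + 1\<close> is \<open>0\<close> (for \<open>b\<close> true) or \<open>1\<close> (for \<open>b\<close> false).\<close>

abbreviation digit_half :: "nat \<Rightarrow> bool \<Rightarrow> real set" where
  "digit_half n b \<equiv> {x. even \<lfloor>2 ^ Suc n * x\<rfloor> = b}"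

lemma digit_half_measurable: "digit_half n b \<in> sets borel"
proof -
  have "(\<lambda>x::real. \<lfloor>2 ^ Suc n * x\<rfloor>) \<in> measurable borel (count_space UNIV)" by measurable
  from measurable_sets[OF this, of "{z. even z = b}"] show ?thesis by (simp add: vimage_def)
qed

lemma level_set_digit_half:
  assumes "level_set n U"
  shows "level_set (Suc n) (U \<inter> digit_half n b)"
proof -
  have U: "level_set (Suc n) U" using level_set_refine[OF assms] by simp
  show ?thesis
    unfolding level_set_def
  proof (intro conjI allI impI)
    show "U \<inter> digit_half n b \<in> sets borel" "U \<inter> digit_half n b \<subseteq> {0..<1}"
      using U digit_half_measurable[of n b] by (auto simp: level_set_def)
    fix x y :: real
    assume xy: "\<lfloor>2 ^ Suc n * x\<rfloor> = \<lfloor>2 ^ Suc n * y\<rfloor>" and x: "x \<in> U \<inter> digit_half n b"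
    from x xy U have "y \<in> U" unfolding level_set_def by blast
    moreover have "y \<in> digit_half n b" using x xy by simp
    ultimately show "y \<in> U \<inter> digit_half n b" ..
  qed
qed

text \<open>The digit number \<open>n + 1\<close> is independent of the first \<open>n\<close> digits: inside a
  union of intervals of level \<open>n\<close>, translation by \<open>1 / 2 ^ (n + 1)\<close> maps the half with digit \<open>0\<close> onto the
  half with digit \<open>1\<close>.\<close>

lemma measure_digit_half:
  assumes "level_set n U"
  shows "measure lborel (U \<inter> digit_half n b) = measure lborel U / 2"
proof -
  let ?d = "1 / 2 ^ Suc n :: real"
  let ?E = "U \<inter> digit_half n True" and ?O = "U \<inter> digit_half n False"
  have U: "U \<in> sets borel" "U \<subseteq> {0..<1}" using assms by (auto simp: level_set_def)
  have fl: "\<lfloor>2 ^ Suc n * (x + ?d)\<rfloor> = \<lfloor>2 ^ Suc n * x\<rfloor> + 1" for x :: real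
    by (simp add: distrib_left del: power_Suc)
  have half: "\<lfloor>2 ^ n * z\<rfloor> = \<lfloor>2 ^ Suc n * z\<rfloor> div 2" for z :: real
    using floor_divide_real_eq_div[of 2 "2 ^ Suc n * z"] by simp
  have "?O = (+) ?d ` ?E"
  proof (intro equalityI subsetI)
    fix y assume y: "y \<in> ?O"
    define x where "x = y - ?d"
    have yx: "y = x + ?d" by (simp add: x_def)
    have "even \<lfloor>2 ^ Suc n * x\<rfloor>" using y fl[of x] unfolding yx by simp
    moreover have "\<lfloor>2 ^ n * y\<rfloor> = \<lfloor>2 ^ n * x\<rfloor>"
      unfolding half yx fl by (rule even_succ_div_two[OF calculation])
    then have "x \<in> U" using y assms unfolding level_set_def by blast
    ultimately show "y \<in> (+) ?d ` ?E" unfolding yx by (auto simp: add.commute)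
  next
    fix y assume "y \<in> (+) ?d ` ?E"
    then obtain x where x: "x \<in> U" "even \<lfloor>2 ^ Suc n * x\<rfloor>" and yx: "y = x + ?d" by (auto simp: add.commute)
    have "\<lfloor>2 ^ n * x\<rfloor> = \<lfloor>2 ^ n * y\<rfloor>"
      unfolding half yx fl by (rule even_succ_div_two[OF x(2), symmetric])
    then have "y \<in> U" using x assms unfolding level_set_def by blast
    then show "y \<in> ?O" unfolding yx using fl[of x] x by simp
  qed
  then have "measure lebesgue ?O = measure lebesgue ?E" by (simp only: measure_translation)
  moreover have m: "?E \<in> sets borel" "?O \<in> sets borel"
    using U digit_half_measurable by (auto intro!: sets.Int)
  ultimately have eq: "measure lborel ?O = measure lborel ?E" by (simp add: measure_completion)
  have fin: "emeasure lborel S \<noteq> \<infinity>" if "S \<in> sets borel" "S \<subseteq> {0..<1}" for S :: "real set"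
  proof -
    have "emeasure lborel S \<le> emeasure lborel {0..<1::real}" using that by (intro emeasure_mono) auto
    then show ?thesis by (auto simp: top_unique)
  qed
  have "measure lborel (?E \<union> ?O) = measure lborel ?E + measure lborel ?O"
  proof (rule measure_Union)
    show "emeasure lborel ?E \<noteq> \<infinity>" "emeasure lborel ?O \<noteq> \<infinity>" using m U by (intro fin; blast)+
  qed (use m in auto)
  moreover have "?E \<union> ?O = U" by auto
  ultimately show ?thesis using eq by (cases b) auto
qed

section \<open>The tree of cells\<close>

text \<open>The tree of sets that copies the dyadic tree on sparse binary digits: the node \<open>k\<close> is split by the digit
  number \<open>n k + 1\<close>, where \<open>n k\<close> is a level attached to that node.\<close>

fun cell :: "(nat \<Rightarrow> nat) \<Rightarrow> nat \<Rightarrow> real set" where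
  "cell n 0 = {0..<1}"
| "cell n (Suc k) = cell n (k div 2) \<inter> digit_half (n (k div 2)) (even k)"

fun ancestors :: "nat \<Rightarrow> nat set" where
  "ancestors 0 = {}"
| "ancestors (Suc k) = insert (k div 2) (ancestors (k div 2))"

text \<open>Exactly what makes the digit that splits a node independent of the digits that define the node.\<close>

definition ancestor_mono :: "(nat \<Rightarrow> nat) \<Rightarrow> bool" where
  "ancestor_mono n \<longleftrightarrow> (\<forall>k. n (k div 2) < n (Suc k))"

lemma cell_cong: "(\<And>j. j < k \<Longrightarrow> n j = m j) \<Longrightarrow> cell n k = cell m k"
proof (induction k rule: ancestors.induct)
  case (2 k)
  have "cell n (k div 2) = cell m (k div 2)" by (rule 2) (simp add: 2(2))
  then show ?case by (simp add: 2(2))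
qed simp

lemma level_set_cell:
  assumes "ancestor_mono n"
  shows "level_set (n k) (cell n k)"
proof (induction k rule: ancestors.induct)
  case 1 show ?case by (simp add: level_set_unit)
next
  case (2 k)
  have "Suc (n (k div 2)) \<le> n (Suc k)" using assms by (simp add: ancestor_mono_def Suc_le_eq)
  with level_set_digit_half[OF 2] show ?case unfolding cell.simps by (rule level_set_refine)
qed

lemma ancestors_less: "j \<in> ancestors t \<Longrightarrow> 2 * j < t"
proof (induction t rule: ancestors.induct)
  case (2 k) then show ?case by auto
qed simp

lemma level_ancestors_less:
  assumes "ancestor_mono n" "j \<in> ancestors t"
  shows "n j < n t"
  using assms(2)
proof (induction t rule: ancestors.induct)
  case (2 k)
  then show ?case using assms(1) unfolding ancestor_mono_def by (metis ancestors.simps(2) insertE less_trans)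
qed simp

text \<open>Homogeneity: below the node \<open>j\<close>, every union of intervals of level \<open>n j\<close> inside the cell of \<open>j\<close> is cut in the
  same proportion by each later cell, because all later splittings use finer digits. This is
  the independence that makes the averaging argument for the functionals work.\<close>

lemma measure_level_set_cell:
  assumes n: "ancestor_mono n" and U: "level_set (n j) U" "U \<subseteq> cell n j"
    and j: "j = t \<or> j \<in> ancestors t"
  shows "measure lborel (U \<inter> cell n t) = measure lborel U * 2 ^ dyadic_level j / 2 ^ dyadic_level t"
proof (cases "j = t")
  case True
  then show ?thesis using U(2) by (simp add: Int_absorb2)
next
  case False
  then have "j \<in> ancestors t" using j by simp
  then show ?thesis
  proof (induction t rule: ancestors.induct)
    case (2 k)
    let ?q = "k div 2"
    have "n j \<le> n ?q"
      using 2(2) level_ancestors_less[OF n, of j ?q] by (cases "j = ?q") auto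
    then have "level_set (n ?q) U" by (rule level_set_refine[OF U(1)])
    then have "level_set (n ?q) (U \<inter> cell n ?q)" by (rule level_set_Int[OF _ level_set_cell[OF n]])
    from measure_digit_half[OF this, of "even k"]
    have "measure lborel (U \<inter> cell n (Suc k)) = measure lborel (U \<inter> cell n ?q) / 2"
      by (simp only: cell.simps Int_assoc)
    also have "measure lborel (U \<inter> cell n ?q) = measure lborel U * 2 ^ dyadic_level j / 2 ^ dyadic_level ?q"
    proof (cases "j = ?q")
      case True
      then show ?thesis using U(2) by (simp add: Int_absorb2)
    next
      case False
      then show ?thesis using 2 by simp
    qed
    finally show ?case by simp
  qed simp
qed

lemma root_ancestor: "0 = t \<or> 0 \<in> ancestors t"
  by (induction t rule: ancestors.induct) auto

lemma measure_cell:
  assumes "ancestor_mono n"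
  shows "measure lborel (cell n t) = 1 / 2 ^ dyadic_level t"
proof -
  have "cell n t \<subseteq> {0..<1}" using level_set_cell[OF assms, of t] by (simp add: level_set_def)
  then show ?thesis
    using measure_level_set_cell[OF assms level_set_unit _ root_ancestor[of t]]
    by (simp add: Int_absorb1)
qed

text \<open>The first \<open>N\<close> nodes of the heap form a binary tree whose leaves are the nodes \<open>N, \<dots>, 2 * N\<close>:
  passing from \<open>N\<close> to \<open>N + 1\<close> removes the leaf \<open>N\<close> and adds its children \<open>2 * N + 1\<close> and \<open>2 * N + 2\<close>.
  The cells of these leaves partition the unit interval.\<close>

lemma leaf_cover:
  "x \<in> {0..<1} \<Longrightarrow> \<exists>t\<in>{N..2 * N}. x \<in> cell n t"
proof (induction N)
  case (Suc N)
  then obtain t where t: "t \<in> {N..2 * N}" "x \<in> cell n t" by blast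
  show ?case
  proof (cases "t = N")
    case True
    have "Suc (2 * N) \<in> {Suc N..2 * Suc N}" "Suc (Suc (2 * N)) \<in> {Suc N..2 * Suc N}" by auto
    moreover have "x \<in> cell n (Suc (2 * N)) \<or> x \<in> cell n (Suc (Suc (2 * N)))"
      using t(2) True by simp
    ultimately show ?thesis by blast
  next
    case False
    then show ?thesis using t by auto
  qed
qed simp

text \<open>The two parts are proved by one induction, since a cell can meet a leaf below an old
  leaf \<open>N\<close> only if it meets the leaf \<open>N\<close> itself.\<close>

lemma leaf_unique_ancestors:
  "(\<forall>s\<in>{N..2*N}. \<forall>t\<in>{N..2*N}. x \<in> cell n s \<longrightarrow> x \<in> cell n t \<longrightarrow> s = t) \<and>
   (\<forall>j<N. \<forall>t\<in>{N..2*N}. x \<in> cell n j \<longrightarrow> x \<in> cell n t \<longrightarrow> j \<in> ancestors t)"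
proof (induction N)
  case (Suc N)
  have leaf: "t \<in> {N<..2*N} \<or> t = Suc (2 * N) \<or> t = Suc (Suc (2 * N))" if "t \<in> {Suc N..2 * Suc N}" for t
    using that by auto
  have par: "x \<in> cell n N" if "t = Suc (2 * N) \<or> t = Suc (Suc (2 * N))" "x \<in> cell n t" for t
    using that by auto
  have excl: "\<not> (x \<in> cell n (Suc (2 * N)) \<and> x \<in> cell n (Suc (Suc (2 * N))))" by auto
  have uni: "s = t" if "s \<in> {N..2*N}" "t \<in> {N..2*N}" "x \<in> cell n s" "x \<in> cell n t" for s t
    using Suc that by blast
  have N: "N \<in> {N..2*N}" by simp
  have old: False if "s \<in> {N<..2*N}" "x \<in> cell n s" "x \<in> cell n N" for s
    using uni[OF _ N that(2,3)] that(1) by simp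
  have "s = t" if st: "s \<in> {Suc N..2 * Suc N}" "t \<in> {Suc N..2 * Suc N}" "x \<in> cell n s" "x \<in> cell n t" for s t
  proof (cases "s \<in> {N<..2*N}")
    case True
    have "t \<in> {N<..2*N}" using leaf[OF st(2)] old[OF True st(3)] par[OF _ st(4)] by blast
    then show ?thesis using True by (intro uni st) auto
  next
    case False
    then have s: "s = Suc (2 * N) \<or> s = Suc (Suc (2 * N))" using leaf[OF st(1)] by blast
    have "t = Suc (2 * N) \<or> t = Suc (Suc (2 * N))"
      using leaf[OF st(2)] old[OF _ st(4) par[OF s st(3)]] by blast
    then show ?thesis using s excl st(3,4) by blast
  qed
  moreover have "j \<in> ancestors t" if jt: "j < Suc N" "t \<in> {Suc N..2 * Suc N}" "x \<in> cell n j" "x \<in> cell n t" for j t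
    using leaf[OF jt(2)]
  proof
    assume t: "t \<in> {N<..2*N}"
    then have "j \<noteq> N" using old[OF t jt(4)] jt(3) by blast
    then have "j < N" "t \<in> {N..2*N}" using jt(1) t by auto
    then show ?thesis using Suc jt(3,4) by blast
  next
    assume t: "t = Suc (2 * N) \<or> t = Suc (Suc (2 * N))"
    then have "ancestors t = insert N (ancestors N)" by auto
    moreover have "j = N \<or> j \<in> ancestors N"
      using Suc N jt(1,3) par[OF t jt(4)] less_Suc_eq by blast
    ultimately show ?thesis by simp
  qed
  ultimately show ?case by blast
qed simp

lemma cell_ancestors: "x \<in> cell n t \<Longrightarrow> j \<in> ancestors t \<Longrightarrow> x \<in> cell n j"
  by (induction t rule: ancestors.induct) auto

text \<open>Splitting each interval by its own next digit gives back the dyadic tree. Thus everything that is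
  proved about cells applies to the Haar basis itself.\<close>

lemma cell_dyadic_level: "cell dyadic_level k = nth_dyadic k"
proof (induction k rule: ancestors.induct)
  case 1 show ?case by (simp add: nth_dyadic_eq_interval dyadic_interval_def)
next
  case (2 k)
  let ?q = "k div 2" and ?d = "dyadic_level (k div 2)"
  show ?case
  proof (rule set_eqI)
    fix x :: real
    define p :: int where "p = 2 ^ ?d"
    define z where "z = \<lfloor>2 ^ Suc ?d * x\<rfloor>"
    have half: "\<lfloor>2 ^ ?d * x\<rfloor> = z div 2"
      using floor_divide_real_eq_div[of 2 "2 ^ Suc ?d * x"] by (simp add: z_def)
    have "x \<in> cell dyadic_level (Suc k) \<longleftrightarrow> z div 2 = int k div 2 + 1 - p \<and> even z = even k"
      by (simp only: cell.simps 2 Int_iff mem_nth_dyadic half mem_Collect_eq z_def p_def of_nat_div of_nat_numeral)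
    also have "\<dots> \<longleftrightarrow> z = int k + 2 - 2 * p"
    proof -
      define K where "K = int k"
      have "even k = even K" by (simp add: K_def)
      then show ?thesis unfolding K_def[symmetric]
        by (cases "even z"; cases "even K") (auto elim!: evenE oddE, presburger+)
    qed
    also have "\<dots> \<longleftrightarrow> x \<in> nth_dyadic (Suc k)"
      by (simp add: mem_nth_dyadic z_def p_def add.commute)
    finally show "x \<in> cell dyadic_level (Suc k) \<longleftrightarrow> x \<in> nth_dyadic (Suc k)" .
  qed
qed

lemma ancestor_mono_dyadic_level: "ancestor_mono dyadic_level"
  by (simp add: ancestor_mono_def)

section \<open>Square functions on the tree\<close>

lemma integrable_L2_set:
  fixes f :: "'i \<Rightarrow> 'a \<Rightarrow> real"
  assumes "\<And>j. j \<in> S \<Longrightarrow> integrable M (f j)"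
  shows "integrable M (\<lambda>x. L2_set (\<lambda>j. f j x) S)"
proof (rule Bochner_Integration.integrable_bound)
  show "integrable M (\<lambda>x. \<Sum>j\<in>S. \<bar>f j x\<bar>)"
    using assms by (intro Bochner_Integration.integrable_sum integrable_abs)
  show "(\<lambda>x. L2_set (\<lambda>j. f j x) S) \<in> borel_measurable M"
    unfolding L2_set_def using assms
    by (intro borel_measurable_sqrt[THEN measurable_compose[rotated]] borel_measurable_sum borel_measurable_power) auto
  show "AE x in M. norm (L2_set (\<lambda>j. f j x) S) \<le> norm (\<Sum>j\<in>S. \<bar>f j x\<bar>)"
    by (intro AE_I2) (simp add: L2_set_le_sum_abs sum_nonneg)
qed

text \<open>Minkowski's integral inequality, or Jensen's inequality for the Euclidean norm: test the
  vector of integrals against itself and use the Cauchy-Schwarz inequality pointwise.\<close>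

lemma L2_set_integral_le:
  fixes f :: "'i \<Rightarrow> 'a \<Rightarrow> real"
  assumes f: "\<And>j. j \<in> S \<Longrightarrow> integrable M (f j)"
  shows "L2_set (\<lambda>j. LINT x|M. f j x) S \<le> (LINT x|M. L2_set (\<lambda>j. f j x) S)"
proof -
  define u where "u j = (LINT x|M. f j x)" for j
  let ?L = "L2_set u S" and ?R = "LINT x|M. L2_set (\<lambda>j. f j x) S"
  have "?L * ?L = (\<Sum>j\<in>S. u j * u j)"
    using sum_nonneg[of S "\<lambda>j. u j * u j"] by (simp add: L2_set_def power2_eq_square flip: real_sqrt_mult)
  also have "\<dots> = (\<Sum>j\<in>S. (LINT x|M. u j * f j x))" by (simp add: u_def)
  also have "\<dots> = (LINT x|M. (\<Sum>j\<in>S. u j * f j x))"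
    by (rule Bochner_Integration.integral_sum[symmetric]) (simp add: f)
  also have "\<dots> \<le> (LINT x|M. ?L * L2_set (\<lambda>j. f j x) S)"
  proof (rule integral_mono)
    show "integrable M (\<lambda>x. \<Sum>j\<in>S. u j * f j x)" using f by (intro Bochner_Integration.integrable_sum) simp
    show "integrable M (\<lambda>x. ?L * L2_set (\<lambda>j. f j x) S)" by (intro integrable_mult_right integrable_L2_set f)
    show "(\<Sum>j\<in>S. u j * f j x) \<le> ?L * L2_set (\<lambda>j. f j x) S" for x
    proof -
      have "(\<Sum>j\<in>S. u j * f j x) \<le> (\<Sum>j\<in>S. \<bar>u j\<bar> * \<bar>f j x\<bar>)"
        by (intro sum_mono) (simp flip: abs_mult)
      also have "\<dots> \<le> ?L * L2_set (\<lambda>j. f j x) S" by (rule L2_set_mult_ineq)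
      finally show ?thesis .
    qed
  qed
  also have "\<dots> = ?L * ?R" by simp
  finally have "?L * ?L \<le> ?L * ?R" .
  moreover have "0 \<le> ?R" by (rule integral_nonneg_AE) (simp add: L2_set_nonneg)
  ultimately have "?L \<le> ?R"
    using L2_set_nonneg[of u S] by (cases "?L = 0") (auto simp: mult_le_cancel_left)
  then show ?thesis unfolding u_def[abs_def] .
qed

lemma integrable_indicator_level_set:
  assumes "level_set n U"
  shows "integrable lborel (indicator U :: real \<Rightarrow> real)"
proof (rule integrable_real_indicator)
  have U: "U \<in> sets borel" "U \<subseteq> {0..<1}" using assms by (auto simp: level_set_def)
  then show "U \<in> sets lborel" by simp
  have "emeasure lborel U \<le> emeasure lborel {0..<1::real}" using U by (intro emeasure_mono) auto
  also have "\<dots> < \<infinity>" by simp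
  finally show "emeasure lborel U < \<infinity>" .
qed

lemmas integrable_indicator_nth_dyadic [simp, intro] = integrable_indicator_level_set[OF level_set_nth_dyadic]

lemma norm_haar_sum:
  assumes "finite F"
  shows "norm (\<Sum>i\<in>F. a i *\<^sub>R haar_basis i)
    = (LINT x|lborel. L2_set (\<lambda>i. a i * 2 ^ dyadic_level i * indicator (nth_dyadic i) x) F)"
proof -
  have "(indicator A x :: real)\<^sup>2 = indicator A x" for A and x :: real by (simp add: indicator_def)
  then show ?thesis
    unfolding norm_haar_basis_sum[OF assms] L2_set_def
    by (simp add: measure_nth_dyadic haar_nth_dyadic_square power_mult_distrib)
qed

lemma L2_set_single_support:
  assumes "\<And>i. i \<in> E \<Longrightarrow> i \<noteq> j \<Longrightarrow> v i = 0" "finite E"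
  shows "L2_set v E = (\<Sum>i\<in>E. \<bar>v i\<bar>)"
proof (cases "j \<in> E")
  case True
  have "(\<Sum>i\<in>E. (v i)\<^sup>2) = (\<Sum>i\<in>{j}. (v i)\<^sup>2)" "(\<Sum>i\<in>E. \<bar>v i\<bar>) = (\<Sum>i\<in>{j}. \<bar>v i\<bar>)"
    by (rule sum.mono_neutral_right; use True assms in auto)+
  then show ?thesis by (simp add: L2_set_def)
next
  case False
  then have "v i = 0" if "i \<in> E" for i using assms(1) that by blast
  then show ?thesis by (simp add: L2_set_def)
qed

text \<open>Within one level the intervals are disjoint, so at each point the square function of a block of one level is
  a plain sum with at most one nonzero term; different blocks add up in the Euclidean norm.\<close>

lemma norm_block_sum:
  fixes n :: "nat \<Rightarrow> nat"
  assumes n: "inj n" and E: "\<And>k. E k \<subseteq> {i. dyadic_level i = n k}"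
  shows "norm (\<Sum>k<N. \<Sum>i\<in>E k. \<beta> k i *\<^sub>R haar_basis i)
    = (LINT x|lborel. L2_set (\<lambda>k. 2 ^ n k * (\<Sum>i\<in>E k. \<bar>\<beta> k i\<bar> * indicator (nth_dyadic i) x)) {..<N})"
proof -
  \<comment> \<open>The level of an index determines its block, so the coefficients of all blocks form one family.\<close>
  define a where "a i = \<beta> (inv n (dyadic_level i)) i" for i
  have fin: "finite (E k)" for k by (rule finite_subset[OF E finite_dyadic_level])
  have disj: "E k \<inter> E l = {}" if "k \<noteq> l" for k l
  proof -
    have "n k \<noteq> n l" using that injD[OF n] by blast
    then show ?thesis using E[of k] E[of l] by fastforce
  qed
  have a: "a i = \<beta> k i" "dyadic_level i = n k" if "i \<in> E k" for i k
    using E[of k] that by (auto simp: a_def inv_f_f[OF n])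
  have "(\<Sum>k<N. \<Sum>i\<in>E k. \<beta> k i *\<^sub>R haar_basis i) = (\<Sum>k<N. \<Sum>i\<in>E k. a i *\<^sub>R haar_basis i)"
    by (intro sum.cong) (simp_all add: a)
  also have "\<dots> = (\<Sum>i\<in>(\<Union>k<N. E k). a i *\<^sub>R haar_basis i)"
    by (rule sum.UNION_disjoint[symmetric]) (use fin disj in auto)
  finally have "norm (\<Sum>k<N. \<Sum>i\<in>E k. \<beta> k i *\<^sub>R haar_basis i)
    = (LINT x|lborel. L2_set (\<lambda>i. a i * 2 ^ dyadic_level i * indicator (nth_dyadic i) x) (\<Union>k<N. E k))"
    using fin by (simp add: norm_haar_sum)
  also have "\<dots> = (LINT x|lborel. L2_set (\<lambda>k. 2 ^ n k * (\<Sum>i\<in>E k. \<bar>\<beta> k i\<bar> * indicator (nth_dyadic i) x)) {..<N})"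
  proof (rule Bochner_Integration.integral_cong[OF refl])
    fix x
    let ?v = "\<lambda>i. a i * 2 ^ dyadic_level i * indicator (nth_dyadic i) x :: real"
    have block: "2 ^ n k * (\<Sum>i\<in>E k. \<bar>\<beta> k i\<bar> * indicator (nth_dyadic i) x) = L2_set ?v (E k)" for k
    proof -
      obtain j where j: "\<And>i. i \<in> E k \<Longrightarrow> i \<noteq> j \<Longrightarrow> x \<notin> nth_dyadic i"
      proof (cases "\<exists>j\<in>E k. x \<in> nth_dyadic j")
        case True
        then obtain j where "j \<in> E k" "x \<in> nth_dyadic j" by blast
        then show ?thesis using that[of j] a(2) nth_dyadic_disjoint by metis
      qed (use that in blast)
      have "L2_set ?v (E k) = (\<Sum>i\<in>E k. \<bar>?v i\<bar>)"
        by (rule L2_set_single_support[where j = j]) (use j fin in auto)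
      also have "\<dots> = (\<Sum>i\<in>E k. 2 ^ n k * (\<bar>\<beta> k i\<bar> * indicator (nth_dyadic i) x))"
        by (intro sum.cong) (auto simp: a abs_mult indicator_def)
      finally show ?thesis by (simp add: sum_distrib_left)
    qed
    have "(\<Sum>i\<in>(\<Union>k<N. E k). (?v i)\<^sup>2) = (\<Sum>k<N. \<Sum>i\<in>E k. (?v i)\<^sup>2)"
      by (rule sum.UNION_disjoint) (use fin disj in auto)
    also have "\<dots> = (\<Sum>k<N. (L2_set ?v (E k))\<^sup>2)"
      by (simp add: L2_set_def sum_nonneg)
    finally show "L2_set ?v (\<Union>k<N. E k) = L2_set (\<lambda>k. 2 ^ n k * (\<Sum>i\<in>E k. \<bar>\<beta> k i\<bar> * indicator (nth_dyadic i) x)) {..<N}"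
      unfolding block by (simp add: L2_set_def)
  qed
  finally show ?thesis .
qed

lemma leaf_expansion:
  assumes n: "ancestor_mono n" and v: "x \<notin> {0..<1} \<Longrightarrow> v = (0::real)"
  shows "v = (\<Sum>t\<in>{N..2 * N}. indicator (cell n t) x * v)"
proof (cases "x \<in> {0..<1}")
  case True
  obtain t where t: "t \<in> {N..2*N}" "x \<in> cell n t" using leaf_cover[OF True] by blast
  have "(\<Sum>s\<in>{N..2 * N}. indicator (cell n s) x * v) = (\<Sum>s\<in>{t}. indicator (cell n s) x * v)"
  proof (rule sum.mono_neutral_right)
    show "\<forall>s\<in>{N..2 * N} - {t}. indicator (cell n s) x * v = 0"
      using leaf_unique_ancestors[of N x n] t by (auto simp: indicator_def)
  qed (use t in auto)
  then show ?thesis using t by simp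
qed (simp add: v)

text \<open>On the cell of a leaf the square function is constant, as the cells of the ancestors contain that cell and the
  other ones miss it. The right-hand side does not depend on \<open>n\<close>: this is why replacing dyadic
  intervals by cells preserves norms.\<close>

lemma integral_cell_tree:
  assumes n: "ancestor_mono n"
  shows "(LINT x|lborel. L2_set (\<lambda>k. d k * indicator (cell n k) x) {..<N})
    = (\<Sum>t\<in>{N..2 * N}. L2_set d (ancestors t) / 2 ^ dyadic_level t)"
proof -
  let ?\<phi> = "\<lambda>x. L2_set (\<lambda>k. d k * indicator (cell n k) x) {..<N}"
  have unit: "cell n t \<subseteq> {0..<1}" for t using level_set_cell[OF n, of t] by (simp add: level_set_def)
  have "?\<phi> x = (\<Sum>t\<in>{N..2 * N}. L2_set d (ancestors t) * indicator (cell n t) x)" for x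
  proof -
    have "?\<phi> x = 0" if "x \<notin> {0..<1}"
    proof -
      have "x \<notin> cell n k" for k using unit[of k] that by blast
      then show ?thesis by (simp add: L2_set_def)
    qed
    then have "?\<phi> x = (\<Sum>t\<in>{N..2 * N}. indicator (cell n t) x * ?\<phi> x)" by (rule leaf_expansion[OF n])
    also have "\<dots> = (\<Sum>t\<in>{N..2 * N}. L2_set d (ancestors t) * indicator (cell n t) x)"
    proof (rule sum.cong[OF refl])
      fix t assume t: "t \<in> {N..2 * N}"
      show "indicator (cell n t) x * ?\<phi> x = L2_set d (ancestors t) * indicator (cell n t) x"
      proof (cases "x \<in> cell n t")
        case True
        have sub: "ancestors t \<subseteq> {..<N}" using ancestors_less[of _ t] t by fastforce
        have "(\<Sum>k<N. (d k * indicator (cell n k) x)\<^sup>2) = (\<Sum>k\<in>ancestors t. (d k)\<^sup>2)"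
        proof (rule sum.mono_neutral_cong_right[OF _ sub])
          show "\<forall>k\<in>{..<N} - ancestors t. (d k * indicator (cell n k) x)\<^sup>2 = 0"
            using leaf_unique_ancestors[of N x n] True t by (auto simp: indicator_def)
        qed (use cell_ancestors[OF True] in auto)
        then show ?thesis using True by (simp add: L2_set_def)
      qed simp
    qed
    finally show ?thesis .
  qed
  then have "(LINT x|lborel. ?\<phi> x)
      = (LINT x|lborel. (\<Sum>t\<in>{N..2 * N}. L2_set d (ancestors t) * indicator (cell n t) x))"
    by (simp only:)
  also have "\<dots> = (\<Sum>t\<in>{N..2 * N}. (LINT x|lborel. L2_set d (ancestors t) * indicator (cell n t) x))"
    by (intro Bochner_Integration.integral_sum integrable_mult_right integrable_indicator_level_set[OF level_set_cell[OF n]])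
  also have "\<dots> = (\<Sum>t\<in>{N..2 * N}. L2_set d (ancestors t) / 2 ^ dyadic_level t)"
    by (simp add: measure_cell[OF n])
  finally show ?thesis .
qed

lemma norm_haar_tree:
  "norm (\<Sum>k<N. c k *\<^sub>R haar_basis k)
    = (\<Sum>t\<in>{N..2 * N}. L2_set (\<lambda>k. c k * 2 ^ dyadic_level k) (ancestors t) / 2 ^ dyadic_level t)"
  by (simp add: norm_haar_sum integral_cell_tree[OF ancestor_mono_dyadic_level, symmetric] cell_dyadic_level)

section \<open>Blocks that copy the Haar system\<close>

text \<open>The indices of the dyadic intervals of level \<open>n k\<close> that make up the cell of the node \<open>k\<close>. These are the
  sets that player (II) plays.\<close>

definition node_cover :: "(nat \<Rightarrow> nat) \<Rightarrow> nat \<Rightarrow> nat set" where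
  "node_cover n k = {i. dyadic_level i = n k \<and> nth_dyadic i \<subseteq> cell n k}"

lemma finite_node_cover: "finite (node_cover n k)"
  by (rule finite_subset[OF _ finite_dyadic_level[of "n k"]]) (auto simp: node_cover_def)

lemma sum_indicator_node_cover:
  assumes "ancestor_mono n"
  shows "(\<Sum>i\<in>node_cover n k. indicator (nth_dyadic i) x) = (indicator (cell n k) x :: real)"
proof (cases "x \<in> cell n k")
  case True
  note cell = level_set_cell[OF assms, of k, unfolded level_set_def]
  obtain i where i: "dyadic_level i = n k" "x \<in> nth_dyadic i"
    using nth_dyadic_cover[of x "n k"] True cell by blast
  have "nth_dyadic i \<subseteq> cell n k"
  proof
    fix y assume "y \<in> nth_dyadic i"
    then have "\<lfloor>2 ^ n k * x\<rfloor> = \<lfloor>2 ^ n k * y\<rfloor>" using i by (simp add: mem_nth_dyadic)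
    then show "y \<in> cell n k" using cell True by blast
  qed
  then have "i \<in> node_cover n k" using i by (simp add: node_cover_def)
  then have "(\<Sum>j\<in>node_cover n k. indicator (nth_dyadic j) x) = (\<Sum>j\<in>{i}. (indicator (nth_dyadic j) x :: real))"
  proof (intro sum.mono_neutral_right finite_node_cover ballI)
    fix j assume "j \<in> node_cover n k - {i}"
    then have "dyadic_level j = dyadic_level i" "j \<noteq> i" using i(1) by (auto simp: node_cover_def)
    then have "x \<notin> nth_dyadic j" using nth_dyadic_disjoint[of j i x] i(2) by blast
    then show "indicator (nth_dyadic j) x = (0 :: real)" by simp
  qed simp
  then show ?thesis using True i by simp
next
  case False
  then have "x \<notin> nth_dyadic i" if "i \<in> node_cover n k" for i using that by (auto simp: node_cover_def)
  then show ?thesis using False by simp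
qed

lemma card_node_cover:
  assumes "ancestor_mono n"
  shows "real (card (node_cover n k)) = 2 ^ n k / 2 ^ dyadic_level k"
proof -
  have "1 / 2 ^ dyadic_level k = (LINT x|lborel. indicator (cell n k) x :: real)"
    by (simp add: measure_cell[OF assms])
  also have "\<dots> = (LINT x|lborel. (\<Sum>i\<in>node_cover n k. indicator (nth_dyadic i) x))"
    by (simp only: sum_indicator_node_cover[OF assms])
  also have "\<dots> = (\<Sum>i\<in>node_cover n k. (LINT x|lborel. indicator (nth_dyadic i) x))"
    by (rule Bochner_Integration.integral_sum) simp
  also have "\<dots> = (\<Sum>i\<in>node_cover n k. 1 / 2 ^ n k)"
    by (rule sum.cong) (auto simp: measure_nth_dyadic node_cover_def)
  finally show ?thesis by (simp add: field_simps)
qed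

lemma strict_mono_ancestor_mono: "strict_mono n \<Longrightarrow> ancestor_mono n"
  by (simp add: ancestor_mono_def strict_mono_less less_Suc_eq_le)

text \<open>The blocks played by player (II) have the square function of the tree of cells, so they
  span an isometric copy of the span of the Haar basis, whatever the signs are.\<close>

lemma norm_node_cover_sum:
  assumes n: "strict_mono n" and s: "\<And>k i. i \<in> node_cover n k \<Longrightarrow> \<bar>s k i\<bar> = (1 :: real)"
  shows "norm (\<Sum>k<N. c k *\<^sub>R (\<Sum>i\<in>node_cover n k. (s k i * (2 ^ dyadic_level k / 2 ^ n k)) *\<^sub>R haar_basis i))
    = norm (\<Sum>k<N. c k *\<^sub>R haar_basis k)"
proof -
  have am: "ancestor_mono n" using n by (rule strict_mono_ancestor_mono)
  let ?\<beta> = "\<lambda>k i. c k * (s k i * (2 ^ dyadic_level k / 2 ^ n k))"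
  have "2 ^ n k * (\<Sum>i\<in>node_cover n k. \<bar>?\<beta> k i\<bar> * indicator (nth_dyadic i) x)
      = \<bar>c k\<bar> * 2 ^ dyadic_level k * indicator (cell n k) x" for k x
  proof -
    have "(\<Sum>i\<in>node_cover n k. \<bar>?\<beta> k i\<bar> * indicator (nth_dyadic i) x)
        = (\<Sum>i\<in>node_cover n k. \<bar>c k\<bar> * 2 ^ dyadic_level k / 2 ^ n k * indicator (nth_dyadic i) x)"
      by (rule sum.cong) (auto simp: abs_mult s)
    also have "\<dots> = \<bar>c k\<bar> * 2 ^ dyadic_level k / 2 ^ n k * indicator (cell n k) x"
      by (simp only: sum_indicator_node_cover[OF am] flip: sum_distrib_left)
    finally show ?thesis by simp
  qed
  note block = this
  have "norm (\<Sum>k<N. c k *\<^sub>R (\<Sum>i\<in>node_cover n k. (s k i * (2 ^ dyadic_level k / 2 ^ n k)) *\<^sub>R haar_basis i))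
    = (LINT x|lborel. L2_set (\<lambda>k. 2 ^ n k * (\<Sum>i\<in>node_cover n k. \<bar>?\<beta> k i\<bar> * indicator (nth_dyadic i) x)) {..<N})"
    unfolding scaleR_sum_right scaleR_scaleR
    by (rule norm_block_sum) (auto simp: node_cover_def strict_mono_imp_inj_on[OF n])
  also have "\<dots> = (\<Sum>t\<in>{N..2 * N}. L2_set (\<lambda>k. \<bar>c k\<bar> * 2 ^ dyadic_level k) (ancestors t) / 2 ^ dyadic_level t)"
    unfolding block by (rule integral_cell_tree[OF am])
  also have "\<dots> = norm (\<Sum>k<N. c k *\<^sub>R haar_basis k)"
    unfolding norm_haar_tree L2_set_def power_mult_distrib power2_abs ..
  finally show ?thesis .
qed

text \<open>The adjoint side: the operator that maps \<open>f\<close> to the combination of Haar functions with the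
  coefficients of \<open>f\<close> against the played functionals is a contraction. On the cell of a leaf, the coefficients
  that it produces are bounded by the averages of the square functions \<open>g k\<close> of the blocks
  over that cell, for every ancestor \<open>k\<close> at once: by homogeneity the average of \<open>g k\<close> over the small
  cell of the leaf is its average over the whole cell of \<open>k\<close>. So Jensen's inequality on each leaf gives the bound.\<close>

lemma norm_node_averages_le:
  assumes n: "strict_mono n" and s: "\<And>k i. i \<in> node_cover n k \<Longrightarrow> \<bar>s k i\<bar> = (1 :: real)"
  shows "norm (\<Sum>k<N. (\<Sum>i\<in>node_cover n k. s k i * a i) *\<^sub>R haar_basis k)
    \<le> norm (\<Sum>k<N. \<Sum>i\<in>node_cover n k. a i *\<^sub>R haar_basis i)"
proof -
  have am: "ancestor_mono n" using n by (rule strict_mono_ancestor_mono)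
  define c where "c k = (\<Sum>i\<in>node_cover n k. s k i * a i)" for k
  define g where "g k x = 2 ^ n k * (\<Sum>i\<in>node_cover n k. \<bar>a i\<bar> * indicator (nth_dyadic i) x)" for k x
  let ?cell = "\<lambda>t. indicator (cell n t) :: real \<Rightarrow> real"
  have int_g: "integrable lborel (g k)" for k
    unfolding g_def by (intro integrable_mult_right Bochner_Integration.integrable_sum) simp
  have int_cell: "integrable lborel (\<lambda>x. ?cell t x * f x)" if "integrable lborel f" for f t
    using integrable_mult_indicator[OF _ that, of "cell n t"] level_set_cell[OF am, of t]
    by (simp add: level_set_def)
  have g0: "g k x = 0" if "x \<notin> {0..<1}" for k x
  proof -
    have "x \<notin> nth_dyadic i" for i using nth_dyadic_subset_unit[of i] that by blast
    then show ?thesis by (simp add: g_def)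
  qed
  \<comment> \<open>The averages are taken against the cell of the leaf \<open>t\<close>, so one integral serves all ancestors.\<close>
  have average: "\<bar>c k * 2 ^ dyadic_level k\<bar> / 2 ^ dyadic_level t \<le> (LINT x|lborel. ?cell t x * g k x)"
    if "k \<in> ancestors t" for k t
  proof -
    have "(LINT x|lborel. ?cell t x * g k x)
        = (LINT x|lborel. (\<Sum>i\<in>node_cover n k. 2 ^ n k * \<bar>a i\<bar> * indicator (nth_dyadic i \<inter> cell n t) x))"
      by (intro Bochner_Integration.integral_cong refl)
        (simp add: g_def sum_distrib_left indicator_inter_arith mult_ac)
    also have "\<dots> = (\<Sum>i\<in>node_cover n k. (LINT x|lborel. 2 ^ n k * \<bar>a i\<bar> * indicator (nth_dyadic i \<inter> cell n t) x))"
    proof (intro Bochner_Integration.integral_sum integrable_mult_right)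
      fix i
      have "level_set (max (dyadic_level i) (n t)) (nth_dyadic i \<inter> cell n t)"
        by (intro level_set_Int level_set_refine[OF level_set_nth_dyadic] level_set_refine[OF level_set_cell[OF am]]) auto
      then show "integrable lborel (indicator (nth_dyadic i \<inter> cell n t) :: real \<Rightarrow> real)"
        by (rule integrable_indicator_level_set)
    qed
    also have "\<dots> = (\<Sum>i\<in>node_cover n k. \<bar>a i\<bar> * (2 ^ dyadic_level k / 2 ^ dyadic_level t))"
    proof (rule sum.cong[OF refl])
      fix i assume i: "i \<in> node_cover n k"
      have "measure lborel (nth_dyadic i \<inter> cell n t)
          = measure lborel (nth_dyadic i) * 2 ^ dyadic_level k / 2 ^ dyadic_level t"
        using i level_set_nth_dyadic[of i] that
        by (intro measure_level_set_cell[OF am]) (auto simp: node_cover_def)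
      then show "(LINT x|lborel. 2 ^ n k * \<bar>a i\<bar> * indicator (nth_dyadic i \<inter> cell n t) x)
          = \<bar>a i\<bar> * (2 ^ dyadic_level k / 2 ^ dyadic_level t)"
        using i by (simp add: measure_nth_dyadic node_cover_def)
    qed
    also have "\<dots> = (\<Sum>i\<in>node_cover n k. \<bar>a i\<bar>) * (2 ^ dyadic_level k / 2 ^ dyadic_level t)"
      by (rule sum_distrib_right[symmetric])
    also have "\<dots> \<ge> \<bar>c k\<bar> * (2 ^ dyadic_level k / 2 ^ dyadic_level t)"
    proof (rule mult_right_mono)
      have "\<bar>c k\<bar> \<le> (\<Sum>i\<in>node_cover n k. \<bar>s k i * a i\<bar>)" unfolding c_def by (rule sum_abs)
      also have "\<dots> = (\<Sum>i\<in>node_cover n k. \<bar>a i\<bar>)" by (rule sum.cong) (auto simp: abs_mult s)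
      finally show "\<bar>c k\<bar> \<le> (\<Sum>i\<in>node_cover n k. \<bar>a i\<bar>)" .
    qed simp
    finally show ?thesis by (simp add: abs_mult)
  qed
  have "norm (\<Sum>k<N. c k *\<^sub>R haar_basis k)
      = (\<Sum>t\<in>{N..2 * N}. L2_set (\<lambda>k. c k * 2 ^ dyadic_level k) (ancestors t) / 2 ^ dyadic_level t)"
    by (rule norm_haar_tree)
  also have "\<dots> \<le> (\<Sum>t\<in>{N..2 * N}. (LINT x|lborel. ?cell t x * L2_set (\<lambda>k. g k x) {..<N}))"
  proof (rule sum_mono)
    fix t assume t: "t \<in> {N..2 * N}"
    have sub: "ancestors t \<subseteq> {..<N}" using ancestors_less[of _ t] t by fastforce
    have "L2_set (\<lambda>k. c k * 2 ^ dyadic_level k) (ancestors t) / 2 ^ dyadic_level t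
        = L2_set (\<lambda>k. \<bar>c k * 2 ^ dyadic_level k\<bar> / 2 ^ dyadic_level t) (ancestors t)"
      using L2_set_left_distrib[of "1 / 2 ^ dyadic_level t" "\<lambda>k. \<bar>c k * 2 ^ dyadic_level k\<bar>" "ancestors t"]
      by (simp add: L2_set_def)
    also have "\<dots> \<le> L2_set (\<lambda>k. LINT x|lborel. ?cell t x * g k x) (ancestors t)"
      by (rule L2_set_mono) (auto intro: average)
    also have "\<dots> \<le> L2_set (\<lambda>k. LINT x|lborel. ?cell t x * g k x) {..<N}"
      unfolding L2_set_def by (intro real_sqrt_le_mono sum_mono2 sub) auto
    also have "\<dots> \<le> (LINT x|lborel. L2_set (\<lambda>k. ?cell t x * g k x) {..<N})"
      by (rule L2_set_integral_le) (intro int_cell int_g)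
    also have "\<dots> = (LINT x|lborel. ?cell t x * L2_set (\<lambda>k. g k x) {..<N})"
      by (intro Bochner_Integration.integral_cong refl) (simp add: L2_set_def indicator_def)
    finally show "L2_set (\<lambda>k. c k * 2 ^ dyadic_level k) (ancestors t) / 2 ^ dyadic_level t
        \<le> (LINT x|lborel. ?cell t x * L2_set (\<lambda>k. g k x) {..<N})" .
  qed
  also have "\<dots> = (LINT x|lborel. (\<Sum>t\<in>{N..2 * N}. ?cell t x * L2_set (\<lambda>k. g k x) {..<N}))"
    by (rule Bochner_Integration.integral_sum[symmetric]) (intro int_cell integrable_L2_set int_g)
  also have "\<dots> = (LINT x|lborel. L2_set (\<lambda>k. g k x) {..<N})"
    by (intro Bochner_Integration.integral_cong refl leaf_expansion[OF am, symmetric]) (simp add: g0 L2_set_def)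
  also have "\<dots> = norm (\<Sum>k<N. \<Sum>i\<in>node_cover n k. a i *\<^sub>R haar_basis i)"
    unfolding g_def
    by (rule norm_block_sum[symmetric]) (auto simp: node_cover_def strict_mono_imp_inj_on[OF n])
  finally show ?thesis by (simp add: c_def)
qed

section \<open>Distances to subspaces of finite codimension\<close>

text \<open>Dividing by \<open>c\<close> shows that \<open>x / c\<close> is the difference of \<open>v\<close> and a point of \<open>W\<close>.\<close>

lemma coset_coordinate_bound:
  fixes W :: "'a::real_normed_vector set"
  assumes W: "subspace W" "x - c *\<^sub>R v \<in> W"
  shows "\<bar>c\<bar> * infdist v W \<le> norm x"
proof (cases "c = 0")
  case False
  have "v - (1 / c) *\<^sub>R x = - (1 / c) *\<^sub>R (x - c *\<^sub>R v)"
    using False by (simp add: scaleR_diff_right)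
  then have mem: "v - (1 / c) *\<^sub>R x \<in> W" by (simp only: subspace_scale[OF W])
  have "infdist v W \<le> dist v (v - (1 / c) *\<^sub>R x)" by (rule infdist_le[OF mem])
  also have "\<dots> = norm x / \<bar>c\<bar>" by (simp add: dist_norm divide_inverse mult.commute)
  finally show ?thesis using False by (simp add: field_simps)
qed simp

lemma infdist_pos_closed:
  fixes W :: "'a::real_normed_vector set"
  assumes "closed W" "subspace W" "v \<notin> W"
  shows "0 < infdist v W"
  using in_closed_iff_infdist_zero[of W v] assms subspace_0[of W] infdist_nonneg[of v W]
  by (metis empty_iff less_le)

lemma closed_span_insert:
  fixes W :: "'a::real_normed_vector set"
  assumes W: "closed W" "subspace W" "v \<notin> W"
  shows "closed (span (insert v W))"
proof -
  let ?d = "infdist v W"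
  have d: "0 < ?d" by (rule infdist_pos_closed[OF W])
  have span: "span (insert v W) = {x. \<exists>c. x - c *\<^sub>R v \<in> W}"
    by (simp add: span_insert span_eq_iff[THEN iffD2, OF W(2)])
  show ?thesis unfolding span closed_sequential_limits
  proof (intro allI impI, elim conjE)
    fix x and l :: 'a
    assume x: "\<forall>n. x n \<in> {x. \<exists>c. x - c *\<^sub>R v \<in> W}" and l: "x \<longlonglongrightarrow> l"
    from x obtain c where c: "\<And>n. x n - c n *\<^sub>R v \<in> W" by (simp, metis)
    have "Cauchy c"
    proof (rule CauchyI)
      fix e :: real assume "0 < e"
      then obtain M where M: "\<And>m n. m \<ge> M \<Longrightarrow> n \<ge> M \<Longrightarrow> norm (x m - x n) < e * ?d"
        using CauchyD[OF LIMSEQ_imp_Cauchy[OF l], of "e * ?d"] d by auto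
      have "norm (c m - c n) < e" if "m \<ge> M" "n \<ge> M" for m n
      proof -
        have "(x m - x n) - (c m - c n) *\<^sub>R v \<in> W"
          using subspace_diff[OF W(2) c[of m] c[of n]] by (simp add: algebra_simps)
        from coset_coordinate_bound[OF W(2) this] M[OF that]
        have "\<bar>c m - c n\<bar> * ?d < e * ?d" by linarith
        then show ?thesis using d by simp
      qed
      then show "\<exists>M. \<forall>m\<ge>M. \<forall>n\<ge>M. norm (c m - c n) < e" by blast
    qed
    then obtain b where "c \<longlonglongrightarrow> b" using real_Cauchy_convergent by (auto simp: convergent_def)
    then have "(\<lambda>n. x n - c n *\<^sub>R v) \<longlonglongrightarrow> l - b *\<^sub>R v" by (intro tendsto_intros l)
    then have "l - b *\<^sub>R v \<in> W" using closed_sequentially[OF W(1), of "\<lambda>n. x n - c n *\<^sub>R v"] c by blast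
    then show "l \<in> {x. \<exists>c. x - c *\<^sub>R v \<in> W}" by blast
  qed
qed

text \<open>The identity agrees modulo \<open>W\<close> with a bounded operator of finite rank, which is built one vector \<open>v\<close> at a time: the induction hypothesis
  for \<open>W + \<real> v\<close> moves every point into \<open>W + \<real> v\<close> by a bounded operator, on whose range the coordinate along \<open>v\<close>
  is bounded.\<close>

lemma finite_codim_projection:
  fixes W :: "'a::real_normed_vector set"
  assumes "finite F" "closed W" "subspace W" "span (W \<union> F) = UNIV"
  shows "\<exists>m (f :: nat \<Rightarrow> 'a \<Rightarrow>\<^sub>L real) v. \<forall>x. x - (\<Sum>j<m. blinfun_apply (f j) x *\<^sub>R v j) \<in> W"
  using assms
proof (induction F arbitrary: W rule: finite_induct)
  case empty
  then have "W = UNIV" by (simp add: span_eq_iff[THEN iffD2])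
  then show ?case by simp
next
  case (insert v F)
  show ?case
  proof (cases "v \<in> W")
    case True
    then have "W \<union> insert v F = W \<union> F" by blast
    then show ?thesis using insert by auto
  next
    case False
    let ?d = "infdist v W"
    have d: "0 < ?d" by (rule infdist_pos_closed[OF insert.prems(1,2) False])
    let ?V = "span (insert v W)"
    have V: "?V = {x. \<exists>c. x - c *\<^sub>R v \<in> W}"
      using insert.prems by (simp add: span_insert span_eq_iff[THEN iffD2])
    have "span (W \<union> insert v F) \<subseteq> span (?V \<union> F)"
      by (rule span_mono) (auto intro: span_base)
    then have "span (?V \<union> F) = UNIV" using insert.prems by auto
    moreover have "closed ?V" by (rule closed_span_insert[OF insert.prems(1,2) False])
    ultimately obtain m and f :: "nat \<Rightarrow> 'a \<Rightarrow>\<^sub>L real" and u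
      where P: "\<And>x. x - (\<Sum>j<m. blinfun_apply (f j) x *\<^sub>R u j) \<in> ?V"
      using insert.IH[OF _ subspace_span] by blast
    define P where "P x = x - (\<Sum>j<m. blinfun_apply (f j) x *\<^sub>R u j)" for x
    have blP: "bounded_linear P"
      unfolding P_def
      by (intro bounded_linear_sub bounded_linear_ident bounded_linear_sum
          bounded_linear_compose[OF bounded_linear_scaleR_left] blinfun.bounded_linear_right)
    interpret P: bounded_linear P by (rule blP)
    have "\<exists>c. P x - c *\<^sub>R v \<in> W" for x using P[of x] unfolding V P_def by simp
    then obtain c where c: "\<And>x. P x - c x *\<^sub>R v \<in> W" by metis
    have unique: "c x = b" if "P x - b *\<^sub>R v \<in> W" for x b
    proof -
      have "0 - (c x - b) *\<^sub>R v \<in> W"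
        using subspace_diff[OF insert.prems(2) c[of x] that] by (simp add: algebra_simps)
      from coset_coordinate_bound[OF insert.prems(2) this] d show ?thesis
        by (simp add: mult_le_0_iff)
    qed
    obtain K where K: "\<And>x. norm (P x) \<le> norm x * K" using P.bounded by blast
    have "bounded_linear c"
    proof (rule bounded_linear_intro)
      show "c (x + y) = c x + c y" for x y
        using subspace_add[OF insert.prems(2) c[of x] c[of y]]
        by (intro unique) (simp add: P.add algebra_simps)
      show "c (r *\<^sub>R x) = r *\<^sub>R c x" for r x
        using subspace_scale[OF insert.prems(2) c[of x], of r]
        by (intro unique) (simp add: P.scaleR algebra_simps)
      show "norm (c x) \<le> norm x * (K / ?d)" for x
        using order_trans[OF coset_coordinate_bound[OF insert.prems(2) c[of x]] K[of x]] d
        by (simp add: field_simps)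
    qed
    then have "x - (\<Sum>j<Suc m. blinfun_apply ((f(m := Blinfun c)) j) x *\<^sub>R (u(m := v)) j) \<in> W" for x
      using c[of x] by (simp add: bounded_linear_Blinfun_apply P_def algebra_simps)
    then show ?thesis by blast
  qed
qed

lemma cof_projection:
  fixes W :: "'a::real_normed_vector set"
  assumes "closed W" "finite_codim_subspace W"
  shows "\<exists>m (f :: nat \<Rightarrow> 'a \<Rightarrow>\<^sub>L real) v. \<forall>x. x - (\<Sum>j<m. blinfun_apply (f j) x *\<^sub>R v j) \<in> W"
proof -
  obtain F where F: "finite F" "subspace W" "span (W \<union> F) = UNIV"
    using assms(2) by (auto simp: finite_codim_subspace_def)
  show ?thesis by (rule finite_codim_projection[OF F(1) assms(1) F(2,3)])
qed

lemma infdist_cof_tendsto_0: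
  fixes W :: "'a::real_normed_vector set"
  assumes "W \<in> cof" "\<And>f :: 'a \<Rightarrow>\<^sub>L real. (\<lambda>n. blinfun_apply f (x n)) \<longlonglongrightarrow> 0"
  shows "(\<lambda>n. infdist (x n) W) \<longlonglongrightarrow> 0"
proof -
  have W: "closed W" "finite_codim_subspace W" using assms(1) by (auto simp: cof_def)
  obtain m and f :: "nat \<Rightarrow> 'a \<Rightarrow>\<^sub>L real" and v
    where "\<forall>x. x - (\<Sum>j<m. blinfun_apply (f j) x *\<^sub>R v j) \<in> W"
    using cof_projection[OF W] by (elim exE) (rule that)
  then have f: "x - (\<Sum>j<m. blinfun_apply (f j) x *\<^sub>R v j) \<in> W" for x by (rule spec)
  define h where "h n = norm (\<Sum>j<m. blinfun_apply (f j) (x n) *\<^sub>R v j)" for n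
  have "h \<longlonglongrightarrow> norm (\<Sum>j<m. 0 *\<^sub>R v j)" unfolding h_def
    by (rule tendsto_norm, rule tendsto_sum, rule tendsto_scaleR[OF assms(2) tendsto_const])
  then have null: "h \<longlonglongrightarrow> 0" by simp
  have le: "infdist (x n) W \<le> h n" for n
    using infdist_le[OF f[of "x n"], of "x n"] by (simp add: dist_norm h_def)
  show ?thesis by (rule Lim_null_comparison[OF _ null]) (simp add: infdist_nonneg le)
qed

lemma wstar_closed_sequentially:
  assumes G: "closedin strong_operator_topology (G :: ('a::real_normed_vector \<Rightarrow>\<^sub>L real) set)"
    and g: "\<And>n. g n \<in> G" "\<And>x. (\<lambda>n. blinfun_apply (g n) x) \<longlonglongrightarrow> blinfun_apply l x"
  shows "l \<in> G"
proof (rule ccontr)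
  assume l: "l \<notin> G"
  have "openin strong_operator_topology (- G)"
    using G by (simp add: closedin_def strong_operator_topology_topspace Compl_eq_Diff_UNIV)
  then obtain U where U: "open U" "- G = blinfun_apply -` U"
    unfolding strong_operator_topology_def openin_pullback_topology by auto
  have "((\<lambda>n. blinfun_apply (g n)) \<longlongrightarrow> blinfun_apply l) sequentially"
    using g(2) limitin_componentwise[of "\<lambda>_. euclidean" UNIV "\<lambda>n. blinfun_apply (g n)" "blinfun_apply l" sequentially]
    by (simp add: euclidean_product_topology)
  then have "\<forall>\<^sub>F n in sequentially. blinfun_apply (g n) \<in> U"
    by (rule topological_tendstoD[OF _ U(1)]) (use l U(2) in auto)
  then obtain n where "blinfun_apply (g n) \<in> U" by (auto simp: eventually_sequentially)
  then show False using g(1)[of n] U(2) by auto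
qed

lemma compact_bounded_combinations:
  fixes v :: "nat \<Rightarrow> 'a::real_normed_vector"
  shows "\<exists>K. compact K \<and> (\<forall>c. (\<forall>j<m. \<bar>c j\<bar> \<le> R) \<longrightarrow> (\<Sum>j<m. c j *\<^sub>R v j) \<in> K)"
proof (induction m)
  case 0
  show ?case by (rule exI[of _ "{0}"]) simp
next
  case (Suc m)
  then obtain K where K: "compact K" "\<And>c. \<forall>j<m. \<bar>c j\<bar> \<le> R \<Longrightarrow> (\<Sum>j<m. c j *\<^sub>R v j) \<in> K" by blast
  let ?I = "(\<lambda>r. r *\<^sub>R v m) ` {- R..R}"
  have "compact ?I" by (intro compact_continuous_image continuous_intros compact_Icc)
  then have "compact {x + y | x y. x \<in> K \<and> y \<in> ?I}" by (rule compact_sums[OF K(1)])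
  moreover have "(\<Sum>j<Suc m. c j *\<^sub>R v j) \<in> {x + y | x y. x \<in> K \<and> y \<in> ?I}" if "\<forall>j<Suc m. \<bar>c j\<bar> \<le> R" for c
  proof -
    have "(\<Sum>j<m. c j *\<^sub>R v j) \<in> K" using that K(2)[of c] by simp
    moreover have "c m \<in> {- R..R}" using that by (auto simp: abs_le_iff)
    then have "c m *\<^sub>R v m \<in> ?I" by (rule imageI)
    ultimately show ?thesis by auto
  qed
  ultimately show ?case by blast
qed

text \<open>The functionals that describe \<open>G\<close> live on the dual space and need not be evaluations, so pointwise
  convergence does not apply to them. Instead, the finite-rank parts \<open>q n\<close> of \<open>\<phi> n\<close> are bounded, hence
  converge in norm along a subsequence to some \<open>l\<close>. Along it \<open>\<phi> n - q n\<close> lies in \<open>G\<close> and tends to \<open>- l\<close>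
  pointwise, so \<open>- l\<close> lies in \<open>G\<close>, and then \<open>\<phi> n - q n + l\<close> is a point of \<open>G\<close> close to \<open>\<phi> n\<close>.\<close>

lemma infdist_cof_wstar_tendsto_0:
  fixes \<phi> :: "nat \<Rightarrow> 'a::real_normed_vector \<Rightarrow>\<^sub>L real"
  assumes G: "G \<in> cof_wstar" and bound: "\<And>n. norm (\<phi> n) \<le> B"
    and null: "\<And>x. (\<lambda>n. blinfun_apply (\<phi> n) x) \<longlonglongrightarrow> 0"
  shows "(\<lambda>n. infdist (\<phi> n) G) \<longlonglongrightarrow> 0"
proof (rule ccontr)
  assume "\<not> ?thesis"
  then have "\<not> (\<forall>e>0. \<exists>N. \<forall>n\<ge>N. norm (infdist (\<phi> n) G - 0) < e)"
    unfolding LIMSEQ_iff .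
  then obtain e where e: "0 < e" and "\<forall>N. \<exists>n\<ge>N. \<not> norm (infdist (\<phi> n) G - 0) < e" by blast
  then have "\<forall>N. \<exists>n\<ge>N. n \<in> {n. e \<le> infdist (\<phi> n) G}" by (simp add: infdist_nonneg not_less)
  then have "infinite {n. e \<le> infdist (\<phi> n) G}" unfolding infinite_nat_iff_unbounded_le .
  then obtain r :: "nat \<Rightarrow> nat" where "strict_mono r" "\<forall>n. r n \<in> {n. e \<le> infdist (\<phi> n) G}"
    using infinite_enumerate by blast
  then have r: "strict_mono r" "e \<le> infdist (\<phi> (r n)) G" for n by auto
  have wcl: "closedin strong_operator_topology G" and cod: "finite_codim_subspace G"
    using G by (auto simp: cof_wstar_def)
  have sub: "subspace G" using cod by (simp add: finite_codim_subspace_def)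
  have "closed G"
    unfolding closed_sequential_limits
  proof (intro allI impI, elim conjE)
    fix g l assume "\<forall>n. g n \<in> G" and g: "g \<longlonglongrightarrow> l"
    then have "g n \<in> G" for n by blast
    moreover have "(\<lambda>n. blinfun_apply (g n) x) \<longlonglongrightarrow> blinfun_apply l x" for x
      by (rule blinfun.tendsto[OF g tendsto_const])
    ultimately show "l \<in> G" by (rule wstar_closed_sequentially[OF wcl])
  qed
  then obtain m and f :: "nat \<Rightarrow> ('a \<Rightarrow>\<^sub>L real) \<Rightarrow>\<^sub>L real" and v
    where "\<forall>x. x - (\<Sum>j<m. blinfun_apply (f j) x *\<^sub>R v j) \<in> G"
    using cof_projection[OF \<open>closed G\<close> cod] by (elim exE) (rule that)
  then have f: "x - (\<Sum>j<m. blinfun_apply (f j) x *\<^sub>R v j) \<in> G" for x by (rule spec)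
  define q where "q n = (\<Sum>j<m. blinfun_apply (f j) (\<phi> (r n)) *\<^sub>R v j)" for n
  define R where "R = (\<Sum>j<m. norm (f j)) * B"
  have B: "0 \<le> B" using bound[of 0] norm_ge_zero order_trans by blast
  have "\<bar>blinfun_apply (f j) (\<phi> (r n))\<bar> \<le> R" if "j < m" for j n
  proof -
    have "norm (blinfun_apply (f j) (\<phi> (r n))) \<le> norm (f j) * norm (\<phi> (r n))" by (rule norm_blinfun)
    also have "\<dots> \<le> (\<Sum>j<m. norm (f j)) * B"
      by (intro mult_mono bound member_le_sum) (use that in \<open>auto intro: sum_nonneg\<close>)
    finally show ?thesis by (simp add: R_def)
  qed
  moreover obtain K where K: "compact K" "\<And>c. \<forall>j<m. \<bar>c j\<bar> \<le> R \<Longrightarrow> (\<Sum>j<m. c j *\<^sub>R v j) \<in> K"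
    using compact_bounded_combinations[of m R v] by blast
  ultimately have qK: "\<forall>n. q n \<in> K" unfolding q_def by simp
  have "seq_compact K" using K(1) by (simp only: compact_eq_seq_compact_metric)
  from seq_compactE[OF this qK] obtain l t where t: "strict_mono t" "(q \<circ> t) \<longlonglongrightarrow> l" by metis
  have "(\<lambda>n. blinfun_apply (\<phi> (r (t n))) x) \<longlonglongrightarrow> 0" for x
    using LIMSEQ_subseq_LIMSEQ[OF null strict_mono_o[OF r(1) t(1)], of x] by (simp add: comp_def)
  then have "(\<lambda>n. blinfun_apply (\<phi> (r (t n)) - q (t n)) x) \<longlonglongrightarrow> blinfun_apply (- l) x" for x
    using tendsto_diff[of "\<lambda>n. blinfun_apply (\<phi> (r (t n))) x" 0 sequentially "\<lambda>n. blinfun_apply (q (t n)) x" "blinfun_apply l x"]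
      blinfun.tendsto[OF t(2) tendsto_const, of x]
    by (simp add: blinfun.diff_left blinfun.minus_left comp_def)
  from wstar_closed_sequentially[OF wcl _ this] have "- l \<in> G" by (simp add: q_def f)
  have near: "e \<le> norm (q (t n) - l)" for n
  proof -
    have "(\<phi> (r (t n)) - q (t n)) - (- l) \<in> G"
      by (rule subspace_diff[OF sub _ \<open>- l \<in> G\<close>]) (simp add: q_def f)
    from infdist_le[OF this, of "\<phi> (r (t n))"] r(2)[of "t n"] show ?thesis
      by (simp add: dist_norm)
  qed
  obtain n where "norm (q (t n) - l) < e" using LIMSEQ_D[OF t(2) e] by auto
  then show False using near[of n] by simp
qed

section \<open>Vectors and functionals of high level\<close>

lemma haar_dense_le:
  fixes g h :: "dyadic_H1 \<Rightarrow> real"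
  assumes "continuous_on UNIV g" "continuous_on UNIV h"
    and le: "\<And>F a. finite F \<Longrightarrow> g (\<Sum>i\<in>F. a i *\<^sub>R haar_basis i) \<le> h (\<Sum>i\<in>F. a i *\<^sub>R haar_basis i)"
  shows "g x \<le> h x"
proof -
  have "closed {x. g x \<le> h x}" by (rule closed_Collect_le[OF assms(1,2)])
  moreover have "x \<in> closure {x. g x \<le> h x}"
    unfolding closure_approachable
  proof (intro allI impI)
    fix e :: real assume "0 < e"
    then obtain F a where "finite F" "norm (x - (\<Sum>i\<in>F. a i *\<^sub>R haar_basis i)) < e"
      using haar_basis_dense by blast
    then show "\<exists>y\<in>{x. g x \<le> h x}. dist y x < e"
      using le[of F a] by (intro bexI[of _ "\<Sum>i\<in>F. a i *\<^sub>R haar_basis i"]) (auto simp: dist_norm norm_minus_commute)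
  qed
  ultimately show ?thesis by (simp add: closure_closed)
qed

lemma norm_blinfun_haar_le:
  fixes \<psi> :: "dyadic_H1 \<Rightarrow>\<^sub>L real"
  assumes "0 \<le> B" "\<And>F a. finite F \<Longrightarrow>
    \<bar>blinfun_apply \<psi> (\<Sum>i\<in>F. a i *\<^sub>R haar_basis i)\<bar> \<le> B * norm (\<Sum>i\<in>F. a i *\<^sub>R haar_basis i)"
  shows "norm \<psi> \<le> B"
proof (rule norm_blinfun_bound[OF assms(1)])
  show "norm (blinfun_apply \<psi> x) \<le> B * norm x" for x
    unfolding real_norm_def by (rule haar_dense_le) (intro continuous_intros, intro continuous_intros, rule assms(2))
qed

lemma norm_haar_restrict:
  "finite F \<Longrightarrow> A \<subseteq> F \<Longrightarrow> norm (\<Sum>i\<in>A. a i *\<^sub>R haar_basis i) \<le> norm (\<Sum>i\<in>F. a i *\<^sub>R haar_basis i)"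
  by (rule one_unc_restrict[OF haar_basis_one_unconditional haar_basis_nonzero haar_basis_dense])

lemma sum_indicator_level: "(\<Sum>i | dyadic_level i = n. indicator (nth_dyadic i) x) = (indicator {0..<1} x :: real)"
proof -
  \<comment> \<open>A full level covers the root cell of a tree whose root has level \<open>n\<close>.\<close>
  have "strict_mono (\<lambda>k. n + k)" by (simp add: strict_mono_def)
  moreover have "node_cover (\<lambda>k. n + k) 0 = {i. dyadic_level i = n}"
    using nth_dyadic_subset_unit by (auto simp: node_cover_def)
  ultimately show ?thesis
    using sum_indicator_node_cover[where n = "\<lambda>k. n + k" and k = 0 and x = x, OF strict_mono_ancestor_mono]
    by simp
qed

lemma norm_level_sum:
  assumes E: "E \<subseteq> {i. dyadic_level i = n}"
  shows "norm (\<Sum>i\<in>E. a i *\<^sub>R haar_basis i) = (\<Sum>i\<in>E. \<bar>a i\<bar>)"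
proof -
  have fin: "finite E" by (rule finite_subset[OF E finite_dyadic_level])
  \<comment> \<open>A single block, padded with empty blocks of the levels above \<open>n\<close>.\<close>
  let ?E = "\<lambda>k::nat. if k = 0 then E else {}"
  have "norm (\<Sum>k<Suc 0. \<Sum>i\<in>?E k. a i *\<^sub>R haar_basis i)
    = (LINT x|lborel. L2_set (\<lambda>k. 2 ^ (n + k) * (\<Sum>i\<in>?E k. \<bar>a i\<bar> * indicator (nth_dyadic i) x)) {..<Suc 0})"
    by (rule norm_block_sum) (use E in \<open>auto simp: inj_def\<close>)
  also have "\<dots> = (LINT x|lborel. (\<Sum>i\<in>E. 2 ^ n * \<bar>a i\<bar> * indicator (nth_dyadic i) x))"
    by (intro Bochner_Integration.integral_cong refl)
      (simp add: lessThan_Suc sum_nonneg sum_distrib_left mult.assoc)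
  also have "\<dots> = (\<Sum>i\<in>E. (LINT x|lborel. 2 ^ n * \<bar>a i\<bar> * indicator (nth_dyadic i) x))"
    by (intro Bochner_Integration.integral_sum integrable_mult_right) simp
  also have "\<dots> = (\<Sum>i\<in>E. \<bar>a i\<bar>)"
    by (rule sum.cong) (use E in \<open>auto simp: measure_nth_dyadic\<close>)
  finally show ?thesis by (simp add: lessThan_Suc)
qed

text \<open>Combinations of full levels with coefficients of size at most \<open>L / 2 ^ n\<close> behave like Rademacher
  functions: their square function is bounded pointwise by \<open>L\<close> times the Euclidean norm of \<open>\<beta>\<close>. The
  coefficients \<open>c\<close> include the value \<open>0\<close>, which selects an arbitrary subset of the level.\<close>

lemma norm_rademacher_sum_le:
  assumes c: "\<And>n i. \<bar>c n i\<bar> \<le> 1" and L: "0 \<le> L"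
  shows "norm (\<Sum>n<M. \<beta> n *\<^sub>R (\<Sum>i | dyadic_level i = n. (c n i * (L / 2 ^ n)) *\<^sub>R haar_basis i))
    \<le> L * L2_set \<beta> {..<M}"
proof -
  let ?b = "\<lambda>n i. \<beta> n * (c n i * (L / 2 ^ n))"
  let ?g = "\<lambda>n x. 2 ^ n * (\<Sum>i | dyadic_level i = n. \<bar>?b n i\<bar> * indicator (nth_dyadic i) x)"
  have g: "\<bar>?g n x\<bar> \<le> \<bar>L * \<beta> n\<bar> * indicator {0..<1} x" for n x
  proof -
    have "?g n x \<le> 2 ^ n * (\<Sum>i | dyadic_level i = n. \<bar>L * \<beta> n\<bar> / 2 ^ n * indicator (nth_dyadic i) x)"
    proof (intro mult_left_mono sum_mono mult_right_mono)
      fix i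
      have "\<bar>\<beta> n\<bar> * L / 2 ^ n * \<bar>c n i\<bar> \<le> \<bar>\<beta> n\<bar> * L / 2 ^ n * 1"
        by (intro mult_left_mono c) (use L in simp)
      then show "\<bar>?b n i\<bar> \<le> \<bar>L * \<beta> n\<bar> / 2 ^ n" using L by (simp add: abs_mult mult_ac)
    qed auto
    also have "\<dots> = \<bar>L * \<beta> n\<bar> * indicator {0..<1} x"
      unfolding sum_distrib_left[symmetric] sum_indicator_level by simp
    finally show ?thesis by (simp add: sum_nonneg)
  qed
  have "norm (\<Sum>n<M. \<beta> n *\<^sub>R (\<Sum>i | dyadic_level i = n. (c n i * (L / 2 ^ n)) *\<^sub>R haar_basis i))
    = (LINT x|lborel. L2_set (\<lambda>n. ?g n x) {..<M})"
    unfolding scaleR_sum_right scaleR_scaleR by (rule norm_block_sum) auto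
  also have "\<dots> \<le> (LINT x::real|lborel. L * L2_set \<beta> {..<M} * indicator {0..<1} x)"
  proof (rule integral_mono)
    show "integrable lborel (\<lambda>x. L2_set (\<lambda>n. ?g n x) {..<M})"
      by (intro integrable_L2_set integrable_mult_right Bochner_Integration.integrable_sum) simp
    show "integrable lborel (\<lambda>x::real. L * L2_set \<beta> {..<M} * indicator {0..<1} x)"
      by (intro integrable_mult_right integrable_indicator_level_set[OF level_set_unit])
    fix x :: real
    have "L2_set (\<lambda>n. ?g n x) {..<M} = L2_set (\<lambda>n. \<bar>?g n x\<bar>) {..<M}" by (simp add: L2_set_def)
    also have "\<dots> \<le> L2_set (\<lambda>n. \<bar>L * \<beta> n\<bar> * indicator {0..<1} x) {..<M}"
      by (intro L2_set_mono g) simp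
    also have "\<dots> = L2_set (\<lambda>n. \<bar>L * \<beta> n\<bar>) {..<M} * indicator {0..<1} x"
      by (rule L2_set_left_distrib[symmetric]) simp
    also have "L2_set (\<lambda>n. \<bar>L * \<beta> n\<bar>) {..<M} = L2_set (\<lambda>n. L * \<beta> n) {..<M}" by (simp add: L2_set_def)
    also have "\<dots> = L * L2_set \<beta> {..<M}" by (rule L2_set_right_distrib[OF L, symmetric])
    finally show "L2_set (\<lambda>n. ?g n x) {..<M} \<le> L * L2_set \<beta> {..<M} * indicator {0..<1} x" .
  qed
  also have "\<dots> = L * L2_set \<beta> {..<M}" by simp
  finally show ?thesis .
qed

text \<open>The values of a functional on a sequence with an upper \<open>2\<close>-estimate are square summable: test the
  functional on the combination whose coefficients are these values.\<close>

lemma rademacher_weakly_null: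
  fixes f :: "dyadic_H1 \<Rightarrow>\<^sub>L real"
  assumes c: "\<And>n i. \<bar>c n i\<bar> \<le> 1" and L: "0 \<le> L"
  shows "(\<lambda>n. blinfun_apply f (\<Sum>i | dyadic_level i = n. (c n i * (L / 2 ^ n)) *\<^sub>R haar_basis i)) \<longlonglongrightarrow> 0"
proof -
  define y where "y n = (\<Sum>i | dyadic_level i = n. (c n i * (L / 2 ^ n)) *\<^sub>R haar_basis i)" for n
  define \<beta> where "\<beta> n = blinfun_apply f (y n)" for n
  have bound: "(\<Sum>n<M. (\<beta> n)\<^sup>2) \<le> (norm f * L)\<^sup>2" for M
  proof -
    let ?S = "L2_set \<beta> {..<M}"
    have "?S * ?S = (\<Sum>n<M. (\<beta> n)\<^sup>2)" by (simp add: L2_set_def sum_nonneg)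
    also have "\<dots> = blinfun_apply f (\<Sum>n<M. \<beta> n *\<^sub>R y n)"
      by (simp add: blinfun.sum_right blinfun.scaleR_right power2_eq_square flip: \<beta>_def)
    also have "\<dots> \<le> norm f * norm (\<Sum>n<M. \<beta> n *\<^sub>R y n)"
      using norm_blinfun[of f "\<Sum>n<M. \<beta> n *\<^sub>R y n"] by simp
    also have "\<dots> \<le> norm f * (L * ?S)"
      unfolding y_def by (intro mult_left_mono norm_rademacher_sum_le c L norm_ge_zero)
    finally have "?S * ?S \<le> (norm f * L) * ?S" by simp
    moreover have "0 \<le> ?S" "0 \<le> norm f * L" using L by (simp_all add: L2_set_nonneg)
    ultimately have "?S \<le> norm f * L" by (cases "?S = 0") (auto simp: mult_le_cancel_right)
    then have "?S\<^sup>2 \<le> (norm f * L)\<^sup>2" by (simp add: power_mono L2_set_nonneg)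
    then show ?thesis by (simp add: L2_set_def sum_nonneg)
  qed
  have "summable (\<lambda>n. (\<beta> n)\<^sup>2)"
    by (rule summableI_nonneg_bounded[OF _ bound]) simp
  then have "(\<lambda>n. (\<beta> n)\<^sup>2) \<longlonglongrightarrow> 0" by (rule summable_LIMSEQ_zero)
  then have "\<beta> \<longlonglongrightarrow> 0" by (simp add: tendsto_null_power)
  then show ?thesis unfolding \<beta>_def[abs_def] y_def .
qed

lemma level_functional_apply:
  assumes "finite F"
  shows "blinfun_apply (\<Sum>i | dyadic_level i = n. c i *\<^sub>R biorthogonal haar_basis i) (\<Sum>j\<in>F. a j *\<^sub>R haar_basis j)
    = (\<Sum>j\<in>F \<inter> {i. dyadic_level i = n}. c j * a j)"
proof -
  have "blinfun_apply (\<Sum>i | dyadic_level i = n. c i *\<^sub>R biorthogonal haar_basis i) (haar_basis j)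
      = (if dyadic_level j = n then c j else 0)" for j
    by (simp add: blinfun.sum_left blinfun.scaleR_left biorthogonal_haar finite_dyadic_level if_distrib cong: if_cong)
  then have "blinfun_apply (\<Sum>i | dyadic_level i = n. c i *\<^sub>R biorthogonal haar_basis i) (\<Sum>j\<in>F. a j *\<^sub>R haar_basis j)
      = (\<Sum>j\<in>F. a j *\<^sub>R (if dyadic_level j = n then c j else 0))"
    by (simp only: blinfun.sum_right blinfun.scaleR_right)
  also have "\<dots> = (\<Sum>j\<in>F. if j \<in> {i. dyadic_level i = n} then c j * a j else 0)"
    by (rule sum.cong) simp_all
  finally show ?thesis by (simp only: sum.inter_restrict[OF assms])
qed

text \<open>Within a level the basis is isometrically that of \<open>l\<^sup>1\<close>, so signed sums of its biorthogonal
  functionals have norm at most \<open>1\<close>.\<close>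

lemma norm_level_functional_le:
  assumes c: "\<And>i. \<bar>c i\<bar> \<le> 1"
  shows "norm (\<Sum>i | dyadic_level i = n. c i *\<^sub>R biorthogonal haar_basis i) \<le> 1"
proof (rule norm_blinfun_haar_le)
  fix F :: "nat set" and a :: "nat \<Rightarrow> real" assume F: "finite F"
  let ?A = "F \<inter> {i. dyadic_level i = n}"
  have "\<bar>\<Sum>j\<in>?A. c j * a j\<bar> \<le> (\<Sum>j\<in>?A. \<bar>c j * a j\<bar>)" by (rule sum_abs)
  also have "\<dots> \<le> (\<Sum>j\<in>?A. \<bar>a j\<bar>)"
    by (intro sum_mono) (simp add: abs_mult mult_left_le_one_le c)
  also have "\<dots> = norm (\<Sum>j\<in>?A. a j *\<^sub>R haar_basis j)" by (rule norm_level_sum[where n = n, symmetric]) simp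
  also have "\<dots> \<le> norm (\<Sum>j\<in>F. a j *\<^sub>R haar_basis j)" by (rule norm_haar_restrict[OF F]) simp
  finally show "\<bar>blinfun_apply (\<Sum>i | dyadic_level i = n. c i *\<^sub>R biorthogonal haar_basis i) (\<Sum>i\<in>F. a i *\<^sub>R haar_basis i)\<bar>
      \<le> 1 * norm (\<Sum>i\<in>F. a i *\<^sub>R haar_basis i)"
    by (simp add: level_functional_apply[OF F])
qed simp

lemma level_functionals_pointwise_null:
  assumes c: "\<And>n i. \<bar>c n i\<bar> \<le> 1"
  shows "(\<lambda>n. blinfun_apply (\<Sum>i | dyadic_level i = n. c n i *\<^sub>R biorthogonal haar_basis i) x) \<longlonglongrightarrow> 0"
proof (rule LIMSEQ_I)
  fix e :: real assume "0 < e"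
  then obtain F a where F: "finite F" and near: "norm (x - (\<Sum>i\<in>F. a i *\<^sub>R haar_basis i)) < e"
    using haar_basis_dense by blast
  obtain N where N: "\<And>i. i \<in> F \<Longrightarrow> dyadic_level i < N"
    using finite_nat_set_iff_bounded[of "dyadic_level ` F"] F by auto
  have "norm (blinfun_apply (\<Sum>i | dyadic_level i = n. c n i *\<^sub>R biorthogonal haar_basis i) x - 0) < e" if "N \<le> n" for n
  proof -
    let ?\<psi> = "\<Sum>i | dyadic_level i = n. c n i *\<^sub>R biorthogonal haar_basis i"
    let ?y = "\<Sum>i\<in>F. a i *\<^sub>R haar_basis i"
    have "F \<inter> {i. dyadic_level i = n} = {}" using N that by fastforce
    then have "blinfun_apply ?\<psi> ?y = 0" by (simp add: level_functional_apply[OF F])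
    then have "blinfun_apply ?\<psi> x = blinfun_apply ?\<psi> (x - ?y)" by (simp add: blinfun.diff_right)
    also have "norm \<dots> \<le> norm ?\<psi> * norm (x - ?y)" by (rule norm_blinfun)
    also have "\<dots> \<le> 1 * norm (x - ?y)" by (intro mult_right_mono norm_level_functional_le c) simp
    finally show ?thesis using near by simp
  qed
  then show "\<exists>N. \<forall>n\<ge>N. norm (blinfun_apply (\<Sum>i | dyadic_level i = n. c n i *\<^sub>R biorthogonal haar_basis i) x - 0) < e" by blast
qed

text \<open>Convergence along every choice of parameters is uniform in the parameter, since a
  violation at infinitely many indices could be collected into one bad choice. This turns limits
  for fixed signs into estimates that hold before the opponent chooses the signs.\<close>

lemma eventually_uniform:
  fixes D :: "nat \<Rightarrow> 'c \<Rightarrow> real"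
  assumes "\<And>c. (\<And>n. Q (c n)) \<Longrightarrow> (\<lambda>n. D n (c n)) \<longlonglongrightarrow> 0" "Q z" "0 < \<eta>"
  shows "\<exists>N. \<forall>n\<ge>N. \<forall>c. Q c \<longrightarrow> D n c < \<eta>"
proof -
  define c where "c n = (if \<exists>b. Q b \<and> \<eta> \<le> D n b then SOME b. Q b \<and> \<eta> \<le> D n b else z)" for n
  have c: "Q (c n)" "Q b \<Longrightarrow> \<eta> \<le> D n b \<Longrightarrow> \<eta> \<le> D n (c n)" for n b
    using someI_ex[of "\<lambda>b. Q b \<and> \<eta> \<le> D n b"] assms(2) unfolding c_def by auto
  have "(\<lambda>n. D n (c n)) \<longlonglongrightarrow> 0" by (rule assms(1)) (rule c(1))
  from LIMSEQ_D[OF this assms(3)] obtain N where "\<And>n. N \<le> n \<Longrightarrow> norm (D n (c n) - 0) < \<eta>"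
    by blast
  then have "D n (c n) < \<eta>" if "N \<le> n" for n using that by fastforce
  then have "\<forall>n\<ge>N. \<forall>b. Q b \<longrightarrow> D n b < \<eta>" using c(2) by (meson leD leI)
  then show ?thesis by blast
qed

lemma level_vectors_close:
  assumes "legal_subspace_move (\<eta>, W, G)" "0 \<le> L"
  shows "\<exists>N. \<forall>n\<ge>N. \<forall>c. (\<forall>i. \<bar>c i\<bar> \<le> 1) \<longrightarrow>
    infdist (\<Sum>i | dyadic_level i = n. (c i * (L / 2 ^ n)) *\<^sub>R haar_basis i) W < \<eta> \<and>
    infdist (\<Sum>i | dyadic_level i = n. c i *\<^sub>R biorthogonal haar_basis i) G < \<eta>"
proof -
  let ?Q = "\<lambda>c :: nat \<Rightarrow> real. \<forall>i. \<bar>c i\<bar> \<le> 1"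
  have WG: "0 < \<eta>" "W \<in> cof" "G \<in> cof_wstar" using assms(1) by auto
  have "\<exists>N. \<forall>n\<ge>N. \<forall>c. ?Q c \<longrightarrow>
      infdist (\<Sum>i | dyadic_level i = n. (c i * (L / 2 ^ n)) *\<^sub>R haar_basis i) W < \<eta>"
  proof (rule eventually_uniform[where z = "\<lambda>_. 0"])
    fix c :: "nat \<Rightarrow> nat \<Rightarrow> real" assume "\<And>n. ?Q (c n)"
    then show "(\<lambda>n. infdist (\<Sum>i | dyadic_level i = n. (c n i * (L / 2 ^ n)) *\<^sub>R haar_basis i) W) \<longlonglongrightarrow> 0"
      by (intro infdist_cof_tendsto_0[OF WG(2)] rademacher_weakly_null assms(2)) blast
  qed (use WG in auto)
  then obtain N1 where N1: "\<And>n c. N1 \<le> n \<Longrightarrow> ?Q c \<Longrightarrow>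
      infdist (\<Sum>i | dyadic_level i = n. (c i * (L / 2 ^ n)) *\<^sub>R haar_basis i) W < \<eta>" by blast
  have "\<exists>N. \<forall>n\<ge>N. \<forall>c. ?Q c \<longrightarrow>
      infdist (\<Sum>i | dyadic_level i = n. c i *\<^sub>R biorthogonal haar_basis i) G < \<eta>"
  proof (rule eventually_uniform[where z = "\<lambda>_. 0"])
    fix c :: "nat \<Rightarrow> nat \<Rightarrow> real" assume c: "\<And>n. ?Q (c n)"
    show "(\<lambda>n. infdist (\<Sum>i | dyadic_level i = n. c n i *\<^sub>R biorthogonal haar_basis i) G) \<longlonglongrightarrow> 0"
    proof (rule infdist_cof_wstar_tendsto_0[OF WG(3)])
      show "norm (\<Sum>i | dyadic_level i = n. c n i *\<^sub>R biorthogonal haar_basis i) \<le> 1" for n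
        by (rule norm_level_functional_le) (use c in blast)
      show "(\<lambda>n. blinfun_apply (\<Sum>i | dyadic_level i = n. c n i *\<^sub>R biorthogonal haar_basis i) x) \<longlonglongrightarrow> 0" for x
        by (rule level_functionals_pointwise_null) (use c in blast)
    qed
  qed (use WG in auto)
  then obtain N2 where N2: "\<And>n c. N2 \<le> n \<Longrightarrow> ?Q c \<Longrightarrow>
      infdist (\<Sum>i | dyadic_level i = n. c i *\<^sub>R biorthogonal haar_basis i) G < \<eta>" by blast
  show ?thesis by (rule exI[of _ "max N1 N2"]) (use N1 N2 in auto)
qed

section \<open>The strategy\<close>

lemma impartially_equivalent_isometric:
  fixes x :: "nat \<Rightarrow> 'a::real_normed_vector" and y :: "nat \<Rightarrow> 'b::real_normed_vector"
  assumes "\<And>N a. norm (\<Sum>k<N. a k *\<^sub>R x k) = norm (\<Sum>k<N. a k *\<^sub>R y k)" "1 \<le> C"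
  shows "impartially_equivalent C x y"
  unfolding impartially_equivalent_def
proof (intro allI impI)
  fix a :: "nat \<Rightarrow> real" assume "finite {i. a i \<noteq> 0}"
  then obtain N where N: "{i. a i \<noteq> 0} \<subseteq> {..<N}" using finite_nat_iff_bounded by blast
  have "(\<Sum>i | a i \<noteq> 0. a i *\<^sub>R x i) = (\<Sum>i<N. a i *\<^sub>R x i)" "(\<Sum>i | a i \<noteq> 0. a i *\<^sub>R y i) = (\<Sum>i<N. a i *\<^sub>R y i)"
    by (rule sum.mono_neutral_left; use N in auto)+
  then have eq: "norm (\<Sum>i | a i \<noteq> 0. a i *\<^sub>R x i) = norm (\<Sum>i | a i \<noteq> 0. a i *\<^sub>R y i)"
    using assms(1) by simp
  have "1 \<le> sqrt C" using assms(2) by simp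
  then have "1 / sqrt C * r \<le> r" "r \<le> sqrt C * r" if "0 \<le> r" for r
    using that by (simp_all add: divide_le_eq mult_le_cancel_left1 mult_le_cancel_right1)
  then show "1 / sqrt C * norm (\<Sum>i | a i \<noteq> 0. a i *\<^sub>R y i) \<le> norm (\<Sum>i | a i \<noteq> 0. a i *\<^sub>R x i) \<and>
      norm (\<Sum>i | a i \<noteq> 0. a i *\<^sub>R x i) \<le> sqrt C * norm (\<Sum>i | a i \<noteq> 0. a i *\<^sub>R y i)"
    unfolding eq using norm_ge_zero by blast
qed

lemma biorthogonal_haar_sum:
  "finite F \<Longrightarrow> blinfun_apply (biorthogonal haar_basis k) (\<Sum>i\<in>F. a i *\<^sub>R haar_basis i) = (if k \<in> F then a k else 0)"
  by (simp add: blinfun.sum_right blinfun.scaleR_right biorthogonal_haar if_distrib cong: if_cong)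

lemma norm_haar_partial_sum_le:
  "norm (\<Sum>k<N. blinfun_apply (biorthogonal haar_basis k) f *\<^sub>R haar_basis k) \<le> norm f"
proof (rule haar_dense_le[where x = f])
  fix F :: "nat set" and a :: "nat \<Rightarrow> real" assume F: "finite F"
  have "(\<Sum>k<N. blinfun_apply (biorthogonal haar_basis k) (\<Sum>i\<in>F. a i *\<^sub>R haar_basis i) *\<^sub>R haar_basis k)
      = (\<Sum>k\<in>F \<inter> {..<N}. a k *\<^sub>R haar_basis k)"
    by (rule sum.mono_neutral_cong_right) (auto simp: biorthogonal_haar_sum[OF F])
  also have "norm \<dots> \<le> norm (\<Sum>i\<in>F. a i *\<^sub>R haar_basis i)" by (rule norm_haar_restrict[OF F]) simp
  finally show "norm (\<Sum>k<N. blinfun_apply (biorthogonal haar_basis k) (\<Sum>i\<in>F. a i *\<^sub>R haar_basis i) *\<^sub>R haar_basis k)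
      \<le> norm (\<Sum>i\<in>F. a i *\<^sub>R haar_basis i)" .
qed (intro continuous_intros)+

text \<open>Write \<open>T\<close> for the map that sends the basis to \<open>x\<close> and \<open>P\<close> for the map with the coordinates \<open>x'\<close>. The
  hypotheses say that \<open>T\<close> and \<open>P\<close> are contractions with \<open>P T = id\<close>. A functional on the basis
  composed with \<open>P\<close> gives the same combination of \<open>x'\<close>, and composing with \<open>T\<close> goes back.\<close>

lemma dual_norm_isometric:
  fixes x :: "nat \<Rightarrow> dyadic_H1" and x' :: "nat \<Rightarrow> dyadic_H1 \<Rightarrow>\<^sub>L real"
  assumes biorth: "\<And>j k. blinfun_apply (x' j) (x k) = (if j = k then 1 else 0)"
    and embed: "\<And>c. norm (\<Sum>k<N. c k *\<^sub>R x k) \<le> norm (\<Sum>k<N. c k *\<^sub>R haar_basis k)"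
    and project: "\<And>f. norm (\<Sum>k<N. blinfun_apply (x' k) f *\<^sub>R haar_basis k) \<le> norm f"
  shows "norm (\<Sum>k<N. a k *\<^sub>R x' k) = norm (\<Sum>k<N. a k *\<^sub>R biorthogonal haar_basis k)"
proof (rule antisym)
  let ?\<psi> = "\<Sum>k<N. a k *\<^sub>R x' k" and ?\<phi> = "\<Sum>k<N. a k *\<^sub>R biorthogonal haar_basis k"
  show "norm ?\<psi> \<le> norm ?\<phi>"
  proof (rule norm_blinfun_bound[OF norm_ge_zero])
    fix f
    let ?y = "\<Sum>k<N. blinfun_apply (x' k) f *\<^sub>R haar_basis k"
    have "blinfun_apply ?\<psi> f = blinfun_apply ?\<phi> ?y"
      by (simp add: blinfun.sum_left blinfun.scaleR_left biorthogonal_haar_sum)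
    also have "norm \<dots> \<le> norm ?\<phi> * norm ?y" by (rule norm_blinfun)
    also have "\<dots> \<le> norm ?\<phi> * norm f" by (intro mult_left_mono project norm_ge_zero)
    finally show "norm (blinfun_apply ?\<psi> f) \<le> norm ?\<phi> * norm f" .
  qed
  show "norm ?\<phi> \<le> norm ?\<psi>"
  proof (rule norm_blinfun_bound[OF norm_ge_zero])
    fix f
    let ?c = "\<lambda>k. blinfun_apply (biorthogonal haar_basis k) f"
    let ?y = "\<Sum>k<N. ?c k *\<^sub>R x k"
    have "blinfun_apply (x' j) ?y = ?c j" if "j < N" for j
      using that by (simp add: blinfun.sum_right blinfun.scaleR_right biorth if_distrib cong: if_cong)
    then have "blinfun_apply ?\<phi> f = blinfun_apply ?\<psi> ?y"
      by (simp add: blinfun.sum_left blinfun.scaleR_left)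
    also have "norm \<dots> \<le> norm ?\<psi> * norm ?y" by (rule norm_blinfun)
    also have "\<dots> \<le> norm ?\<psi> * norm f"
      by (intro mult_left_mono order_trans[OF embed norm_haar_partial_sum_le] norm_ge_zero)
    finally show "norm (blinfun_apply ?\<phi> f) \<le> norm ?\<psi> * norm f" .
  qed
qed

definition node_vector :: "(nat \<Rightarrow> nat) \<Rightarrow> (nat \<Rightarrow> real) \<Rightarrow> nat \<Rightarrow> dyadic_H1" where
  "node_vector n s k = (\<Sum>i\<in>node_cover n k. (s i * (2 ^ dyadic_level k / 2 ^ n k)) *\<^sub>R haar_basis i)"

definition node_functional :: "(nat \<Rightarrow> nat) \<Rightarrow> (nat \<Rightarrow> real) \<Rightarrow> nat \<Rightarrow> dyadic_H1 \<Rightarrow>\<^sub>L real" where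
  "node_functional n s k = (\<Sum>i\<in>node_cover n k. s i *\<^sub>R biorthogonal haar_basis i)"

lemma node_functional_apply:
  assumes "finite F"
  shows "blinfun_apply (node_functional n s k) (\<Sum>i\<in>F. a i *\<^sub>R haar_basis i)
    = (\<Sum>i\<in>node_cover n k. s i * (if i \<in> F then a i else 0))"
  by (simp add: node_functional_def blinfun.sum_left blinfun.scaleR_left biorthogonal_haar_sum[OF assms])

lemma node_cover_disjoint: "strict_mono n \<Longrightarrow> i \<in> node_cover n j \<Longrightarrow> i \<in> node_cover n k \<Longrightarrow> j = k"
  by (auto simp: node_cover_def strict_mono_eq)

lemma node_functional_vector:
  assumes n: "strict_mono n" and s: "\<And>k i. i \<in> node_cover n k \<Longrightarrow> \<bar>s k i\<bar> = 1"
  shows "blinfun_apply (node_functional n (s j) j) (node_vector n (s k) k) = (if j = k then 1 else 0)"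
proof -
  have "blinfun_apply (node_functional n (s j) j) (node_vector n (s k) k)
      = (\<Sum>i\<in>node_cover n j. s j i * (if i \<in> node_cover n k then s k i * (2 ^ dyadic_level k / 2 ^ n k) else 0))"
    unfolding node_vector_def by (rule node_functional_apply[OF finite_node_cover])
  also have "\<dots> = (\<Sum>i\<in>node_cover n j. if j = k then 2 ^ dyadic_level k / 2 ^ n k else 0)"
  proof (rule sum.cong[OF refl])
    fix i assume i: "i \<in> node_cover n j"
    have "s j i * s j i = 1" using s[OF i] by (metis abs_mult_self_eq mult_1)
    then show "s j i * (if i \<in> node_cover n k then s k i * (2 ^ dyadic_level k / 2 ^ n k) else 0)
        = (if j = k then 2 ^ dyadic_level k / 2 ^ n k else 0)"
      using i node_cover_disjoint[OF n i, of k] by (cases "j = k") auto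
  qed
  also have "\<dots> = (if j = k then 1 else 0)"
    using card_node_cover[OF strict_mono_ancestor_mono[OF n], of k] by simp
  finally show ?thesis .
qed

lemma norm_node_projection_le:
  assumes n: "strict_mono n" and s: "\<And>k i. i \<in> node_cover n k \<Longrightarrow> \<bar>s k i\<bar> = 1"
  shows "norm (\<Sum>k<N. blinfun_apply (node_functional n (s k) k) f *\<^sub>R haar_basis k) \<le> norm f"
proof (rule haar_dense_le[where x = f])
  fix F :: "nat set" and a :: "nat \<Rightarrow> real" assume F: "finite F"
  define b where "b i = (if i \<in> F then a i else 0)" for i
  let ?U = "\<Union>k<N. node_cover n k"
  have "norm (\<Sum>k<N. blinfun_apply (node_functional n (s k) k) (\<Sum>i\<in>F. a i *\<^sub>R haar_basis i) *\<^sub>R haar_basis k)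
      = norm (\<Sum>k<N. (\<Sum>i\<in>node_cover n k. s k i * b i) *\<^sub>R haar_basis k)"
    by (simp only: node_functional_apply[OF F] b_def)
  also have "\<dots> \<le> norm (\<Sum>k<N. \<Sum>i\<in>node_cover n k. b i *\<^sub>R haar_basis i)"
    by (rule norm_node_averages_le[OF n s])
  also have "(\<Sum>k<N. \<Sum>i\<in>node_cover n k. b i *\<^sub>R haar_basis i) = (\<Sum>i\<in>?U. b i *\<^sub>R haar_basis i)"
    by (rule sum.UNION_disjoint[symmetric]) (use finite_node_cover node_cover_disjoint[OF n] in blast)+
  also have "norm \<dots> \<le> norm (\<Sum>i\<in>F \<union> ?U. b i *\<^sub>R haar_basis i)"
    by (rule norm_haar_restrict) (use F finite_node_cover in auto)
  also have "(\<Sum>i\<in>F \<union> ?U. b i *\<^sub>R haar_basis i) = (\<Sum>i\<in>F. a i *\<^sub>R haar_basis i)"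
    by (rule sum.mono_neutral_cong_right) (use F finite_node_cover in \<open>auto simp: b_def\<close>)
  finally show "norm (\<Sum>k<N. blinfun_apply (node_functional n (s k) k) (\<Sum>i\<in>F. a i *\<^sub>R haar_basis i) *\<^sub>R haar_basis k)
      \<le> norm (\<Sum>i\<in>F. a i *\<^sub>R haar_basis i)" .
qed (intro continuous_intros)+

lemma node_systems_equivalent:
  assumes n: "strict_mono n" and s: "\<And>k i. i \<in> node_cover n k \<Longrightarrow> \<bar>s k i\<bar> = 1" and C: "1 \<le> C"
  shows "impartially_equivalent C (\<lambda>k. node_vector n (s k) k) haar_basis"
    and "impartially_equivalent C (\<lambda>k. node_functional n (s k) k) (biorthogonal haar_basis)"
proof -
  have iso: "norm (\<Sum>k<N. c k *\<^sub>R node_vector n (s k) k) = norm (\<Sum>k<N. c k *\<^sub>R haar_basis k)" for N c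
    unfolding node_vector_def by (rule norm_node_cover_sum[OF n s])
  show "impartially_equivalent C (\<lambda>k. node_vector n (s k) k) haar_basis"
    by (rule impartially_equivalent_isometric[OF iso C])
  show "impartially_equivalent C (\<lambda>k. node_functional n (s k) k) (biorthogonal haar_basis)"
    by (rule impartially_equivalent_isometric[OF dual_norm_isometric C],
        rule node_functional_vector[OF n s], assumption, simp add: iso, rule norm_node_projection_le[OF n s])
qed

text \<open>The coefficients \<open>c\<close> stand for the signs on the set that player (II) plays, extended by \<open>0\<close> to the whole level. The
  quantifier over all \<open>c\<close> comes last because player (I) chooses the signs after the level is fixed.\<close>

definition close_from :: "dyadic_H1 subspace_move \<Rightarrow> real \<Rightarrow> nat \<Rightarrow> bool" where
  "close_from p L N \<longleftrightarrow> (case p of (\<eta>, W, G) \<Rightarrow> \<forall>n\<ge>N. \<forall>c. (\<forall>i. \<bar>c i\<bar> \<le> 1) \<longrightarrow>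
    infdist (\<Sum>i | dyadic_level i = n. (c i * (L / 2 ^ n)) *\<^sub>R haar_basis i) W < \<eta> \<and>
    infdist (\<Sum>i | dyadic_level i = n. c i *\<^sub>R biorthogonal haar_basis i) G < \<eta>)"

text \<open>The summand \<open>k\<close> makes the levels strictly increasing, and the sum puts them beyond the threshold of the current
  move, while the level at turn \<open>k\<close> depends only on the moves up to turn \<open>k\<close>. The factor
  \<open>2 ^ dyadic_level k\<close> is the inverse of the length of the dyadic interval number \<open>k\<close>.\<close>

definition chosen_levels :: "(nat \<Rightarrow> dyadic_H1 subspace_move) \<Rightarrow> nat \<Rightarrow> nat" where
  "chosen_levels p k = k + (\<Sum>j\<le>k. SOME N. close_from (p j) (2 ^ dyadic_level j) N)"

text \<open>At turn \<open>k\<close> player (II) spreads the basis vector number \<open>k\<close> over the intervals of level \<open>n k\<close> that cover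
  the cell of \<open>k\<close>. Norms in \<open>H\<^sup>1\<close> do not see signs, so the reply depends on the subspace moves only.\<close>

definition haar_strategy :: "dyadic_H1 strategy" where
  "haar_strategy ps ss = (let n = chosen_levels (\<lambda>j. ps ! j); k = length ss in
     (node_cover n k, \<lambda>i. 2 ^ dyadic_level k / 2 ^ n k, \<lambda>i. 1))"

lemma strict_mono_chosen_levels: "strict_mono (chosen_levels p)"
  unfolding strict_mono_Suc_iff by (simp add: chosen_levels_def)

lemma node_vector_close:
  assumes p: "legal_subspace_move (p k)" "p k = (\<eta>, W, G)" and s: "\<And>i. i \<in> node_cover n k \<Longrightarrow> \<bar>s i\<bar> = 1"
    and n: "n = chosen_levels p"
  shows "infdist (node_vector n s k) W < \<eta>" "infdist (node_functional n s k) G < \<eta>"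
proof -
  define N where "N = (SOME N. close_from (p k) (2 ^ dyadic_level k) N)"
  let ?c = "\<lambda>i. if i \<in> node_cover n k then s i else 0"
  have "\<exists>N. close_from (p k) (2 ^ dyadic_level k) N"
    using level_vectors_close[of \<eta> W G "2 ^ dyadic_level k"] p by (simp add: close_from_def)
  then have close: "close_from (p k) (2 ^ dyadic_level k) N" unfolding N_def by (rule someI_ex)
  have "N \<le> (\<Sum>j\<le>k. SOME N. close_from (p j) (2 ^ dyadic_level j) N)"
    unfolding N_def by (rule member_le_sum) auto
  then have le: "N \<le> n k" by (simp add: n chosen_levels_def)
  have bound: "\<forall>i. \<bar>?c i\<bar> \<le> 1" using s by simp
  have vector: "node_vector n s k = (\<Sum>i | dyadic_level i = n k. (?c i * (2 ^ dyadic_level k / 2 ^ n k)) *\<^sub>R haar_basis i)"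
    unfolding node_vector_def
    by (rule sum.mono_neutral_cong_left[OF finite_dyadic_level]) (auto simp: node_cover_def)
  have functional: "node_functional n s k = (\<Sum>i | dyadic_level i = n k. ?c i *\<^sub>R biorthogonal haar_basis i)"
    unfolding node_functional_def
    by (rule sum.mono_neutral_cong_left[OF finite_dyadic_level]) (auto simp: node_cover_def)
  show "infdist (node_vector n s k) W < \<eta>" "infdist (node_functional n s k) G < \<eta>"
    using close[unfolded close_from_def p(2) prod.case, rule_format, OF le, of ?c] bound
    unfolding vector functional by blast+
qed

lemma reply_haar_strategy:
  "reply haar_strategy p s k = (node_cover (chosen_levels p) k, \<lambda>i. 2 ^ dyadic_level k / 2 ^ chosen_levels p k, \<lambda>i. 1)"
proof -
  let ?q = "\<lambda>j. map p [0..<Suc k] ! j"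
  have eq: "chosen_levels ?q j = chosen_levels p j" if "j \<le> k" for j
  proof -
    have "?q l = p l" if "l \<le> j" for l using that \<open>j \<le> k\<close> by (simp del: upt_Suc)
    then show ?thesis by (simp add: chosen_levels_def del: upt_Suc)
  qed
  have "cell (chosen_levels ?q) k = cell (chosen_levels p) k" by (rule cell_cong) (simp only: eq less_imp_le)
  then have "node_cover (chosen_levels ?q) k = node_cover (chosen_levels p) k"
    by (simp only: node_cover_def eq[OF order_refl])
  then show ?thesis
    by (simp add: reply_def haar_strategy_def Let_def eq del: upt_Suc)
qed

lemma haar_strategy_winning:
  assumes C: "1 \<le> C"
  shows "winning_strategy haar_basis C haar_strategy"
  unfolding winning_strategy_def
proof (intro allI impI, elim conjE)
  fix p :: "nat \<Rightarrow> dyadic_H1 subspace_move" and s :: "nat \<Rightarrow> sign_move"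
  assume p: "\<forall>k. legal_subspace_move (p k)"
    and legal: "\<forall>k. legal_sign_move (reply haar_strategy p s k) (s k)"
  define n where "n = chosen_levels p"
  have n: "strict_mono n" unfolding n_def by (rule strict_mono_chosen_levels)
  have reply: "reply haar_strategy p s k = (node_cover n k, \<lambda>i. 2 ^ dyadic_level k / 2 ^ n k, \<lambda>i. 1)" for k
    by (simp add: reply_haar_strategy n_def)
  have s: "\<bar>s k i\<bar> = 1" if "i \<in> node_cover n k" for k i
  proof -
    have "legal_sign_move (node_cover n k, \<lambda>i. 2 ^ dyadic_level k / 2 ^ n k, \<lambda>i. 1) (s k)"
      using legal[rule_format, of k] unfolding reply .
    then have "s k \<in> node_cover n k \<rightarrow>\<^sub>E {-1, 1}" by (simp only: legal_sign_move.simps)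
    then have "s k i \<in> {-1, 1}" using that by (rule PiE_mem)
    then show ?thesis by auto
  qed
  have vector: "played_vector haar_basis (reply haar_strategy p s k) (s k) = node_vector n (s k) k" for k
    by (simp add: reply node_vector_def)
  have functional: "played_functional haar_basis (reply haar_strategy p s k) (s k) = node_functional n (s k) k" for k
    by (simp add: reply node_functional_def)
  show "(\<forall>k. legal_vector_move (reply haar_strategy p s k)) \<and> player_II_wins haar_basis C p (reply haar_strategy p s) s"
  proof
    show "\<forall>k. legal_vector_move (reply haar_strategy p s k)"
      by (simp add: reply finite_node_cover card_node_cover[OF strict_mono_ancestor_mono[OF n]])
    have "case p k of (\<eta>, W, G) \<Rightarrow> infdist (node_vector n (s k) k) W < \<eta> \<and> infdist (node_functional n (s k) k) G < \<eta>" for k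
      using node_vector_close[of p k _ _ _ n "s k", OF p[rule_format] _ s n_def]
      by (cases "p k") auto
    then show "player_II_wins haar_basis C p (reply haar_strategy p s) s"
      unfolding player_II_wins_def Let_def vector functional
      using node_systems_equivalent[OF n s C] by simp
  qed
qed

text \<open>Player (II) wins with isometric copies, so the constant is \<open>1\<close>.\<close>

theorem theorem5p2:
  shows "strategically_reproducible haar_basis"
  unfolding strategically_reproducible_def strategically_reproducible_with_def
proof (intro exI[of _ 1] conjI allI impI unconditional_basis_haar)
  fix \<eta> :: real assume "0 < \<eta>"
  then show "\<exists>\<sigma>. winning_strategy haar_basis (1 + \<eta>) \<sigma>"
    using haar_strategy_winning[of "1 + \<eta>"] by auto
qed simp

end
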